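(* Let $M$ be a Hausdorff, locally compact, separable space with a continuous action $\alpha$ of $\mathbb{T}^n$, and suppose the canonical projection $J:M\to\Delta=M/\mathbb{T}^n$ admits a continuous section. For every continuous section $\sigma:\Delta\to M$ of $J$ and all $k\in\mathbb{Z}^n$, the set $M_k=J^{-1}(\Delta(k))$ is open in $M$ and the function $k_\sigma:M_k\to\mathbb{T}$ is continuous. Moreover, for every continuous section $\sigma$, there is an isomorphism of $C^*$-algebras $\mathcal{I}:C_0(M)\to C^*(G_0)$ such that, for every $f\in C_c(G_0)$ and $x\in M$, $$(\mathcal{I}^{-1}f)(x)=\sum_{k\in\widehat{\mathbb{T}^n/\mathbb{T}^n_y}} f(J(x),k)\,k_\sigma(x),\qquad\text{where } y=J(x).$$
   Context: $\mathbb{T}=\{z\in\mathbb{C}:|z|=1\}$; "separable" means second countable. The action is written $(s,x)\mapsto\alpha_s(x)$. For $y\in\Delta$, $\mathbb{T}^n_y=\{s\in\mathbb{T}^n:\alpha_s(x)=x\}$ is the common isotropy subgroup of all $x\in M$ with $J(x)=y$. For $k\in\mathbb{Z}^n$, $s\in\mathbb{T}^n$, $\langle k,s\rangle=s_1^{k_1}\cdots s_n^{k_n}$. The Pontryagin dual $\widehat{\mathbb{T}^n/\mathbb{T}^n_y}$ is identified with the subgroup $\{k\in\mathbb{Z}^n:\langle k,s\rangle=1\ \forall s\in\mathbb{T}^n_y\}$ of $\mathbb{Z}^n=\widehat{\mathbb{T}^n}$. Set $\Delta(k)=\{y\in\Delta: s\in\mathbb{T}^n_y\Rightarrow\langle k,s\rangle=1\}$.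 $G_0=\bigcup_{y\in\Delta}\widehat{\mathbb{T}^n/\mathbb{T}^n_y}=\bigcup_{k\in\mathbb{Z}^n}\Delta(k)\times\{k\}\subset\Delta\times\mathbb{Z}^n$, with the topology induced by $\Delta\times\mathbb{Z}^n$, is a bundle of commutative groups over $\Delta$ (a groupoid with $r=s$ the projection to $\Delta$); it is étale when $J$ has a continuous section, and $C^*(G_0)$ denotes its groupoid $C^*$-algebra (for the counting-measure Haar system), in which $C_c(G_0)$ is a dense $*$-subalgebra. Given a continuous section $\sigma$ of $J$, put $\rho(y,s)=\alpha_s(\sigma(y))$ for $(y,s)\in\Delta\times\mathbb{T}^n$; then $M_k=\rho(\Delta(k)\times\mathbb{T}^n)=J^{-1}(\Delta(k))$ and $k_\sigma:M_k\to\mathbb{T}$ is the well-defined function with $k_\sigma(\rho(y,s))=\langle k,s\rangle$ for $y\in\Delta(k)$, $s\in\mathbb{T}^n$. *)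

theory Defs
  imports "HOL-Analysis.Analysis"
begin

section \<open>Star-algebras, C*-algebras and completions\<close>

record 'a star_algebra =
  sa_carrier :: "'a set"
  sa_zero :: 'a
  sa_add :: "'a \<Rightarrow> 'a \<Rightarrow> 'a"
  sa_scale :: "complex \<Rightarrow> 'a \<Rightarrow> 'a"
  sa_mult :: "'a \<Rightarrow> 'a \<Rightarrow> 'a"
  sa_star :: "'a \<Rightarrow> 'a"
  sa_norm :: "'a \<Rightarrow> real"

definition sa_dist :: "('a, 'z) star_algebra_scheme \<Rightarrow> 'a \<Rightarrow> 'a \<Rightarrow> real" where
  "sa_dist A x y = sa_norm A (sa_add A x (sa_scale A (-1) y))"

definition sa_Cauchy :: "('a, 'z) star_algebra_scheme \<Rightarrow> (nat \<Rightarrow> 'a) \<Rightarrow> bool" where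
  "sa_Cauchy A c \<longleftrightarrow> (\<forall>n. c n \<in> sa_carrier A) \<and>
     (\<forall>e>0. \<exists>N. \<forall>m\<ge>N. \<forall>n\<ge>N. sa_dist A (c m) (c n) < e)"

locale cstar_algebra =
  fixes A :: "('a, 'z) star_algebra_scheme"
  assumes zero_closed: "sa_zero A \<in> sa_carrier A"
    and add_closed: "\<lbrakk>x \<in> sa_carrier A; y \<in> sa_carrier A\<rbrakk> \<Longrightarrow> sa_add A x y \<in> sa_carrier A"
    and scale_closed: "x \<in> sa_carrier A \<Longrightarrow> sa_scale A c x \<in> sa_carrier A"
    and mult_closed: "\<lbrakk>x \<in> sa_carrier A; y \<in> sa_carrier A\<rbrakk> \<Longrightarrow> sa_mult A x y \<in> sa_carrier A"
    and star_closed: "x \<in> sa_carrier A \<Longrightarrow> sa_star A x \<in> sa_carrier A"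
    and add_assoc: "\<lbrakk>x \<in> sa_carrier A; y \<in> sa_carrier A; z \<in> sa_carrier A\<rbrakk>
      \<Longrightarrow> sa_add A (sa_add A x y) z = sa_add A x (sa_add A y z)"
    and add_commute: "\<lbrakk>x \<in> sa_carrier A; y \<in> sa_carrier A\<rbrakk> \<Longrightarrow> sa_add A x y = sa_add A y x"
    and add_zero: "x \<in> sa_carrier A \<Longrightarrow> sa_add A x (sa_zero A) = x"
    and add_minus: "x \<in> sa_carrier A \<Longrightarrow> sa_add A x (sa_scale A (-1) x) = sa_zero A"
    and scale_one: "x \<in> sa_carrier A \<Longrightarrow> sa_scale A 1 x = x"
    and scale_scale: "x \<in> sa_carrier A \<Longrightarrow> sa_scale A c (sa_scale A d x) = sa_scale A (c * d) x"
    and scale_add_left: "x \<in> sa_carrier A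
      \<Longrightarrow> sa_scale A (c + d) x = sa_add A (sa_scale A c x) (sa_scale A d x)"
    and scale_add_right: "\<lbrakk>x \<in> sa_carrier A; y \<in> sa_carrier A\<rbrakk>
      \<Longrightarrow> sa_scale A c (sa_add A x y) = sa_add A (sa_scale A c x) (sa_scale A c y)"
    and mult_assoc: "\<lbrakk>x \<in> sa_carrier A; y \<in> sa_carrier A; z \<in> sa_carrier A\<rbrakk>
      \<Longrightarrow> sa_mult A (sa_mult A x y) z = sa_mult A x (sa_mult A y z)"
    and mult_add_left: "\<lbrakk>x \<in> sa_carrier A; y \<in> sa_carrier A; z \<in> sa_carrier A\<rbrakk>
      \<Longrightarrow> sa_mult A (sa_add A x y) z = sa_add A (sa_mult A x z) (sa_mult A y z)"
    and mult_add_right: "\<lbrakk>x \<in> sa_carrier A; y \<in> sa_carrier A; z \<in> sa_carrier A\<rbrakk>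
      \<Longrightarrow> sa_mult A x (sa_add A y z) = sa_add A (sa_mult A x y) (sa_mult A x z)"
    and mult_scale_left: "\<lbrakk>x \<in> sa_carrier A; y \<in> sa_carrier A\<rbrakk>
      \<Longrightarrow> sa_mult A (sa_scale A c x) y = sa_scale A c (sa_mult A x y)"
    and mult_scale_right: "\<lbrakk>x \<in> sa_carrier A; y \<in> sa_carrier A\<rbrakk>
      \<Longrightarrow> sa_mult A x (sa_scale A c y) = sa_scale A c (sa_mult A x y)"
    and star_star: "x \<in> sa_carrier A \<Longrightarrow> sa_star A (sa_star A x) = x"
    and star_add: "\<lbrakk>x \<in> sa_carrier A; y \<in> sa_carrier A\<rbrakk>
      \<Longrightarrow> sa_star A (sa_add A x y) = sa_add A (sa_star A x) (sa_star A y)"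
    and star_scale: "x \<in> sa_carrier A
      \<Longrightarrow> sa_star A (sa_scale A c x) = sa_scale A (cnj c) (sa_star A x)"
    and star_mult: "\<lbrakk>x \<in> sa_carrier A; y \<in> sa_carrier A\<rbrakk>
      \<Longrightarrow> sa_star A (sa_mult A x y) = sa_mult A (sa_star A y) (sa_star A x)"
    and norm_nonneg: "x \<in> sa_carrier A \<Longrightarrow> 0 \<le> sa_norm A x"
    and norm_eq_zero: "x \<in> sa_carrier A \<Longrightarrow> sa_norm A x = 0 \<longleftrightarrow> x = sa_zero A"
    and norm_triangle: "\<lbrakk>x \<in> sa_carrier A; y \<in> sa_carrier A\<rbrakk>
      \<Longrightarrow> sa_norm A (sa_add A x y) \<le> sa_norm A x + sa_norm A y"
    and norm_scale: "x \<in> sa_carrier A \<Longrightarrow> sa_norm A (sa_scale A c x) = cmod c * sa_norm A x"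
    and norm_mult: "\<lbrakk>x \<in> sa_carrier A; y \<in> sa_carrier A\<rbrakk>
      \<Longrightarrow> sa_norm A (sa_mult A x y) \<le> sa_norm A x * sa_norm A y"
    and cstar_identity: "x \<in> sa_carrier A \<Longrightarrow> sa_norm A (sa_mult A (sa_star A x) x) = (sa_norm A x)\<^sup>2"
    and complete: "sa_Cauchy A u \<Longrightarrow> \<exists>x\<in>sa_carrier A. (\<lambda>n. sa_dist A (u n) x) \<longlonglongrightarrow> 0"

text \<open>A bijective star-homomorphism between C*-algebras; it is automatically isometric.\<close>

definition cstar_isomorphism ::
  "('a, 'y) star_algebra_scheme \<Rightarrow> ('b, 'z) star_algebra_scheme \<Rightarrow> ('a \<Rightarrow> 'b) \<Rightarrow> bool" where
  "cstar_isomorphism A B \<phi> \<longleftrightarrow>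
     cstar_algebra A \<and> cstar_algebra B \<and>
     bij_betw \<phi> (sa_carrier A) (sa_carrier B) \<and>
     (\<forall>x\<in>sa_carrier A. \<forall>y\<in>sa_carrier A. \<phi> (sa_add A x y) = sa_add B (\<phi> x) (\<phi> y)) \<and>
     (\<forall>c. \<forall>x\<in>sa_carrier A. \<phi> (sa_scale A c x) = sa_scale B c (\<phi> x)) \<and>
     (\<forall>x\<in>sa_carrier A. \<forall>y\<in>sa_carrier A. \<phi> (sa_mult A x y) = sa_mult B (\<phi> x) (\<phi> y)) \<and>
     (\<forall>x\<in>sa_carrier A. \<phi> (sa_star A x) = sa_star B (\<phi> x))"

text \<open>The (separated) completion of a star-algebra with a submultiplicative, star-invariant
  seminorm: Cauchy sequences modulo null sequences, with operations computed on representatives.\<close>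

definition cauchy_class :: "('a, 'z) star_algebra_scheme \<Rightarrow> (nat \<Rightarrow> 'a) \<Rightarrow> (nat \<Rightarrow> 'a) set" where
  "cauchy_class A c = {d. sa_Cauchy A d \<and> (\<lambda>n. sa_dist A (c n) (d n)) \<longlonglongrightarrow> 0}"

definition class_rep :: "(nat \<Rightarrow> 'a) set \<Rightarrow> nat \<Rightarrow> 'a" where
  "class_rep U = (SOME c. c \<in> U)"

definition sa_completion :: "('a, 'z) star_algebra_scheme \<Rightarrow> (nat \<Rightarrow> 'a) set star_algebra" where
  "sa_completion A =
    \<lparr> sa_carrier = {cauchy_class A c |c. sa_Cauchy A c},
      sa_zero = cauchy_class A (\<lambda>_. sa_zero A),
      sa_add = (\<lambda>U V. cauchy_class A (\<lambda>n. sa_add A (class_rep U n) (class_rep V n))),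
      sa_scale = (\<lambda>a U. cauchy_class A (\<lambda>n. sa_scale A a (class_rep U n))),
      sa_mult = (\<lambda>U V. cauchy_class A (\<lambda>n. sa_mult A (class_rep U n) (class_rep V n))),
      sa_star = (\<lambda>U. cauchy_class A (\<lambda>n. sa_star A (class_rep U n))),
      sa_norm = (\<lambda>U. lim (\<lambda>n. sa_norm A (class_rep U n))) \<rparr>"

definition to_completion :: "('a, 'z) star_algebra_scheme \<Rightarrow> 'a \<Rightarrow> (nat \<Rightarrow> 'a) set" where
  "to_completion A x = cauchy_class A (\<lambda>_. x)"


section \<open>Function spaces\<close>

text \<open>Functions on a topological space are represented by total functions that vanish outside
  the underlying set.  In the norms below, the extra element 0 only matters for the empty space,
  where the supremum would otherwise be taken over the empty set.\<close>

definition Cc :: "'a topology \<Rightarrow> ('a \<Rightarrow> complex) set" where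
  "Cc X = {f. continuous_map X euclidean f \<and> (\<forall>x. x \<notin> topspace X \<longrightarrow> f x = 0) \<and>
              compactin X (X closure_of {x \<in> topspace X. f x \<noteq> 0})}"

definition C0 :: "'a topology \<Rightarrow> ('a \<Rightarrow> complex) star_algebra" where
  "C0 X =
    \<lparr> sa_carrier = {f. continuous_map X euclidean f \<and> (\<forall>x. x \<notin> topspace X \<longrightarrow> f x = 0) \<and>
                       (\<forall>e>0. compactin X {x \<in> topspace X. e \<le> cmod (f x)})},
      sa_zero = (\<lambda>x. 0),
      sa_add = (\<lambda>f g x. f x + g x),
      sa_scale = (\<lambda>c f x. c * f x),
      sa_mult = (\<lambda>f g x. f x * g x),
      sa_star = (\<lambda>f x. cnj (f x)),
      sa_norm = (\<lambda>f. Sup (insert 0 ((\<lambda>x. cmod (f x)) ` topspace X))) \<rparr>"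


section \<open>The C*-algebra of an etale groupoid\<close>

text \<open>A topological groupoid with arrows in \<^typ>\<open>'g\<close> and units in \<^typ>\<open>'u\<close>; the set of arrows is
  the underlying set of \<open>gtop\<close>, and \<open>gmul a b\<close> is meaningful when \<open>src a = rng b\<close>.\<close>

record ('g, 'u) groupoid =
  gtop :: "'g topology"
  rng :: "'g \<Rightarrow> 'u"
  src :: "'g \<Rightarrow> 'u"
  gmul :: "'g \<Rightarrow> 'g \<Rightarrow> 'g"
  ginv :: "'g \<Rightarrow> 'g"

text \<open>For \<open>f, g\<close> in \<open>Cc (gtop G)\<close> and \<open>G\<close> etale, all sums over fibres below (counting measure)
  have finitely many nonzero terms.  They are written as \<^const>\<open>infsum\<close> because the index sets may be
  infinite, where \<^const>\<open>sum\<close> would be 0.\<close>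

definition convolution ::
  "('g, 'u, 'z) groupoid_scheme \<Rightarrow> ('g \<Rightarrow> complex) \<Rightarrow> ('g \<Rightarrow> complex) \<Rightarrow> 'g \<Rightarrow> complex" where
  "convolution G f g = (\<lambda>\<gamma>. \<Sum>\<^sub>\<infinity>(a, b) \<in> {(a, b). a \<in> topspace (gtop G) \<and> b \<in> topspace (gtop G) \<and>
                                          src G a = rng G b \<and> gmul G a b = \<gamma>}. f a * g b)"

definition involution :: "('g, 'u, 'z) groupoid_scheme \<Rightarrow> ('g \<Rightarrow> complex) \<Rightarrow> 'g \<Rightarrow> complex" where
  "involution G f = (\<lambda>\<gamma>. if \<gamma> \<in> topspace (gtop G) then cnj (f (ginv G \<gamma>)) else 0)"

definition I_norm :: "('g, 'u, 'z) groupoid_scheme \<Rightarrow> ('g \<Rightarrow> complex) \<Rightarrow> real" where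
  "I_norm G f = Sup (insert 0
     ((\<lambda>u. \<Sum>\<^sub>\<infinity>\<gamma> \<in> {\<gamma> \<in> topspace (gtop G). rng G \<gamma> = u}. cmod (f \<gamma>)) ` (rng G ` topspace (gtop G)) \<union>
      (\<lambda>u. \<Sum>\<^sub>\<infinity>\<gamma> \<in> {\<gamma> \<in> topspace (gtop G). src G \<gamma> = u}. cmod (f \<gamma>)) ` (src G ` topspace (gtop G))))"

text \<open>Every separable complex Hilbert space is isometrically isomorphic to the space of square
  summable families indexed by some set \<open>S\<close> of natural numbers, realised here as a space of
  sequences supported in \<open>S\<close>.\<close>

definition ell2 :: "nat set \<Rightarrow> (nat \<Rightarrow> complex) set" where
  "ell2 S = {\<xi>. (\<forall>i. i \<notin> S \<longrightarrow> \<xi> i = 0) \<and> summable (\<lambda>i. (cmod (\<xi> i))\<^sup>2)}"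

definition ell2_inner :: "(nat \<Rightarrow> complex) \<Rightarrow> (nat \<Rightarrow> complex) \<Rightarrow> complex" where
  "ell2_inner \<xi> \<eta> = (\<Sum>i. cnj (\<xi> i) * \<eta> i)"

definition ell2_norm :: "(nat \<Rightarrow> complex) \<Rightarrow> real" where
  "ell2_norm \<xi> = sqrt (\<Sum>i. (cmod (\<xi> i))\<^sup>2)"

definition op_norm :: "nat set \<Rightarrow> ((nat \<Rightarrow> complex) \<Rightarrow> nat \<Rightarrow> complex) \<Rightarrow> real" where
  "op_norm S T = Sup {ell2_norm (T \<xi>) |\<xi>. \<xi> \<in> ell2 S \<and> ell2_norm \<xi> \<le> 1}"

text \<open>Star-representations of \<open>Cc (gtop G)\<close> by bounded operators on \<open>ell2 S\<close> that are bounded for the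
  I-norm.  Nondegeneracy is not required: cutting down to the essential subspace does not change
  the operator norms.\<close>

definition groupoid_rep ::
  "('g, 'u, 'z) groupoid_scheme \<Rightarrow> nat set \<Rightarrow> (('g \<Rightarrow> complex) \<Rightarrow> (nat \<Rightarrow> complex) \<Rightarrow> nat \<Rightarrow> complex) \<Rightarrow> bool"
where
  "groupoid_rep G S L \<longleftrightarrow>
     (\<forall>f\<in>Cc (gtop G). \<forall>\<xi>\<in>ell2 S. L f \<xi> \<in> ell2 S) \<and>
     (\<forall>f\<in>Cc (gtop G). \<forall>\<xi>\<in>ell2 S. \<forall>\<eta>\<in>ell2 S. L f (\<lambda>i. \<xi> i + \<eta> i) = (\<lambda>i. L f \<xi> i + L f \<eta> i)) \<and>
     (\<forall>f\<in>Cc (gtop G). \<forall>\<xi>\<in>ell2 S. \<forall>c. L f (\<lambda>i. c * \<xi> i) = (\<lambda>i. c * L f \<xi> i)) \<and>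
     (\<forall>f\<in>Cc (gtop G). \<forall>g\<in>Cc (gtop G). \<forall>\<xi>\<in>ell2 S.
        L (\<lambda>\<gamma>. f \<gamma> + g \<gamma>) \<xi> = (\<lambda>i. L f \<xi> i + L g \<xi> i)) \<and>
     (\<forall>f\<in>Cc (gtop G). \<forall>c. \<forall>\<xi>\<in>ell2 S. L (\<lambda>\<gamma>. c * f \<gamma>) \<xi> = (\<lambda>i. c * L f \<xi> i)) \<and>
     (\<forall>f\<in>Cc (gtop G). \<forall>g\<in>Cc (gtop G). \<forall>\<xi>\<in>ell2 S. L (convolution G f g) \<xi> = L f (L g \<xi>)) \<and>
     (\<forall>f\<in>Cc (gtop G). \<forall>\<xi>\<in>ell2 S. \<forall>\<eta>\<in>ell2 S.
        ell2_inner \<xi> (L f \<eta>) = ell2_inner (L (involution G f) \<xi>) \<eta>) \<and>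
     (\<forall>f\<in>Cc (gtop G). \<forall>\<xi>\<in>ell2 S. ell2_norm (L f \<xi>) \<le> I_norm G f * ell2_norm \<xi>)"

definition full_norm :: "('g, 'u, 'z) groupoid_scheme \<Rightarrow> ('g \<Rightarrow> complex) \<Rightarrow> real" where
  "full_norm G f = Sup {op_norm S (L f) |S L. groupoid_rep G S L}"

definition Cc_algebra :: "('g, 'u, 'z) groupoid_scheme \<Rightarrow> ('g \<Rightarrow> complex) star_algebra" where
  "Cc_algebra G =
    \<lparr> sa_carrier = Cc (gtop G),
      sa_zero = (\<lambda>\<gamma>. 0),
      sa_add = (\<lambda>f g \<gamma>. f \<gamma> + g \<gamma>),
      sa_scale = (\<lambda>c f \<gamma>. c * f \<gamma>),
      sa_mult = convolution G,
      sa_star = involution G,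
      sa_norm = full_norm G \<rparr>"

definition groupoid_cstar ::
  "('g, 'u, 'z) groupoid_scheme \<Rightarrow> (nat \<Rightarrow> 'g \<Rightarrow> complex) set star_algebra" where
  "groupoid_cstar G = sa_completion (Cc_algebra G)"

text \<open>The canonical map of \<open>Cc (gtop G)\<close> onto a dense subalgebra of the groupoid C*-algebra.\<close>

definition Cc_to_cstar ::
  "('g, 'u, 'z) groupoid_scheme \<Rightarrow> ('g \<Rightarrow> complex) \<Rightarrow> (nat \<Rightarrow> 'g \<Rightarrow> complex) set" where
  "Cc_to_cstar G = to_completion (Cc_algebra G)"


section \<open>Torus actions\<close>

text \<open>The group operation of the torus is the componentwise product of \<^typ>\<open>complex^'n\<close>.\<close>

definition torus :: "(complex^'n) set" where
  "torus = {s. \<forall>i. cmod (s $ i) = 1}"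

definition pairing :: "int^'n \<Rightarrow> complex^'n \<Rightarrow> complex" where
  "pairing k s = (\<Prod>i\<in>UNIV. (s $ i) powi (k $ i))"

locale torus_action =
  fixes X :: "'a topology" and \<alpha> :: "complex^'n \<Rightarrow> 'a \<Rightarrow> 'a"
  assumes continuous_action:
      "continuous_map (prod_topology (top_of_set torus) X) X (\<lambda>(s, x). \<alpha> s x)"
    and action_one: "x \<in> topspace X \<Longrightarrow> \<alpha> 1 x = x"
    and action_mult: "\<lbrakk>s \<in> torus; t \<in> torus; x \<in> topspace X\<rbrakk> \<Longrightarrow> \<alpha> (s * t) x = \<alpha> s (\<alpha> t x)"

text \<open>\<open>orbit \<alpha>\<close> is the canonical projection onto the orbit space, whose points are the orbits.\<close>

definition orbit :: "(complex^'n \<Rightarrow> 'a \<Rightarrow> 'a) \<Rightarrow> 'a \<Rightarrow> 'a set" where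
  "orbit \<alpha> x = (\<lambda>s. \<alpha> s x) ` torus"

definition orbit_space :: "'a topology \<Rightarrow> (complex^'n \<Rightarrow> 'a \<Rightarrow> 'a) \<Rightarrow> 'a set topology" where
  "orbit_space X \<alpha> = topology (\<lambda>U. U \<subseteq> orbit \<alpha> ` topspace X \<and>
                                  openin X {x \<in> topspace X. orbit \<alpha> x \<in> U})"

lemma openin_orbit_space:
  "openin (orbit_space X \<alpha>) U \<longleftrightarrow>
     U \<subseteq> orbit \<alpha> ` topspace X \<and> openin X {x \<in> topspace X. orbit \<alpha> x \<in> U}"
proof -
  have "istopology (\<lambda>U. U \<subseteq> orbit \<alpha> ` topspace X \<and> openin X {x \<in> topspace X. orbit \<alpha> x \<in> U})"
    (is "istopology ?P")
    unfolding istopology_def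
  proof (intro conjI allI impI)
    fix S T assume "?P S" "?P T"
    moreover have "{x \<in> topspace X. orbit \<alpha> x \<in> S \<inter> T} =
        {x \<in> topspace X. orbit \<alpha> x \<in> S} \<inter> {x \<in> topspace X. orbit \<alpha> x \<in> T}" by blast
    ultimately show "S \<inter> T \<subseteq> orbit \<alpha> ` topspace X"
      and "openin X {x \<in> topspace X. orbit \<alpha> x \<in> S \<inter> T}" by (auto intro: openin_Int)
  next
    fix \<K> assume K: "\<forall>K\<in>\<K>. ?P K"
    then show "\<Union>\<K> \<subseteq> orbit \<alpha> ` topspace X" by blast
    have "{x \<in> topspace X. orbit \<alpha> x \<in> \<Union>\<K>} = (\<Union>K\<in>\<K>. {x \<in> topspace X. orbit \<alpha> x \<in> K})" by blast
    then show "openin X {x \<in> topspace X. orbit \<alpha> x \<in> \<Union>\<K>}" using K by auto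
  qed
  then show ?thesis by (simp add: orbit_space_def topology_inverse')
qed

lemma quotient_map_orbit: "quotient_map X (orbit_space X \<alpha>) (orbit \<alpha>)"
proof -
  have "{x \<in> topspace X. orbit \<alpha> x \<in> orbit \<alpha> ` topspace X} = topspace X" by blast
  then have "openin (orbit_space X \<alpha>) (orbit \<alpha> ` topspace X)"
    by (simp add: openin_orbit_space)
  then have "topspace (orbit_space X \<alpha>) = orbit \<alpha> ` topspace X"
    by (meson openin_orbit_space openin_subset openin_topspace subset_antisym)
  then show ?thesis by (simp add: quotient_map_def openin_orbit_space)
qed

definition orbit_section ::
  "'a topology \<Rightarrow> (complex^'n \<Rightarrow> 'a \<Rightarrow> 'a) \<Rightarrow> ('a set \<Rightarrow> 'a) \<Rightarrow> bool" where
  "orbit_section X \<alpha> \<sigma> \<longleftrightarrow> continuous_map (orbit_space X \<alpha>) X \<sigma> \<and>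
     (\<forall>y\<in>topspace (orbit_space X \<alpha>). orbit \<alpha> (\<sigma> y) = y)"

definition isotropy ::
  "'a topology \<Rightarrow> (complex^'n \<Rightarrow> 'a \<Rightarrow> 'a) \<Rightarrow> 'a set \<Rightarrow> (complex^'n) set" where
  "isotropy X \<alpha> y = {s \<in> torus. \<forall>x\<in>topspace X. orbit \<alpha> x = y \<longrightarrow> \<alpha> s x = x}"

text \<open>The dual of the quotient of the torus by the isotropy group of \<open>y\<close>, as a group of characters.\<close>

definition isotropy_dual ::
  "'a topology \<Rightarrow> (complex^'n \<Rightarrow> 'a \<Rightarrow> 'a) \<Rightarrow> 'a set \<Rightarrow> (int^'n) set" where
  "isotropy_dual X \<alpha> y = {k. \<forall>s\<in>isotropy X \<alpha> y. pairing k s = 1}"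

definition Delta ::
  "'a topology \<Rightarrow> (complex^'n \<Rightarrow> 'a \<Rightarrow> 'a) \<Rightarrow> int^'n \<Rightarrow> 'a set set" where
  "Delta X \<alpha> k = {y \<in> topspace (orbit_space X \<alpha>). \<forall>s\<in>isotropy X \<alpha> y. pairing k s = 1}"

definition M_set :: "'a topology \<Rightarrow> (complex^'n \<Rightarrow> 'a \<Rightarrow> 'a) \<Rightarrow> int^'n \<Rightarrow> 'a set" where
  "M_set X \<alpha> k = {x \<in> topspace X. orbit \<alpha> x \<in> Delta X \<alpha> k}"

definition rho :: "(complex^'n \<Rightarrow> 'a \<Rightarrow> 'a) \<Rightarrow> ('a set \<Rightarrow> 'a) \<Rightarrow> 'a set \<Rightarrow> complex^'n \<Rightarrow> 'a" where
  "rho \<alpha> \<sigma> y s = \<alpha> s (\<sigma> y)"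

definition k_fun ::
  "'a topology \<Rightarrow> (complex^'n \<Rightarrow> 'a \<Rightarrow> 'a) \<Rightarrow> ('a set \<Rightarrow> 'a) \<Rightarrow> int^'n \<Rightarrow> 'a \<Rightarrow> complex" where
  "k_fun X \<alpha> \<sigma> k x =
     (THE c. \<exists>y\<in>Delta X \<alpha> k. \<exists>s\<in>torus. x = rho \<alpha> \<sigma> y s \<and> c = pairing k s)"

definition G0 ::
  "'a topology \<Rightarrow> (complex^'n \<Rightarrow> 'a \<Rightarrow> 'a) \<Rightarrow> ('a set \<times> (int^'n), 'a set) groupoid" where
  "G0 X \<alpha> =
    \<lparr> gtop = subtopology (prod_topology (orbit_space X \<alpha>) (discrete_topology UNIV))
               (\<Union>k. Delta X \<alpha> k \<times> {k}),
      rng = fst,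
      src = fst,
      gmul = (\<lambda>(y, k) (z, l). (y, k + l)),
      ginv = (\<lambda>(y, k). (y, - k)) \<rparr>"

end

theory Submission
  imports Defs
begin

text \<open>Over a point \<open>y\<close> of the orbit space, the fibre of the isotropy bundle is the group of those characters
\<open>k\<close> of the torus that are trivial on the isotropy group of \<open>y\<close>, and the orbit over \<open>y\<close>, trivialised by the
section \<open>\<sigma>\<close>, is the torus modulo that isotropy group, that is, the dual group of this fibre.  The
isomorphism is therefore a Fourier transform carried out fibre by fibre: \<open>f\<close> in \<open>Cc (gtop G)\<close> goes to the
function \<open>gelfand f x = (\<Sum>k. f (J x, k) * k_fun k x)\<close> on \<open>X\<close>, where \<open>J\<close> is the orbit map.  In
the coordinates \<open>x = \<alpha> s (\<sigma> y)\<close> it is the trigonometric polynomial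
\<open>\<Sum>k. f (y, k) * pairing k s\<close>.  This map is a star-homomorphism into \<open>C0 X\<close>.  It remains to see that it is
isometric for the full norm and that its range is dense; the completion of \<open>Cc (gtop G)\<close> is then
isomorphic to \<open>C0 X\<close> (\<open>completion_of_dense_isometry\<close>), and the inverse isomorphism extends \<open>gelfand\<close>.

The topological input is that projections along the compact torus are closed.  The complement of \<open>M_set k\<close>
is such a projection, because a nontrivial subgroup of the circle cannot stay within distance less than \<open>1\<close> of \<open>1\<close>
(\<open>openin_M\<close>); the preimages of closed sets under \<open>k_fun k\<close> are also such projections
(\<open>k_fun_cont\<close>).

The map is isometric (\<open>full_norm_eq\<close>) for the following reason.  Each point \<open>x\<close> gives the one-dimensional representation
\<open>f \<mapsto> gelfand f x\<close>, so the supremum norm of \<open>gelfand f\<close> is at most the full norm of \<open>f\<close>.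
Conversely let \<open>L\<close> be any representation and \<open>h = f\<^sup>* * f\<close>.  Self-adjointness gives
\<open>norm (L h \<xi>) ^ m \<le> norm (L (h ^ m) \<xi>)\<close> for unit vectors \<open>\<xi>\<close> and powers \<open>m\<close> of two, and the right-hand side is
at most the I-norm of the convolution power \<open>h ^ m\<close>.  That power is supported in a box of side \<open>O(m)\<close> of the
character lattice, and each of its coefficients, being a Fourier coefficient of the \<open>m\<close>-th power of
\<open>gelfand h\<close> on an orbit, is at most the \<open>m\<close>-th power of the supremum norm.  The I-norm thus grows at most
like a polynomial in \<open>m\<close> times the \<open>m\<close>-th power of the supremum norm, and \<open>m\<close>-th roots remove the polynomial.

For the density of the range (\<open>gelfand_dense\<close>), note that, restricted to one orbit, a function \<open>g\<close> in \<open>C0 X\<close> is a continuous function on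
the torus which is invariant under the isotropy group.  By the Stone-Weierstrass theorem it is close to a
trigonometric polynomial, and averaging over the isotropy group deletes the characters outside the
fibre of the bundle without spoiling the approximation (\<open>invariant_trig_approximation\<close>).  The resulting
polynomial also works on all neighbouring orbits, and a partition of unity on the orbit space glues these local
approximations to an element of \<open>Cc (gtop G)\<close>.\<close>

section \<open>Convergence and transport of structure in C*-algebras\<close>

context cstar_algebra
begin

lemma scale_zero: "sa_scale A c (sa_zero A) = sa_zero A"
  using norm_scale[OF zero_closed] norm_eq_zero[OF zero_closed] norm_eq_zero[OF scale_closed[OF zero_closed]]
  by simp

lemma zero_add: "x \<in> sa_carrier A \<Longrightarrow> sa_add A (sa_zero A) x = x"
  using add_commute add_zero zero_closed by metis

lemma add_minus_cancel:
  assumes "x \<in> sa_carrier A" "y \<in> sa_carrier A" "z \<in> sa_carrier A"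
  shows "sa_add A (sa_add A x (sa_scale A (-1) y)) (sa_add A y z) = sa_add A x z"
proof -
  have my: "sa_scale A (-1) y \<in> sa_carrier A" using assms scale_closed by blast
  have "sa_add A (sa_scale A (-1) y) (sa_add A y z) = z"
    using assms my by (metis add_assoc add_commute add_minus zero_add)
  then show ?thesis using assms my by (simp add: add_assoc add_closed)
qed

lemma sa_dist_nonneg: "\<lbrakk>x \<in> sa_carrier A; y \<in> sa_carrier A\<rbrakk> \<Longrightarrow> 0 \<le> sa_dist A x y"
  by (simp add: sa_dist_def norm_nonneg add_closed scale_closed)

lemma sa_dist_self: "x \<in> sa_carrier A \<Longrightarrow> sa_dist A x x = 0"
  by (simp add: sa_dist_def add_minus norm_eq_zero zero_closed)

lemma sa_dist_zero_right: "x \<in> sa_carrier A \<Longrightarrow> sa_dist A x (sa_zero A) = sa_norm A x"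
  by (simp add: sa_dist_def scale_zero add_zero)

lemma sa_dist_triangle:
  assumes "x \<in> sa_carrier A" "y \<in> sa_carrier A" "z \<in> sa_carrier A"
  shows "sa_dist A x z \<le> sa_dist A x y + sa_dist A y z"
proof -
  have "sa_add A x (sa_scale A (-1) z) =
        sa_add A (sa_add A x (sa_scale A (-1) y)) (sa_add A y (sa_scale A (-1) z))"
    using assms by (simp add: add_minus_cancel scale_closed)
  then show ?thesis
    unfolding sa_dist_def using assms norm_triangle by (simp add: add_closed scale_closed)
qed

lemma sa_dist_eq_0:
  assumes "x \<in> sa_carrier A" "y \<in> sa_carrier A" "sa_dist A x y = 0"
  shows "x = y"
proof -
  have *: "sa_add A x (sa_scale A (-1) y) = sa_zero A"
    using assms norm_eq_zero by (simp add: sa_dist_def add_closed scale_closed)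
  have "x = sa_add A (sa_add A x (sa_scale A (-1) y)) (sa_add A y (sa_zero A))"
    using assms by (metis add_minus_cancel zero_closed add_zero)
  then show ?thesis using * assms zero_add add_zero by simp
qed

lemma sa_dist_commute:
  assumes "x \<in> sa_carrier A" "y \<in> sa_carrier A"
  shows "sa_dist A x y = sa_dist A y x"
proof -
  have "sa_scale A (-1) (sa_add A x (sa_scale A (-1) y)) = sa_add A y (sa_scale A (-1) x)"
    using assms by (simp add: scale_add_right scale_closed scale_scale scale_one add_commute)
  then show ?thesis
    unfolding sa_dist_def
    using norm_scale[of "sa_add A x (sa_scale A (-1) y)" "-1"] assms
    by (simp add: add_closed scale_closed)
qed

lemma norm_diff_le_dist: 
  assumes "x \<in> sa_carrier A" "y \<in> sa_carrier A"
  shows "\<bar>sa_norm A x - sa_norm A y\<bar> \<le> sa_dist A x y"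
  using sa_dist_triangle[OF assms zero_closed] sa_dist_triangle[OF assms(2,1) zero_closed] 
    sa_dist_commute[OF assms] assms by (simp add: sa_dist_zero_right)

text \<open>The C*-identity and submultiplicativity give \<open>\<parallel>y\<parallel>\<^sup>2 \<le> \<parallel>y\<^sup>*\<parallel> \<parallel>y\<parallel>\<close> for every \<open>y\<close>; it is applied
to \<open>x\<close> and to its adjoint.\<close>

lemma norm_star:
  assumes x: "x \<in> sa_carrier A"
  shows "sa_norm A (sa_star A x) = sa_norm A x"
proof -
  have le: "sa_norm A y \<le> sa_norm A (sa_star A y)" if y: "y \<in> sa_carrier A" for y
  proof -
    have "(sa_norm A y)\<^sup>2 \<le> sa_norm A (sa_star A y) * sa_norm A y"
      using cstar_identity[OF y] norm_mult[OF star_closed[OF y] y] by simp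
    then show ?thesis
      using norm_nonneg[OF y] norm_nonneg[OF star_closed[OF y]]
      by (cases "sa_norm A y = 0") (auto simp: power2_eq_square)
  qed
  show ?thesis using le[OF x] le[OF star_closed[OF x]] star_star[OF x] by simp
qed

lemma sa_dist_add:
  assumes "x \<in> sa_carrier A" "y \<in> sa_carrier A" "x' \<in> sa_carrier A" "y' \<in> sa_carrier A"
  shows "sa_dist A (sa_add A x y) (sa_add A x' y') \<le> sa_dist A x x' + sa_dist A y y'"
proof -
  have mx: "sa_scale A (-1) x' \<in> sa_carrier A" and my: "sa_scale A (-1) y' \<in> sa_carrier A"
    using assms scale_closed by blast+
  have "sa_add A (sa_add A x y) (sa_add A (sa_scale A (-1) x') (sa_scale A (-1) y'))
      = sa_add A (sa_add A x (sa_scale A (-1) x')) (sa_add A y (sa_scale A (-1) y'))"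
    using assms mx my by (smt (verit) add_assoc add_commute add_closed)
  then show ?thesis
    unfolding sa_dist_def using assms norm_triangle
    by (simp add: scale_add_right add_closed scale_closed)
qed

lemma sa_dist_scale:
  assumes "x \<in> sa_carrier A" "y \<in> sa_carrier A"
  shows "sa_dist A (sa_scale A c x) (sa_scale A c y) = cmod c * sa_dist A x y"
proof -
  have "sa_add A (sa_scale A c x) (sa_scale A (-1) (sa_scale A c y)) =
        sa_scale A c (sa_add A x (sa_scale A (-1) y))"
    using assms by (simp add: scale_add_right scale_scale scale_closed)
  then show ?thesis unfolding sa_dist_def using assms by (simp add: norm_scale add_closed scale_closed)
qed

lemma sa_dist_star:
  assumes "x \<in> sa_carrier A" "y \<in> sa_carrier A"
  shows "sa_dist A (sa_star A x) (sa_star A y) = sa_dist A x y"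
proof -
  have "sa_add A (sa_star A x) (sa_scale A (-1) (sa_star A y)) =
        sa_star A (sa_add A x (sa_scale A (-1) y))"
    using assms by (simp add: star_add star_scale scale_closed)
  then show ?thesis unfolding sa_dist_def using assms by (simp add: norm_star add_closed scale_closed)
qed

lemma sa_dist_mult_left:
  assumes "x \<in> sa_carrier A" "y \<in> sa_carrier A" "z \<in> sa_carrier A"
  shows "sa_dist A (sa_mult A x y) (sa_mult A x z) \<le> sa_norm A x * sa_dist A y z"
proof -
  have "sa_add A (sa_mult A x y) (sa_scale A (-1) (sa_mult A x z)) =
        sa_mult A x (sa_add A y (sa_scale A (-1) z))"
    using assms by (simp add: mult_add_right mult_scale_right scale_closed)
  then show ?thesis unfolding sa_dist_def using assms norm_mult by (simp add: add_closed scale_closed)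
qed

lemma sa_dist_mult_right:
  assumes "x \<in> sa_carrier A" "y \<in> sa_carrier A" "z \<in> sa_carrier A"
  shows "sa_dist A (sa_mult A x z) (sa_mult A y z) \<le> sa_dist A x y * sa_norm A z"
proof -
  have "sa_add A (sa_mult A x z) (sa_scale A (-1) (sa_mult A y z)) =
        sa_mult A (sa_add A x (sa_scale A (-1) y)) z"
    using assms by (simp add: mult_add_left mult_scale_left scale_closed)
  then show ?thesis unfolding sa_dist_def using assms norm_mult by (simp add: add_closed scale_closed)
qed

definition converges :: "(nat \<Rightarrow> 'a) \<Rightarrow> 'a \<Rightarrow> bool" where
  "converges u x \<longleftrightarrow> (\<forall>n. u n \<in> sa_carrier A) \<and> x \<in> sa_carrier A \<and> (\<lambda>n. sa_dist A (u n) x) \<longlonglongrightarrow> 0"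

lemma convergesI_bound:
  assumes "\<And>n. u n \<in> sa_carrier A" "x \<in> sa_carrier A"
    and "\<And>n. sa_dist A (u n) x \<le> b n" "b \<longlonglongrightarrow> 0"
  shows "converges u x"
proof -
  have "(\<lambda>n. sa_dist A (u n) x) \<longlonglongrightarrow> 0"
    by (rule tendsto_sandwich[OF _ _ tendsto_const assms(4)])
       (use assms sa_dist_nonneg in auto)
  then show ?thesis using assms by (simp add: converges_def)
qed

lemma converges_const: "x \<in> sa_carrier A \<Longrightarrow> converges (\<lambda>_. x) x"
  by (simp add: converges_def sa_dist_self)

lemma converges_unique:
  assumes "converges u x" "converges u y" shows "x = y"
proof -
  have "(\<lambda>n. sa_dist A (u n) x + sa_dist A (u n) y) \<longlonglongrightarrow> 0 + 0"
    using assms unfolding converges_def by (intro tendsto_add) auto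
  moreover have "sa_dist A x y \<le> sa_dist A (u n) x + sa_dist A (u n) y" for n
    using assms sa_dist_triangle[of x "u n" y] sa_dist_commute[of x "u n"] by (simp add: converges_def)
  ultimately have "sa_dist A x y \<le> 0" by (intro LIMSEQ_le_const[where a = "sa_dist A x y"]) auto
  then show ?thesis using assms sa_dist_eq_0 sa_dist_nonneg by (simp add: converges_def order_antisym)
qed

lemma converges_close:
  assumes u: "converges u x" and v: "\<And>n. v n \<in> sa_carrier A" and uv: "(\<lambda>n. sa_dist A (u n) (v n)) \<longlonglongrightarrow> 0"
  shows "converges v x"
proof (rule convergesI_bound[OF v])
  show "sa_dist A (v n) x \<le> sa_dist A (u n) (v n) + sa_dist A (u n) x" for n
    using u v sa_dist_triangle[of "v n" "u n" x] sa_dist_commute[of "v n" "u n"] by (simp add: converges_def)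
  show "(\<lambda>n. sa_dist A (u n) (v n) + sa_dist A (u n) x) \<longlonglongrightarrow> 0"
    using tendsto_add[OF uv, of _ 0] u by (simp add: converges_def)
qed (use u in \<open>simp add: converges_def\<close>)

lemma converges_dist:
  assumes "converges u x" "converges v x"
  shows "(\<lambda>n. sa_dist A (u n) (v n)) \<longlonglongrightarrow> 0"
proof (rule tendsto_sandwich[OF _ _ tendsto_const])
  show "(\<lambda>n. sa_dist A (u n) x + sa_dist A (v n) x) \<longlonglongrightarrow> 0"
    using tendsto_add[of "\<lambda>n. sa_dist A (u n) x" 0] assms by (auto simp: converges_def)
  show "\<forall>\<^sub>F n in sequentially. sa_dist A (u n) (v n) \<le> sa_dist A (u n) x + sa_dist A (v n) x"
    using assms sa_dist_triangle[of "u _" x "v _"] sa_dist_commute[of x "v _"] by (simp add: converges_def)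
  show "\<forall>\<^sub>F n in sequentially. 0 \<le> sa_dist A (u n) (v n)"
    using assms sa_dist_nonneg by (simp add: converges_def)
qed

lemma converges_Cauchy:
  assumes "converges u x" shows "sa_Cauchy A u"
  unfolding sa_Cauchy_def
proof (intro conjI allI impI)
  show "u n \<in> sa_carrier A" for n using assms by (simp add: converges_def)
  fix e :: real assume "e > 0"
  then obtain N where N: "\<And>n. n \<ge> N \<Longrightarrow> \<bar>sa_dist A (u n) x\<bar> < e/2"
    using assms unfolding converges_def LIMSEQ_iff
    by (metis diff_zero half_gt_zero real_norm_def)
  have "sa_dist A (u m) (u n) < e" if "m \<ge> N" "n \<ge> N" for m n
    using N[OF that(1)] N[OF that(2)] assms sa_dist_triangle[of "u m" x "u n"] sa_dist_commute[of x "u n"]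
    by (simp add: converges_def)
  then show "\<exists>N. \<forall>m\<ge>N. \<forall>n\<ge>N. sa_dist A (u m) (u n) < e" by blast
qed

lemma converges_norm:
  assumes "converges u x" shows "(\<lambda>n. sa_norm A (u n)) \<longlonglongrightarrow> sa_norm A x"
proof (rule LIM_zero_cancel, rule tendsto_rabs_zero_cancel, rule tendsto_sandwich[OF _ _ tendsto_const])
  show "(\<lambda>n. sa_dist A (u n) x) \<longlonglongrightarrow> 0" using assms by (simp add: converges_def)
  show "\<forall>\<^sub>F n in sequentially. \<bar>sa_norm A (u n) - sa_norm A x\<bar> \<le> sa_dist A (u n) x"
    using assms norm_diff_le_dist by (simp add: converges_def)
qed simp

lemma converges_add:
  assumes "converges u x" "converges v y"
  shows "converges (\<lambda>n. sa_add A (u n) (v n)) (sa_add A x y)"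
proof (rule convergesI_bound)
  show "sa_dist A (sa_add A (u n) (v n)) (sa_add A x y) \<le> sa_dist A (u n) x + sa_dist A (v n) y" for n
    using assms sa_dist_add by (simp add: converges_def)
  show "(\<lambda>n. sa_dist A (u n) x + sa_dist A (v n) y) \<longlonglongrightarrow> 0"
    using tendsto_add[of "\<lambda>n. sa_dist A (u n) x" 0] assms by (auto simp: converges_def)
qed (use assms add_closed in \<open>auto simp: converges_def\<close>)

lemma converges_scale:
  assumes "converges u x"
  shows "converges (\<lambda>n. sa_scale A c (u n)) (sa_scale A c x)"
proof (rule convergesI_bound)
  show "sa_dist A (sa_scale A c (u n)) (sa_scale A c x) \<le> cmod c * sa_dist A (u n) x" for n
    using assms sa_dist_scale by (simp add: converges_def)
  show "(\<lambda>n. cmod c * sa_dist A (u n) x) \<longlonglongrightarrow> 0"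
    using tendsto_mult_left[of "\<lambda>n. sa_dist A (u n) x" 0] assms by (auto simp: converges_def)
qed (use assms scale_closed in \<open>auto simp: converges_def\<close>)

lemma converges_star:
  assumes "converges u x"
  shows "converges (\<lambda>n. sa_star A (u n)) (sa_star A x)"
  using assms star_closed sa_dist_star by (simp add: converges_def)

lemma converges_mult:
  assumes "converges u x" "converges v y"
  shows "converges (\<lambda>n. sa_mult A (u n) (v n)) (sa_mult A x y)"
proof (rule convergesI_bound)
  have c: "\<And>n. u n \<in> sa_carrier A" "\<And>n. v n \<in> sa_carrier A" "x \<in> sa_carrier A" "y \<in> sa_carrier A"
    using assms by (auto simp: converges_def)
  show "sa_dist A (sa_mult A (u n) (v n)) (sa_mult A x y) \<le>
        sa_norm A (u n) * sa_dist A (v n) y + sa_dist A (u n) x * sa_norm A y" for n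
    using sa_dist_triangle[of "sa_mult A (u n) (v n)" "sa_mult A (u n) y" "sa_mult A x y"]
      sa_dist_mult_left[of "u n" "v n" y] sa_dist_mult_right[of "u n" x y] c
    by (simp add: mult_closed)
  have "(\<lambda>n. sa_norm A (u n) * sa_dist A (v n) y + sa_dist A (u n) x * sa_norm A y) \<longlonglongrightarrow>
        sa_norm A x * 0 + 0 * sa_norm A y"
    using assms converges_norm[OF assms(1)] unfolding converges_def by (intro tendsto_intros) auto
  then show "(\<lambda>n. sa_norm A (u n) * sa_dist A (v n) y + sa_dist A (u n) x * sa_norm A y) \<longlonglongrightarrow> 0" by simp
qed (use assms mult_closed in \<open>auto simp: converges_def\<close>)

end

text \<open>The completion acquires its C*-structure from \<open>C0 X\<close> by this lemma, so that none of the axioms has to be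
verified on classes of Cauchy sequences.\<close>

lemma cstar_algebra_transport:
  assumes B: "cstar_algebra B"
    and bij: "bij_betw \<psi> (sa_carrier B) (sa_carrier C)"
    and zero: "\<psi> (sa_zero B) = sa_zero C"
    and add: "\<And>x y. \<lbrakk>x \<in> sa_carrier B; y \<in> sa_carrier B\<rbrakk> \<Longrightarrow> sa_add C (\<psi> x) (\<psi> y) = \<psi> (sa_add B x y)"
    and scale: "\<And>c x. x \<in> sa_carrier B \<Longrightarrow> sa_scale C c (\<psi> x) = \<psi> (sa_scale B c x)"
    and mult: "\<And>x y. \<lbrakk>x \<in> sa_carrier B; y \<in> sa_carrier B\<rbrakk> \<Longrightarrow> sa_mult C (\<psi> x) (\<psi> y) = \<psi> (sa_mult B x y)"
    and star: "\<And>x. x \<in> sa_carrier B \<Longrightarrow> sa_star C (\<psi> x) = \<psi> (sa_star B x)"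
    and norm: "\<And>x. x \<in> sa_carrier B \<Longrightarrow> sa_norm C (\<psi> x) = sa_norm B x"
  shows "cstar_algebra C"
proof -
  interpret cstar_algebra B by (rule B)
  have car: "sa_carrier C = \<psi> ` sa_carrier B" using bij by (simp add: bij_betw_def)
  have inj: "\<psi> x = \<psi> y \<longleftrightarrow> x = y" if "x \<in> sa_carrier B" "y \<in> sa_carrier B" for x y
    using bij that by (auto simp: bij_betw_def inj_on_eq_iff)
  note closed = zero_closed add_closed scale_closed mult_closed star_closed
  note tr = car zero[symmetric] add scale mult star norm closed inj
  have dist: "sa_dist C (\<psi> x) (\<psi> y) = sa_dist B x y" if "x \<in> sa_carrier B" "y \<in> sa_carrier B" for x y
    using that by (simp add: sa_dist_def tr)
  \<comment> \<open>Left commutativity lets the simplifier decide the associativity and commutativity axioms by normalisation.\<close>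
  have left_commute: "sa_add B x (sa_add B y z) = sa_add B y (sa_add B x z)"
    if "x \<in> sa_carrier B" "y \<in> sa_carrier B" "z \<in> sa_carrier B" for x y z
    using that by (metis add_assoc add_commute)
  show ?thesis
  proof (unfold_locales, goal_cases)
    case (29 u)
    define v where "v n = inv_into (sa_carrier B) \<psi> (u n)" for n
    have v: "v n \<in> sa_carrier B" "\<psi> (v n) = u n" for n
      using 29 unfolding sa_Cauchy_def v_def car by (auto simp: inv_into_into f_inv_into_f)
    have "sa_dist C (u m) (u n) = sa_dist B (v m) (v n)" for m n
      using dist[OF v(1) v(1)] v(2) by metis
    then have "sa_Cauchy B v" using 29 v by (simp add: sa_Cauchy_def)
    then obtain x where x: "x \<in> sa_carrier B" "(\<lambda>n. sa_dist B (v n) x) \<longlonglongrightarrow> 0" using complete by blast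
    have "sa_dist C (u n) (\<psi> x) = sa_dist B (v n) x" for n using dist[OF v(1) x(1)] v(2) by simp
    then have "(\<lambda>n. sa_dist C (u n) (\<psi> x)) \<longlonglongrightarrow> 0" using x(2) by simp
    then show ?case using x(1) car by blast
  qed (auto simp: tr add_assoc add_commute left_commute add_zero add_minus scale_one scale_scale scale_add_left
      scale_add_right mult_assoc mult_add_left mult_add_right mult_scale_left mult_scale_right star_star
      star_add star_scale star_mult norm_nonneg norm_eq_zero norm_triangle norm_scale norm_mult
      cstar_identity)
qed

text \<open>The completion is described by limits: the isomorphism sends \<open>b\<close> to the set of all sequences \<open>d\<close> in \<open>A\<close> with
\<open>\<Phi> (d n) \<longrightarrow> b\<close>.  This set is a single class of Cauchy sequences because \<open>\<Phi>\<close> preserves distances, it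
is nonempty because the range of \<open>\<Phi>\<close> is dense, and every class arises because \<open>B\<close> is complete.  The operations of the
completion are compatible with this map because those of \<open>B\<close> are continuous, whatever representatives are chosen.\<close>

lemma completion_of_dense_isometry:
  fixes A :: "'a star_algebra" and B :: "'b star_algebra" and \<Phi> :: "'a \<Rightarrow> 'b"
  assumes B: "cstar_algebra B"
    and A_zero: "sa_zero A \<in> sa_carrier A"
    and A_add: "\<And>x y. \<lbrakk>x \<in> sa_carrier A; y \<in> sa_carrier A\<rbrakk> \<Longrightarrow> sa_add A x y \<in> sa_carrier A"
    and A_scale: "\<And>c x. x \<in> sa_carrier A \<Longrightarrow> sa_scale A c x \<in> sa_carrier A"
    and A_mult: "\<And>x y. \<lbrakk>x \<in> sa_carrier A; y \<in> sa_carrier A\<rbrakk> \<Longrightarrow> sa_mult A x y \<in> sa_carrier A"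
    and A_star: "\<And>x. x \<in> sa_carrier A \<Longrightarrow> sa_star A x \<in> sa_carrier A"
    and \<Phi>: "\<And>x. x \<in> sa_carrier A \<Longrightarrow> \<Phi> x \<in> sa_carrier B"
    and zero: "\<Phi> (sa_zero A) = sa_zero B"
    and add: "\<And>x y. \<lbrakk>x \<in> sa_carrier A; y \<in> sa_carrier A\<rbrakk> \<Longrightarrow> \<Phi> (sa_add A x y) = sa_add B (\<Phi> x) (\<Phi> y)"
    and scale: "\<And>c x. x \<in> sa_carrier A \<Longrightarrow> \<Phi> (sa_scale A c x) = sa_scale B c (\<Phi> x)"
    and mult: "\<And>x y. \<lbrakk>x \<in> sa_carrier A; y \<in> sa_carrier A\<rbrakk> \<Longrightarrow> \<Phi> (sa_mult A x y) = sa_mult B (\<Phi> x) (\<Phi> y)"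
    and star: "\<And>x. x \<in> sa_carrier A \<Longrightarrow> \<Phi> (sa_star A x) = sa_star B (\<Phi> x)"
    and norm: "\<And>x. x \<in> sa_carrier A \<Longrightarrow> sa_norm A x = sa_norm B (\<Phi> x)"
    and dense: "\<And>b e. \<lbrakk>b \<in> sa_carrier B; 0 < e\<rbrakk> \<Longrightarrow> \<exists>a\<in>sa_carrier A. sa_dist B (\<Phi> a) b < e"
  shows "\<exists>\<I>. cstar_isomorphism B (sa_completion A) \<I> \<and>
             (\<forall>a\<in>sa_carrier A. inv_into (sa_carrier B) \<I> (to_completion A a) = \<Phi> a)"
proof -
  interpret cstar_algebra B by (rule B)
  have dist: "sa_dist A x y = sa_dist B (\<Phi> x) (\<Phi> y)" if "x \<in> sa_carrier A" "y \<in> sa_carrier A" for x y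
    using that by (simp add: sa_dist_def norm A_add A_scale add scale)
  \<comment> \<open>No representative is chosen here, so the value is literally a class of the completion.\<close>
  define \<I> where "\<I> b = {d. (\<forall>n. d n \<in> sa_carrier A) \<and> converges (\<lambda>n. \<Phi> (d n)) b}" for b
  have Cauchy_eq: "sa_Cauchy A d \<longleftrightarrow> (\<forall>n. d n \<in> sa_carrier A) \<and> sa_Cauchy B (\<lambda>n. \<Phi> (d n))" for d
    using \<Phi> by (auto simp: sa_Cauchy_def dist)
  have class_eq: "cauchy_class A c = \<I> b" if c: "c \<in> \<I> b" for c b
  proof -
    have cA: "\<And>n. c n \<in> sa_carrier A" and cb: "converges (\<lambda>n. \<Phi> (c n)) b" using c by (auto simp: \<I>_def)
    show ?thesis
    proof (intro equalityI subsetI)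
      fix d assume "d \<in> cauchy_class A c"
      then have d: "\<And>n. d n \<in> sa_carrier A" "(\<lambda>n. sa_dist B (\<Phi> (c n)) (\<Phi> (d n))) \<longlonglongrightarrow> 0"
        by (auto simp: cauchy_class_def sa_Cauchy_def dist cA)
      then show "d \<in> \<I> b" using converges_close[OF cb _ d(2)] \<Phi> by (simp add: \<I>_def)
    next
      fix d assume d: "d \<in> \<I> b"
      then have dA: "\<And>n. d n \<in> sa_carrier A" and db: "converges (\<lambda>n. \<Phi> (d n)) b" by (auto simp: \<I>_def)
      show "d \<in> cauchy_class A c"
        using converges_dist[OF cb db] converges_Cauchy[OF db] dA cA
        by (simp add: cauchy_class_def Cauchy_eq dist)
    qed
  qed
  have nonempty: "\<exists>c. c \<in> \<I> b" if b: "b \<in> sa_carrier B" for b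
  proof -
    have "\<exists>a\<in>sa_carrier A. sa_dist B (\<Phi> a) b < inverse (real (Suc n))" for n
      using dense[OF b] by simp
    then obtain c where c: "\<And>n. c n \<in> sa_carrier A" "\<And>n. sa_dist B (\<Phi> (c n)) b < inverse (real (Suc n))"
      by metis
    have "converges (\<lambda>n. \<Phi> (c n)) b"
      by (rule convergesI_bound[OF _ b less_imp_le[OF c(2)] LIMSEQ_inverse_real_of_nat]) (use c \<Phi> in auto)
    then show ?thesis using c by (auto simp: \<I>_def)
  qed
  have rep: "class_rep (\<I> b) \<in> \<I> b" if "b \<in> sa_carrier B" for b
    unfolding class_rep_def using nonempty[OF that] by (rule someI_ex)
  have rep': "\<And>n. class_rep (\<I> b) n \<in> sa_carrier A" "converges (\<lambda>n. \<Phi> (class_rep (\<I> b) n)) b"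
    if "b \<in> sa_carrier B" for b
    using rep[OF that] by (auto simp: \<I>_def)
  have carrier: "sa_carrier (sa_completion A) = \<I> ` sa_carrier B"
  proof (intro equalityI subsetI)
    fix U assume "U \<in> sa_carrier (sa_completion A)"
    then obtain c where c: "U = cauchy_class A c" "sa_Cauchy A c" by (auto simp: sa_completion_def)
    then obtain b where b: "b \<in> sa_carrier B" "(\<lambda>n. sa_dist B (\<Phi> (c n)) b) \<longlonglongrightarrow> 0"
      using complete[of "\<lambda>n. \<Phi> (c n)"] Cauchy_eq by blast
    then have "c \<in> \<I> b" using c(2) \<Phi> Cauchy_eq by (auto simp: \<I>_def converges_def)
    then show "U \<in> \<I> ` sa_carrier B" using class_eq c b by blast
  next
    fix U assume "U \<in> \<I> ` sa_carrier B"
    then obtain b where b: "U = \<I> b" "b \<in> sa_carrier B" by blast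
    have "sa_Cauchy A (class_rep (\<I> b))"
      using rep'[OF b(2)] converges_Cauchy Cauchy_eq by blast
    then show "U \<in> sa_carrier (sa_completion A)"
      using class_eq[OF rep[OF b(2)]] b by (auto simp: sa_completion_def)
  qed
  have inj: "inj_on \<I> (sa_carrier B)"
  proof (rule inj_onI)
    fix b b' assume "b \<in> sa_carrier B" "b' \<in> sa_carrier B" "\<I> b = \<I> b'"
    then show "b = b'" using rep'(2)[of b] rep'(2)[of b'] converges_unique by simp
  qed
  have bij: "bij_betw \<I> (sa_carrier B) (sa_carrier (sa_completion A))"
    using inj carrier by (simp add: bij_betw_def)
  have I_zero: "\<I> (sa_zero B) = sa_zero (sa_completion A)"
    using class_eq[of "\<lambda>_. sa_zero A" "sa_zero B"] A_zero zero converges_const[OF zero_closed]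
    by (simp add: \<I>_def sa_completion_def)
  have I_add: "sa_add (sa_completion A) (\<I> x) (\<I> y) = \<I> (sa_add B x y)"
    if "x \<in> sa_carrier B" "y \<in> sa_carrier B" for x y
    using converges_add[OF rep'(2)[OF that(1)] rep'(2)[OF that(2)]] rep'(1) that
    by (simp add: sa_completion_def, intro class_eq) (simp add: \<I>_def A_add add)
  have I_mult: "sa_mult (sa_completion A) (\<I> x) (\<I> y) = \<I> (sa_mult B x y)"
    if "x \<in> sa_carrier B" "y \<in> sa_carrier B" for x y
    using converges_mult[OF rep'(2)[OF that(1)] rep'(2)[OF that(2)]] rep'(1) that
    by (simp add: sa_completion_def, intro class_eq) (simp add: \<I>_def A_mult mult)
  have I_scale: "sa_scale (sa_completion A) c (\<I> x) = \<I> (sa_scale B c x)"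
    if "x \<in> sa_carrier B" for c x
    using converges_scale[OF rep'(2)[OF that]] rep'(1) that
    by (simp add: sa_completion_def, intro class_eq) (simp add: \<I>_def A_scale scale)
  have I_star: "sa_star (sa_completion A) (\<I> x) = \<I> (sa_star B x)"
    if "x \<in> sa_carrier B" for x
    using converges_star[OF rep'(2)[OF that]] rep'(1) that
    by (simp add: sa_completion_def, intro class_eq) (simp add: \<I>_def A_star star)
  have I_norm: "sa_norm (sa_completion A) (\<I> x) = sa_norm B x" if "x \<in> sa_carrier B" for x
    using converges_norm[OF rep'(2)[OF that]] rep'(1)[OF that]
    by (simp add: sa_completion_def norm limI)
  have "cstar_algebra (sa_completion A)"
    by (rule cstar_algebra_transport[OF B bij I_zero I_add I_scale I_mult I_star I_norm])
  then have "cstar_isomorphism B (sa_completion A) \<I>"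
    unfolding cstar_isomorphism_def using B bij I_add I_scale I_mult I_star by simp
  moreover have "inv_into (sa_carrier B) \<I> (to_completion A a) = \<Phi> a" if a: "a \<in> sa_carrier A" for a
  proof -
    have "to_completion A a = \<I> (\<Phi> a)"
      unfolding to_completion_def
      by (rule class_eq) (use a \<Phi> converges_const in \<open>simp add: \<I>_def\<close>)
    then show ?thesis using inj a \<Phi> by simp
  qed
  ultimately show ?thesis by blast
qed

section \<open>Continuous functions vanishing at infinity\<close>

lemma C0_simps [simp]:
  "sa_zero (C0 X) = (\<lambda>x. 0)" "sa_add (C0 X) f g = (\<lambda>x. f x + g x)"
  "sa_scale (C0 X) c f = (\<lambda>x. c * f x)" "sa_mult (C0 X) f g = (\<lambda>x. f x * g x)"
  "sa_star (C0 X) f = (\<lambda>x. cnj (f x))"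
  by (simp_all add: C0_def)

lemma continuous_map_mult:
  fixes f g :: "'a \<Rightarrow> complex"
  shows "\<lbrakk>continuous_map X euclidean f; continuous_map X euclidean g\<rbrakk> \<Longrightarrow> continuous_map X euclidean (\<lambda>x. f x * g x)"
  by (simp add: continuous_map_atin tendsto_mult)

lemma continuous_map_cnj: "continuous_map X euclidean f \<Longrightarrow> continuous_map X euclidean (\<lambda>x. cnj (f x))"
  by (simp add: continuous_map_atin tendsto_cnj)

text \<open>The sets \<open>{e \<le> \<bar>f\<bar>}\<close> are closed, so it is enough to enclose each of them in some compact set.\<close>

lemma C0_carrierI:
  assumes cont: "continuous_map X euclidean f" and out: "\<And>x. x \<notin> topspace X \<Longrightarrow> f x = 0"
    and small: "\<And>e. e > 0 \<Longrightarrow> \<exists>K. compactin X K \<and> {x \<in> topspace X. e \<le> cmod (f x)} \<subseteq> K"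
  shows "f \<in> sa_carrier (C0 X)"
proof -
  have "compactin X {x \<in> topspace X. e \<le> cmod (f x)}" if e: "e > 0" for e
  proof -
    obtain K where K: "compactin X K" "{x \<in> topspace X. e \<le> cmod (f x)} \<subseteq> K" using small[OF e] by blast
    have "continuous_map X euclideanreal (\<lambda>x. cmod (f x))" using cont by (rule continuous_map_norm)
    then have "closedin X {x \<in> topspace X. cmod (f x) \<in> {e..}}"
      by (rule closedin_continuous_map_preimage) simp
    then show ?thesis using closed_compactin[OF K] by simp
  qed
  then show ?thesis using cont out by (simp add: C0_def)
qed

lemma C0_carrierD:
  assumes "f \<in> sa_carrier (C0 X)"
  shows "continuous_map X euclidean f" "x \<notin> topspace X \<Longrightarrow> f x = 0"
    "e > 0 \<Longrightarrow> compactin X {x \<in> topspace X. e \<le> cmod (f x)}"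
  using assms by (auto simp: C0_def)

lemma C0_bdd:
  assumes f: "f \<in> sa_carrier (C0 X)"
  shows "bdd_above (insert 0 ((\<lambda>x. cmod (f x)) ` topspace X))"
proof -
  define K where "K = {x \<in> topspace X. 1 \<le> cmod (f x)}"
  have "compactin euclidean (f ` K)"
    using image_compactin[OF _ C0_carrierD(1)[OF f]] C0_carrierD(3)[OF f] K_def by simp
  then have "bounded (f ` K)" by (simp add: compact_imp_bounded)
  then obtain B where B: "\<And>x. x \<in> K \<Longrightarrow> cmod (f x) \<le> B" by (auto simp: bounded_iff)
  have "cmod (f x) \<le> max 1 B" if "x \<in> topspace X" for x
    using B[of x] that by (cases "x \<in> K") (auto simp: K_def)
  then show ?thesis by (intro bdd_aboveI[of _ "max 1 B"]) auto
qed

lemma C0_norm_upper: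
  assumes "f \<in> sa_carrier (C0 X)" "x \<in> topspace X"
  shows "cmod (f x) \<le> sa_norm (C0 X) f"
  using cSup_upper[OF _ C0_bdd[OF assms(1)], of "cmod (f x)"] assms by (simp add: C0_def)

lemma C0_norm_nonneg: "f \<in> sa_carrier (C0 X) \<Longrightarrow> 0 \<le> sa_norm (C0 X) f"
  using cSup_upper[OF _ C0_bdd, of 0] by (simp add: C0_def)

lemma C0_norm_least:
  assumes "0 \<le> B" "\<And>x. x \<in> topspace X \<Longrightarrow> cmod (f x) \<le> B"
  shows "sa_norm (C0 X) f \<le> B"
  using cSup_least[of "insert 0 ((\<lambda>x. cmod (f x)) ` topspace X)" B] assms by (auto simp: C0_def)

lemma C0_add_closed:
  assumes f: "f \<in> sa_carrier (C0 X)" and g: "g \<in> sa_carrier (C0 X)"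
  shows "(\<lambda>x. f x + g x) \<in> sa_carrier (C0 X)"
proof (rule C0_carrierI)
  fix e :: real assume "e > 0"
  then have "compactin X ({x \<in> topspace X. e/2 \<le> cmod (f x)} \<union> {x \<in> topspace X. e/2 \<le> cmod (g x)})"
    by (intro compactin_Un C0_carrierD(3)[OF f] C0_carrierD(3)[OF g]) auto
  moreover have "{x \<in> topspace X. e \<le> cmod (f x + g x)} \<subseteq>
      {x \<in> topspace X. e/2 \<le> cmod (f x)} \<union> {x \<in> topspace X. e/2 \<le> cmod (g x)}"
    using norm_triangle_ineq by (smt (verit) UnCI field_sum_of_halves mem_Collect_eq subsetI)
  ultimately show "\<exists>K. compactin X K \<and> {x \<in> topspace X. e \<le> cmod (f x + g x)} \<subseteq> K" by blast
qed (use C0_carrierD[OF f] C0_carrierD[OF g] in \<open>auto intro: continuous_map_add\<close>)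

text \<open>\<open>C0 X\<close> is an ideal among the bounded continuous functions; products and scalar multiples are special cases.\<close>

lemma C0_bounded_mult_closed:
  assumes f: "f \<in> sa_carrier (C0 X)" and h: "continuous_map X euclidean h"
    and B: "\<And>x. x \<in> topspace X \<Longrightarrow> cmod (h x) \<le> B"
  shows "(\<lambda>x. h x * f x) \<in> sa_carrier (C0 X)"
proof (rule C0_carrierI)
  fix e :: real assume e: "e > 0"
  define C where "C = max 1 B"
  have C: "C > 0" by (simp add: C_def)
  have "{x \<in> topspace X. e \<le> cmod (h x * f x)} \<subseteq> {x \<in> topspace X. e/C \<le> cmod (f x)}"
  proof safe
    fix x assume x: "x \<in> topspace X" "e \<le> cmod (h x * f x)"
    have "cmod (h x * f x) \<le> C * cmod (f x)"
      using B[OF x(1)] by (auto simp: norm_mult C_def intro!: mult_right_mono)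
    then show "e / C \<le> cmod (f x)" using x C by (simp add: field_simps)
  qed
  moreover have "compactin X {x \<in> topspace X. e/C \<le> cmod (f x)}" using C0_carrierD(3)[OF f] C e by simp
  ultimately show "\<exists>K. compactin X K \<and> {x \<in> topspace X. e \<le> cmod (h x * f x)} \<subseteq> K" by blast
qed (use C0_carrierD[OF f] h in \<open>auto intro: continuous_map_mult\<close>)


lemma C0_mult_closed:
  assumes f: "f \<in> sa_carrier (C0 X)" and g: "g \<in> sa_carrier (C0 X)"
  shows "(\<lambda>x. f x * g x) \<in> sa_carrier (C0 X)"
  using C0_bounded_mult_closed[OF g C0_carrierD(1)[OF f] C0_norm_upper[OF f]] by simp

lemma C0_scale_closed: "f \<in> sa_carrier (C0 X) \<Longrightarrow> (\<lambda>x. c * f x) \<in> sa_carrier (C0 X)"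
  using C0_bounded_mult_closed[of f X "\<lambda>_. c" "cmod c"] by simp

lemma C0_star_closed: "f \<in> sa_carrier (C0 X) \<Longrightarrow> (\<lambda>x. cnj (f x)) \<in> sa_carrier (C0 X)"
  by (auto simp: C0_def intro: continuous_map_cnj)

lemma C0_dist: "sa_dist (C0 X) f g = sa_norm (C0 X) (\<lambda>x. f x - g x)"
  by (simp add: sa_dist_def)

lemma C0_diff_closed:
  assumes f: "f \<in> sa_carrier (C0 X)" and g: "g \<in> sa_carrier (C0 X)"
  shows "(\<lambda>x. f x - g x) \<in> sa_carrier (C0 X)"
  using C0_add_closed[OF f C0_scale_closed[OF g, of "-1"]] by simp

text \<open>A Cauchy sequence converges uniformly, and the limit is small wherever a late term of the sequence is small.\<close>

lemma C0_complete:
  assumes u: "sa_Cauchy (C0 X) u"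
  shows "\<exists>f\<in>sa_carrier (C0 X). (\<lambda>n. sa_dist (C0 X) (u n) f) \<longlonglongrightarrow> 0"
proof -
  have uc: "u n \<in> sa_carrier (C0 X)" for n using u by (simp add: sa_Cauchy_def)
  have close: "\<exists>N. \<forall>m n x. N \<le> m \<longrightarrow> N \<le> n \<longrightarrow> x \<in> topspace X \<longrightarrow> dist (u m x) (u n x) < e"
    if e: "e > 0" for e
  proof -
    obtain N where N: "\<And>m n. m \<ge> N \<Longrightarrow> n \<ge> N \<Longrightarrow> sa_dist (C0 X) (u m) (u n) < e"
      using u e unfolding sa_Cauchy_def by metis
    have "dist (u m x) (u n x) < e" if "m \<ge> N" "n \<ge> N" "x \<in> topspace X" for m n x
      using C0_norm_upper[OF C0_diff_closed[OF uc[of m] uc[of n]] that(3)] N[OF that(1,2)]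
      by (simp add: dist_norm C0_dist)
    then show ?thesis by blast
  qed
  obtain g where g: "continuous_map X euclidean g"
    and lim: "\<And>e. 0 < e \<Longrightarrow> \<forall>\<^sub>F n in sequentially. \<forall>x\<in>topspace X. dist (u n x) (g x) < e"
  proof (rule Met_TC.continuous_map_uniformly_Cauchy_limit[where X = X and f = u])
    show "\<forall>\<^sub>F n in sequentially. continuous_map X Met_TC.mtopology (u n)"
      using C0_carrierD(1)[OF uc] by simp
  qed (use close in \<open>auto simp: complete_UNIV\<close>)
  define f where "f x = (if x \<in> topspace X then g x else 0)" for x
  have f: "f \<in> sa_carrier (C0 X)"
  proof (rule C0_carrierI)
    show "continuous_map X euclidean f" using continuous_map_eq[OF g, of f] by (simp add: f_def)
    fix e :: real assume e: "e > 0"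
    then obtain n where n: "\<forall>x\<in>topspace X. dist (u n x) (g x) < e/2"
      using eventually_happens[OF lim[of "e/2"]] by auto
    have "{x \<in> topspace X. e \<le> cmod (f x)} \<subseteq> {x \<in> topspace X. e/2 \<le> cmod (u n x)}"
    proof safe
      fix x assume x: "x \<in> topspace X" "e \<le> cmod (f x)"
      have "cmod (f x) \<le> cmod (u n x) + dist (u n x) (g x)"
        using norm_triangle_ineq4[of "u n x" "u n x - g x"] x by (simp add: f_def dist_norm)
      then show "e / 2 \<le> cmod (u n x)" using n x by fastforce
    qed
    then show "\<exists>K. compactin X K \<and> {x \<in> topspace X. e \<le> cmod (f x)} \<subseteq> K"
      using C0_carrierD(3)[OF uc[of n], of "e/2"] e by auto
  qed (simp add: f_def)
  have "(\<lambda>n. sa_dist (C0 X) (u n) f) \<longlonglongrightarrow> 0"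
  proof (rule LIMSEQ_I)
    fix r :: real assume r: "r > 0"
    have "\<forall>\<^sub>F n in sequentially. norm (sa_dist (C0 X) (u n) f - 0) < r"
      using lim[of "r/2"]
    proof (rule eventually_mono)
      fix n assume n: "\<forall>x\<in>topspace X. dist (u n x) (g x) < r/2"
      have "sa_dist (C0 X) (u n) f \<le> r/2"
        unfolding C0_dist using n r by (intro C0_norm_least) (auto simp: f_def dist_norm intro: less_imp_le)
      moreover have "0 \<le> sa_dist (C0 X) (u n) f"
        unfolding C0_dist by (rule C0_norm_nonneg[OF C0_diff_closed[OF uc f]])
      ultimately show "norm (sa_dist (C0 X) (u n) f - 0) < r" using r by simp
    qed (use r in simp)
    then show "\<exists>no. \<forall>n\<ge>no. norm (sa_dist (C0 X) (u n) f - 0) < r" by (simp add: eventually_sequentially)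
  qed
  then show ?thesis using f by blast
qed

lemma cstar_algebra_C0: "cstar_algebra (C0 X)"
proof unfold_locales
  show "sa_zero (C0 X) \<in> sa_carrier (C0 X)"
    by (rule C0_carrierI) (auto intro!: exI[of _ "{}"])
next
  fix f assume f: "f \<in> sa_carrier (C0 X)"
  have out: "f x = 0" if "x \<notin> topspace X" for x using C0_carrierD(2)[OF f that] .
  show "sa_norm (C0 X) f = 0 \<longleftrightarrow> f = sa_zero (C0 X)"
  proof
    assume 0: "sa_norm (C0 X) f = 0"
    have "f x = 0" for x
      using C0_norm_upper[OF f, of x] out[of x] 0 by (cases "x \<in> topspace X") auto
    then show "f = sa_zero (C0 X)" by auto
  next
    assume "f = sa_zero (C0 X)"
    then show "sa_norm (C0 X) f = 0" using C0_norm_nonneg[OF f] C0_norm_least[of 0 X f] by simp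
  qed
  have le: "sa_norm (C0 X) (\<lambda>x. c * g x) \<le> cmod c * sa_norm (C0 X) g" if "g \<in> sa_carrier (C0 X)" for c g
    using C0_norm_upper[OF that] C0_norm_nonneg[OF that]
    by (intro C0_norm_least) (auto simp: norm_mult intro: mult_left_mono)
  show "sa_norm (C0 X) (sa_scale (C0 X) c f) = cmod c * sa_norm (C0 X) f" for c
  proof (cases "c = 0")
    case True
    then show ?thesis using le[OF f, of 0] C0_norm_nonneg[OF C0_scale_closed[OF f, of 0]] by simp
  next
    case False
    then have "sa_norm (C0 X) f \<le> cmod (1/c) * sa_norm (C0 X) (\<lambda>x. c * f x)"
      using le[OF C0_scale_closed[OF f, of c], of "1/c"] by simp
    then have "cmod c * sa_norm (C0 X) f \<le> sa_norm (C0 X) (\<lambda>x. c * f x)"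
      using False by (simp add: norm_divide field_simps)
    then show ?thesis using le[OF f, of c] by simp
  qed
  show "sa_norm (C0 X) (sa_mult (C0 X) (sa_star (C0 X) f) f) = (sa_norm (C0 X) f)\<^sup>2"
  proof (rule antisym)
    show "sa_norm (C0 X) (sa_mult (C0 X) (sa_star (C0 X) f) f) \<le> (sa_norm (C0 X) f)\<^sup>2"
      using C0_norm_upper[OF f] C0_norm_nonneg[OF f]
      by (intro C0_norm_least) (auto simp: norm_mult power2_eq_square intro: mult_mono)
    define g where "g = (\<lambda>x. cnj (f x) * f x)"
    have g: "g \<in> sa_carrier (C0 X)" unfolding g_def by (intro C0_mult_closed C0_star_closed f)
    have "sa_norm (C0 X) f \<le> sqrt (sa_norm (C0 X) g)"
    proof (rule C0_norm_least)
      fix x assume "x \<in> topspace X"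
      then have "(cmod (f x))\<^sup>2 \<le> sa_norm (C0 X) g"
        using C0_norm_upper[OF g, of x] by (simp add: g_def norm_mult power2_eq_square)
      then show "cmod (f x) \<le> sqrt (sa_norm (C0 X) g)" by (simp add: real_le_rsqrt)
    qed (use C0_norm_nonneg[OF g] in simp)
    then have "(sa_norm (C0 X) f)\<^sup>2 \<le> sa_norm (C0 X) g"
      using C0_norm_nonneg[OF f] C0_norm_nonneg[OF g] by (metis real_sqrt_le_iff real_sqrt_abs abs_of_nonneg)
    then show "(sa_norm (C0 X) f)\<^sup>2 \<le> sa_norm (C0 X) (sa_mult (C0 X) (sa_star (C0 X) f) f)"
      by (simp add: g_def)
  qed
  fix g assume g: "g \<in> sa_carrier (C0 X)"
  show "sa_norm (C0 X) (sa_add (C0 X) f g) \<le> sa_norm (C0 X) f + sa_norm (C0 X) g"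
    using C0_norm_upper[OF f] C0_norm_upper[OF g] C0_norm_nonneg[OF f] C0_norm_nonneg[OF g]
    by (intro C0_norm_least) (auto intro: norm_triangle_mono)
  show "sa_norm (C0 X) (sa_mult (C0 X) f g) \<le> sa_norm (C0 X) f * sa_norm (C0 X) g"
    using C0_norm_upper[OF f] C0_norm_upper[OF g] C0_norm_nonneg[OF f] C0_norm_nonneg[OF g]
    by (intro C0_norm_least) (auto simp: norm_mult intro: mult_mono)
qed (use C0_add_closed C0_scale_closed C0_mult_closed C0_star_closed C0_norm_nonneg C0_complete
     in \<open>auto simp: algebra_simps\<close>)

section \<open>Characters of the torus\<close>

definition torus_inv :: "complex^'n \<Rightarrow> complex^'n" where
  "torus_inv s = (\<chi> i. cnj (s $ i))"

lemma torus_nth: "s \<in> torus \<Longrightarrow> cmod (s $ i) = 1"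
  by (simp add: torus_def)

lemma torus_nz: "s \<in> torus \<Longrightarrow> s $ i \<noteq> 0"
  using torus_nth[of s i] by auto

lemma one_torus: "1 \<in> torus"
  by (simp add: torus_def)

lemma mult_torus: "\<lbrakk>s \<in> torus; t \<in> torus\<rbrakk> \<Longrightarrow> s * t \<in> torus"
  by (simp add: torus_def norm_mult)

lemma power_torus: "s \<in> torus \<Longrightarrow> s ^ j \<in> torus"
  by (induction j) (auto simp: one_torus mult_torus)

lemma torus_inv_torus: "s \<in> torus \<Longrightarrow> torus_inv s \<in> torus"
  by (simp add: torus_def torus_inv_def)

lemma torus_inv_right: "s \<in> torus \<Longrightarrow> s * torus_inv s = 1"
  by (simp add: vec_eq_iff torus_inv_def torus_nth flip: complex_norm_square)

lemma torus_inv_left: "s \<in> torus \<Longrightarrow> torus_inv s * s = 1"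
  using torus_inv_right[of s] by (simp add: mult.commute)

text \<open>Compactness is what makes projections along the torus closed and the orbit map proper.\<close>

lemma compact_torus: "compact (torus :: (complex^'n) set)"
proof (rule compact_eq_bounded_closed[THEN iffD2, OF conjI])
  have "norm s \<le> real CARD('n)" if "s \<in> torus" for s :: "complex^'n"
    using L2_set_le_sum[of UNIV "\<lambda>i. norm (s $ i)"] by (simp add: norm_vec_def that torus_nth)
  then show "bounded (torus :: (complex^'n) set)" by (auto simp: bounded_iff)
  have "closed (\<Inter>i. {s :: complex^'n. cmod (s $ i) = 1})"
    by (intro closed_INT ballI closed_Collect_eq continuous_intros)
  moreover have "torus = (\<Inter>i. {s :: complex^'n. cmod (s $ i) = 1})" by (auto simp: torus_def)
  ultimately show "closed (torus :: (complex^'n) set)" by simp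
qed

lemma pairing_mult: "pairing k (s * t) = pairing k s * pairing k t"
  by (simp add: pairing_def power_int_mult_distrib prod.distrib)

lemma pairing_one: "pairing k 1 = 1"
  by (simp add: pairing_def)

lemma pairing_power: "pairing k (s ^ j) = pairing k s ^ j"
  by (induction j) (auto simp: pairing_one pairing_mult)

lemma pairing_zero: "pairing 0 s = 1"
  by (simp add: pairing_def)

lemma pairing_add: "s \<in> torus \<Longrightarrow> pairing (k + l) s = pairing k s * pairing l s"
  by (simp add: pairing_def power_int_add torus_nz prod.distrib)

lemma norm_pairing: "s \<in> torus \<Longrightarrow> cmod (pairing k s) = 1"
  by (simp add: pairing_def prod_norm[symmetric] norm_power_int torus_nth)

lemma pairing_nz: "s \<in> torus \<Longrightarrow> pairing k s \<noteq> 0"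
  using norm_pairing[of s k] by auto

lemma pairing_minus: 
  assumes s: "s \<in> torus" shows "pairing (- k) s = cnj (pairing k s)"
proof -
  have "pairing (- k) s * pairing k s = cnj (pairing k s) * pairing k s"
    using pairing_add[OF s, of "-k" k] norm_pairing[OF s, of k]
    by (simp add: pairing_zero mult.commute[of "cnj _"] flip: complex_norm_square)
  then show ?thesis using pairing_nz[OF s] by simp
qed

lemma pairing_axis: "pairing (axis i 1) s = s $ i"
proof -
  have "pairing (axis i 1) s = (\<Prod>j\<in>UNIV. if i = j then s $ j else 1)"
    unfolding pairing_def by (rule prod.cong) (auto simp: axis_def)
  then show ?thesis by simp
qed

lemma continuous_on_pairing: "continuous_on torus (pairing k)"
  unfolding pairing_def by (intro continuous_intros) (simp add: torus_nz)

definition trig_poly :: "(complex^'n \<Rightarrow> complex) \<Rightarrow> bool" where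
  "trig_poly p \<longleftrightarrow> (\<exists>F c. finite F \<and> (\<forall>s\<in>torus. p s = (\<Sum>k\<in>F. c k * pairing k s)))"

lemma trig_poly_cong: "\<lbrakk>trig_poly p; \<And>s. s \<in> torus \<Longrightarrow> q s = p s\<rbrakk> \<Longrightarrow> trig_poly q"
  by (simp add: trig_poly_def)

lemma trig_poly_monom: "trig_poly (\<lambda>s. c * pairing k s)"
  unfolding trig_poly_def by (intro exI[of _ "{k}"] exI[of _ "\<lambda>_. c"]) simp

lemma trig_poly_const: "trig_poly (\<lambda>s. c)"
  using trig_poly_monom[of c 0] by (simp add: pairing_zero)

lemma trig_poly_add:
  assumes "trig_poly p" "trig_poly q" shows "trig_poly (\<lambda>s. p s + q s)"
proof -
  obtain F c where F: "finite F" "\<And>s. s \<in> torus \<Longrightarrow> p s = (\<Sum>k\<in>F. c k * pairing k s)"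
    using assms(1) unfolding trig_poly_def by blast
  obtain G d where G: "finite G" "\<And>s. s \<in> torus \<Longrightarrow> q s = (\<Sum>k\<in>G. d k * pairing k s)"
    using assms(2) unfolding trig_poly_def by blast
  define e where "e k = (if k \<in> F then c k else 0) + (if k \<in> G then d k else 0)" for k
  have "p s + q s = (\<Sum>k\<in>F \<union> G. e k * pairing k s)" if "s \<in> torus" for s
  proof -
    have "p s = (\<Sum>k\<in>F \<union> G. (if k \<in> F then c k else 0) * pairing k s)"
      using F G by (simp add: that) (rule sum.mono_neutral_cong_left, auto)
    moreover have "q s = (\<Sum>k\<in>F \<union> G. (if k \<in> G then d k else 0) * pairing k s)"
      using F G by (simp add: that) (rule sum.mono_neutral_cong_left, auto)
    ultimately show ?thesis by (simp add: e_def sum.distrib distrib_right)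
  qed
  then show ?thesis unfolding trig_poly_def using F G by blast
qed

lemma trig_poly_sum: "(\<And>i. i \<in> I \<Longrightarrow> trig_poly (p i)) \<Longrightarrow> trig_poly (\<lambda>s. \<Sum>i\<in>I. p i s)"
  by (induction I rule: infinite_finite_induct) (auto intro: trig_poly_const trig_poly_add)

lemma trig_poly_mult:
  assumes "trig_poly p" "trig_poly q" shows "trig_poly (\<lambda>s. p s * q s)"
proof -
  obtain F c where F: "\<And>s. s \<in> torus \<Longrightarrow> p s = (\<Sum>k\<in>F. c k * pairing k s)"
    using assms(1) unfolding trig_poly_def by blast
  obtain G d where G: "\<And>s. s \<in> torus \<Longrightarrow> q s = (\<Sum>k\<in>G. d k * pairing k s)"
    using assms(2) unfolding trig_poly_def by blast
  have "trig_poly (\<lambda>s. \<Sum>k\<in>F. \<Sum>l\<in>G. (c k * d l) * pairing (k + l) s)"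
    by (intro trig_poly_sum trig_poly_monom)
  then show ?thesis
    by (rule trig_poly_cong) (simp add: F G sum_product pairing_add mult_ac)
qed

text \<open>On the torus the coordinates and their conjugates are the characters \<open>axis i 1\<close> and \<open>- axis i 1\<close>, so every
real-linear functional of the coordinates is a combination of characters.  This turns the polynomial
form of the Stone-Weierstrass theorem into density of the trigonometric polynomials.\<close>

lemma trig_poly_real_polynomial:
  fixes r :: "complex^'n \<Rightarrow> real"
  assumes "real_polynomial_function r"
  shows "trig_poly (\<lambda>s. complex_of_real (r s))"
  using assms
proof (induction rule: real_polynomial_function.induct)
  case (linear f)
  interpret bounded_linear f by (rule linear)
  define a b where "a i = complex_of_real (f (axis i 1))" and "b i = complex_of_real (f (axis i \<i>))" for i
  have comp: "f (axis i z) = Re z * f (axis i 1) + Im z * f (axis i \<i>)" for i z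
  proof -
    have "axis i z = Re z *\<^sub>R axis i 1 + Im z *\<^sub>R axis i \<i>"
      by (auto simp: vec_eq_iff axis_def complex_eq_iff)
    then show ?thesis by (simp add: add scaleR)
  qed
  have "trig_poly (\<lambda>s. \<Sum>i\<in>UNIV. ((a i - \<i> * b i)/2) * pairing (axis i 1) s
          + ((a i + \<i> * b i)/2) * pairing (- axis i 1) s)"
    by (intro trig_poly_sum trig_poly_monom trig_poly_add)
  then show ?case
  proof (rule trig_poly_cong)
    fix s :: "complex^'n" assume s: "s \<in> torus"
    have "s = (\<Sum>i\<in>UNIV. axis i (s $ i))"
      by (simp add: vec_eq_iff axis_def)
    then have "f s = (\<Sum>i\<in>UNIV. f (axis i (s $ i)))" by (metis sum)
    also have "complex_of_real \<dots> = (\<Sum>i\<in>UNIV. ((a i - \<i> * b i)/2) * pairing (axis i 1) s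
          + ((a i + \<i> * b i)/2) * pairing (- axis i 1) s)"
      unfolding of_real_sum
      by (rule sum.cong[OF refl], subst comp)
         (simp add: pairing_minus[OF s] pairing_axis a_def b_def complex_eq_iff field_simps)
    finally show "complex_of_real (f s) = (\<Sum>i\<in>UNIV. ((a i - \<i> * b i)/2) * pairing (axis i 1) s
          + ((a i + \<i> * b i)/2) * pairing (- axis i 1) s)" .
  qed
qed (auto intro: trig_poly_const trig_poly_add trig_poly_mult)

lemma trig_poly_dense:
  fixes g :: "complex^'n \<Rightarrow> complex"
  assumes g: "continuous_on torus g" and e: "0 < e"
  obtains p where "trig_poly p" "\<And>s. s \<in> torus \<Longrightarrow> cmod (g s - p s) < e"
proof -
  obtain p where p: "polynomial_function p" "\<And>s. s \<in> torus \<Longrightarrow> cmod (g s - p s) < e"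
    using Stone_Weierstrass_polynomial_function[OF compact_torus g e] by blast
  have "real_polynomial_function (Re \<circ> p)" "real_polynomial_function (Im \<circ> p)"
    using p(1) bounded_linear_Re bounded_linear_Im unfolding polynomial_function_def by blast+
  then have "trig_poly (\<lambda>s. of_real ((Re \<circ> p) s) + \<i> * of_real ((Im \<circ> p) s))"
    by (intro trig_poly_add trig_poly_mult trig_poly_const trig_poly_real_polynomial)
  then have "trig_poly p" by (rule trig_poly_cong) (simp add: complex_eq)
  then show ?thesis using that p by blast
qed

text \<open>Translating the argument by an element of \<open>H\<close> changes neither \<open>u\<close> nor the bound, so it may be averaged over
\<open>1, h, h\<^sup>2, \<dots>\<close>.  If the character \<open>k\<close> is nontrivial at \<open>h\<close>, its averages over \<open>N\<close> terms are
geometric sums divided by \<open>N\<close> and tend to \<open>0\<close>.  The characters in \<open>F\<close> can thus be removed one after the other,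
at an arbitrarily small cost.  Such averages along single elements of \<open>H\<close> replace integration against the
Haar measure of the closed subgroup generated by \<open>H\<close>.\<close>

lemma averaging_removes_characters:
  fixes u :: "complex^'n \<Rightarrow> complex" and H :: "(complex^'n) set"
  assumes H: "H \<subseteq> torus"
    and inv: "\<And>s h. \<lbrakk>s \<in> torus; h \<in> H\<rbrakk> \<Longrightarrow> u (s * h) = u s"
    and F: "finite F" and nontriv: "\<And>k. k \<in> F \<Longrightarrow> \<exists>h\<in>H. pairing k h \<noteq> 1"
    and bound: "\<And>s. s \<in> torus \<Longrightarrow> cmod (u s + (\<Sum>k\<in>F. d k * pairing k s)) \<le> r"
    and s: "s \<in> torus"
  shows "cmod (u s) \<le> r"
  using F nontriv bound
proof (induction F arbitrary: d r rule: finite_induct)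
  case empty
  then show ?case using s by simp
next
  case (insert k1 F)
  obtain h where h: "h \<in> H" "pairing k1 h \<noteq> 1" using insert.prems(1) by blast
  have hT: "h \<in> torus" using h H by blast
  define z where "z = pairing k1 h"
  have z: "z \<noteq> 1" "cmod z = 1" using h hT by (auto simp: z_def norm_pairing)
  have invj: "u (t * h ^ j) = u t" if "t \<in> torus" for t j
  proof (induction j)
    case (Suc j)
    then show ?case using inv[of "t * h ^ j" h] that hT h(1)
      by (simp add: mult_torus power_torus mult_ac)
  qed simp
  show ?case
  proof (rule field_le_epsilon)
    fix e :: real assume e: "e > 0"
    \<comment> \<open>The number of terms is chosen such that the average of the character \<open>k1\<close>, at most
      \<open>2 / (\<bar>z - 1\<bar> * N)\<close>, stays below \<open>e\<close> after multiplication by \<open>d k1\<close>.\<close>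
    obtain n :: nat where n: "cmod (d k1) * 2 / (cmod (z - 1) * e) < real n" using reals_Archimedean2 by blast
    define N where "N = Suc n"
    have N: "cmod (d k1) * 2 / cmod (z - 1) \<le> e * real N" "N > 0"
      using n e z by (auto simp: N_def field_simps intro: order_trans less_imp_le)
    define d' where "d' k = d k * ((\<Sum>j<N. pairing k h ^ j) / of_nat N)" for k
    have k1: "cmod (d' k1) \<le> e"
    proof -
      have "cmod (\<Sum>j<N. z ^ j) = cmod (z ^ N - 1) / cmod (z - 1)"
        using z by (simp add: geometric_sum norm_divide)
      also have "\<dots> \<le> 2 / cmod (z - 1)"
        using norm_triangle_ineq4[of "z ^ N" 1] z by (intro divide_right_mono) (auto simp: norm_power)
      finally have "cmod (d' k1) \<le> cmod (d k1) * (2 / cmod (z - 1) / real N)"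
        unfolding d'_def z_def[symmetric] norm_mult norm_divide norm_of_nat
        by (intro mult_left_mono divide_right_mono) auto
      also have "\<dots> = cmod (d k1) * 2 / cmod (z - 1) / real N" by simp
      also have "\<dots> \<le> e" using N by (subst pos_divide_le_eq) auto
      finally show ?thesis .
    qed
    show "cmod (u s) \<le> r + e"
    proof (rule insert.IH)
      fix t :: "complex^'n" assume t: "t \<in> torus"
      \<comment> \<open>All \<open>P j\<close> obey the bound, and their average has the same \<open>u\<close> but coefficients \<open>d'\<close>.\<close>
      define P where "P j = u (t * h ^ j) + (\<Sum>k\<in>insert k1 F. d k * pairing k (t * h ^ j))" for j
      have "cmod (P j) \<le> r" for j
        unfolding P_def using t hT by (intro insert.prems(2) mult_torus power_torus)
      then have "cmod ((\<Sum>j<N. P j) / of_nat N) \<le> r"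
        using sum_norm_bound[of "{..<N}" P r] N by (simp add: norm_divide divide_le_eq mult.commute)
      moreover have "(\<Sum>j<N. P j) / of_nat N = u t + (\<Sum>k\<in>insert k1 F. d' k * pairing k t)"
      proof -
        have "(\<Sum>j<N. P j) = of_nat N * u t + (\<Sum>k\<in>insert k1 F. \<Sum>j<N. d k * pairing k (t * h ^ j))"
          unfolding P_def sum.distrib using t by (simp add: invj sum.swap[of _ "{..<N}"])
        also have "(\<Sum>k\<in>insert k1 F. \<Sum>j<N. d k * pairing k (t * h ^ j)) =
                   (\<Sum>k\<in>insert k1 F. of_nat N * (d' k * pairing k t))"
        proof (rule sum.cong[OF refl])
          fix k
          have "(\<Sum>j<N. d k * pairing k (t * h ^ j)) = d k * pairing k t * (\<Sum>j<N. pairing k h ^ j)"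
            by (simp add: pairing_mult pairing_power sum_distrib_left mult_ac)
          then show "(\<Sum>j<N. d k * pairing k (t * h ^ j)) = of_nat N * (d' k * pairing k t)"
            using N by (simp add: d'_def)
        qed
        finally show ?thesis using N by (simp add: sum_distrib_left[symmetric] add_divide_distrib)
      qed
      ultimately have "cmod ((u t + (\<Sum>k\<in>F. d' k * pairing k t)) + d' k1 * pairing k1 t) \<le> r"
        using insert.hyps by (simp add: algebra_simps)
      moreover have "cmod (d' k1 * pairing k1 t) \<le> e" using k1 t by (simp add: norm_mult norm_pairing)
      ultimately show "cmod (u t + (\<Sum>k\<in>F. d' k * pairing k t)) \<le> r + e"
        using norm_triangle_ineq4[of "(u t + (\<Sum>k\<in>F. d' k * pairing k t)) + d' k1 * pairing k1 t" "d' k1 * pairing k1 t"]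
        by simp
    qed (use insert.prems in auto)
  qed
qed

text \<open>After multiplication with the inverse of the character \<open>l\<close>, the coefficient \<open>c l\<close> becomes the constant term, and
averaging over the whole torus removes all other terms.\<close>

lemma trig_coefficient_le:
  fixes l :: "int^'n"
  assumes F: "finite F" and bound: "\<And>s. s \<in> torus \<Longrightarrow> cmod (\<Sum>k\<in>F. c k * pairing k s) \<le> r"
    and l: "l \<in> F"
  shows "cmod (c l) \<le> r"
proof (rule averaging_removes_characters[where H = torus and u = "\<lambda>_. c l" and s = 1
      and F = "(\<lambda>k. k - l) ` (F - {l})" and d = "\<lambda>k. c (k + l)"])
  fix k assume "k \<in> (\<lambda>k. k - l) ` (F - {l})"
  then have "k \<noteq> 0" by auto
  then obtain i where i: "k $ i \<noteq> 0" by (auto simp: vec_eq_iff)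
  \<comment> \<open>A torus element at which the character \<open>k\<close> takes the value \<open>-1\<close>.\<close>
  define w where "w = cis (pi / of_int (k $ i))"
  have w: "cmod w = 1" "w powi (k $ i) = -1" using i by (simp_all add: w_def cis_power_int)
  define h where "h = (\<chi> j. if j = i then w else 1)"
  have "pairing k h = (\<Prod>j\<in>UNIV. if j = i then w powi (k $ j) else 1)"
    unfolding pairing_def by (rule prod.cong) (auto simp: h_def)
  then have "pairing k h = -1" using w by simp
  moreover have "h \<in> torus" using w by (simp add: h_def torus_def)
  ultimately show "\<exists>h\<in>torus. pairing k h \<noteq> 1" by force
next
  fix s :: "complex^'n" assume s: "s \<in> torus"
  have "(\<Sum>k\<in>(\<lambda>k. k - l) ` (F - {l}). c (k + l) * pairing k s) =
        (\<Sum>k\<in>F - {l}. c k * pairing (k + - l) s)"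
    by (subst sum.reindex) (auto simp: inj_on_def)
  then have "c l + (\<Sum>k\<in>(\<lambda>k. k - l) ` (F - {l}). c (k + l) * pairing k s) =
        (\<Sum>k\<in>F. c k * pairing (k + - l) s)"
    using l F by (simp add: sum.remove[of F l] pairing_zero)
  also have "\<dots> = (\<Sum>k\<in>F. c k * pairing k s) * pairing (-l) s"
    using s by (simp only: pairing_add sum_distrib_right mult.assoc)
  finally show "cmod (c l + (\<Sum>k\<in>(\<lambda>k. k - l) ` (F - {l}). c (k + l) * pairing k s)) \<le> r"
    using bound[OF s] s by (simp add: norm_mult norm_pairing)
qed (use F one_torus in auto)

text \<open>A trigonometric approximation of \<open>g\<close> splits into characters that are trivial on \<open>H\<close> and others.  The difference
of \<open>g\<close> and the first part is invariant under \<open>H\<close>, so that averaging removes the second part.\<close>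

lemma invariant_trig_approximation:
  fixes g :: "complex^'n \<Rightarrow> complex" and H :: "(complex^'n) set"
  assumes H: "H \<subseteq> torus"
    and inv: "\<And>s h. \<lbrakk>s \<in> torus; h \<in> H\<rbrakk> \<Longrightarrow> g (s * h) = g s"
    and g: "continuous_on torus g" and e: "0 < e"
  obtains F c where "finite (F :: (int^'n) set)" "\<And>k. k \<in> F \<Longrightarrow> \<forall>h\<in>H. pairing k h = 1"
    "\<And>s. s \<in> torus \<Longrightarrow> cmod (g s - (\<Sum>k\<in>F. c k * pairing k s)) < e"
proof -
  obtain p where p: "trig_poly p" "\<And>s. s \<in> torus \<Longrightarrow> cmod (g s - p s) < e/2"
    using trig_poly_dense[OF g, of "e/2"] e by auto
  obtain E c where E: "finite E" "\<And>s. s \<in> torus \<Longrightarrow> p s = (\<Sum>k\<in>E. c k * pairing k s)"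
    using p(1) unfolding trig_poly_def by blast
  \<comment> \<open>The part of the approximation that descends to the quotient by \<open>H\<close>.\<close>
  define F where "F = {k\<in>E. \<forall>h\<in>H. pairing k h = 1}"
  have split: "p s = (\<Sum>k\<in>F. c k * pairing k s) + (\<Sum>k\<in>E - F. c k * pairing k s)" if "s \<in> torus" for s
    using E that by (subst add.commute, subst sum.subset_diff[symmetric]) (auto simp: F_def)
  have "cmod (g s - (\<Sum>k\<in>F. c k * pairing k s)) \<le> e/2" if s: "s \<in> torus" for s
  proof (rule averaging_removes_characters[OF H _ _ _ _ s, where F = "E - F" and d = "\<lambda>k. - c k"
          and u = "\<lambda>s. g s - (\<Sum>k\<in>F. c k * pairing k s)"])
    fix s h :: "complex^'n" assume "s \<in> torus" "h \<in> H"
    then show "g (s * h) - (\<Sum>k\<in>F. c k * pairing k (s * h)) = g s - (\<Sum>k\<in>F. c k * pairing k s)"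
      using inv by (simp add: pairing_mult F_def)
  next
    fix s :: "complex^'n" assume s: "s \<in> torus"
    show "cmod (g s - (\<Sum>k\<in>F. c k * pairing k s) + (\<Sum>k\<in>E - F. - c k * pairing k s)) \<le> e / 2"
      using p(2)[OF s] split[OF s] by (simp add: sum_negf algebra_simps)
  qed (use E in \<open>auto simp: F_def\<close>)
  then have "cmod (g s - (\<Sum>k\<in>F. c k * pairing k s)) < e" if "s \<in> torus" for s
    using that e by fastforce
  then show ?thesis by (intro that[of F c]) (use E in \<open>auto simp: F_def\<close>)
qed

section \<open>Torus actions with a continuous section of the orbit map\<close>

text \<open>A function given on an open set \<open>U\<close> only, such as \<open>k_fun\<close> on \<open>M_set\<close>, becomes a global continuous function
after multiplication by a factor supported in a closed subset of \<open>U\<close>.\<close>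

lemma continuous_map_vanishing_outside:
  fixes f :: "'a \<Rightarrow> 'b::real_normed_vector"
  assumes U: "openin X U" and K: "closedin X K" "K \<subseteq> U"
    and f: "continuous_map (subtopology X U) euclidean f"
    and zero: "\<And>x. x \<in> topspace X - K \<Longrightarrow> f x = 0"
  shows "continuous_map X euclidean f"
  unfolding continuous_map_def
proof (intro conjI allI impI)
  fix W :: "'b set" assume W: "openin euclidean W"
  have UX: "U \<subseteq> topspace X" by (rule openin_subset[OF U])
  have "openin (subtopology X U) {x \<in> topspace (subtopology X U). f x \<in> W}"
    using f W by (rule openin_continuous_map_preimage)
  then have 1: "openin X {x \<in> U. f x \<in> W}"
    using U UX by (simp add: openin_open_subtopology Int_absorb1)
  have 2: "openin X (topspace X - K)" using K by blast
  show "openin X {x \<in> topspace X. f x \<in> W}"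
  proof (cases "0 \<in> W")
    case True
    then have "{x \<in> topspace X. f x \<in> W} = {x \<in> U. f x \<in> W} \<union> (topspace X - K)"
      using UX zero K by auto
    then show ?thesis using 1 2 by auto
  next
    case False
    then have "{x \<in> topspace X. f x \<in> W} = {x \<in> U. f x \<in> W}"
      using UX zero K(2) by (metis (mono_tags, lifting) DiffI subsetD)
    then show ?thesis using 1 by simp
  qed
qed simp

lemma locally_compact_Hausdorff_bump:
  assumes "Hausdorff_space Y" "locally_compact_space Y" "openin Y U" "y \<in> U"
  obtains \<phi> :: "'a \<Rightarrow> real" and K where "continuous_map Y euclideanreal \<phi>" "\<phi> y = 1"
    "\<And>z. 0 \<le> \<phi> z" "compactin Y K" "K \<subseteq> U" "\<And>z. z \<notin> K \<Longrightarrow> \<phi> z = 0"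
proof -
  obtain V K where V: "openin Y V" "compactin Y K" "y \<in> V" "V \<subseteq> K" "K \<subseteq> U"
    using assms locally_compact_space_neighbourhood_base[of Y] unfolding neighbourhood_base_of by metis
  have creg: "completely_regular_space Y"
    using assms locally_compact_Hausdorff_imp_regular_space
      locally_compact_regular_imp_completely_regular_space by blast
  have "closedin Y (topspace Y - V)" "y \<in> topspace Y - (topspace Y - V)"
    using V openin_subset[OF V(1)] by auto
  then obtain f :: "'a \<Rightarrow> real" where f: "continuous_map Y (top_of_set {0..1}) f" "f y = 0" "f ` (topspace Y - V) \<subseteq> {1}"
    using creg unfolding completely_regular_space_def by meson
  define \<phi> where "\<phi> z = (if z \<in> topspace Y then 1 - f z else 0)" for z
  have f': "continuous_map Y euclideanreal f" "\<And>z. z \<in> topspace Y \<Longrightarrow> f z \<le> 1"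
    using f(1) by (auto simp: continuous_map_in_subtopology)
  have "continuous_map Y euclideanreal (\<lambda>z. 1 - f z)"
    using f'(1) by (intro continuous_map_diff) auto
  then have "continuous_map Y euclideanreal \<phi>" by (rule continuous_map_eq) (simp add: \<phi>_def)
  moreover have "y \<in> topspace Y" using assms openin_subset by blast
  then have "\<phi> y = 1" using f by (simp add: \<phi>_def)
  moreover have "0 \<le> \<phi> z" for z using f'(2) by (simp add: \<phi>_def)
  moreover have "\<phi> z = 0" if "z \<notin> K" for z using f(3) V that by (auto simp: \<phi>_def)
  ultimately show thesis using that V(2,5) by metis
qed

text \<open>If \<open>w\<close> lies on the unit circle within distance less than \<open>1\<close> of \<open>1\<close>, then \<open>Re w > 1/2\<close>, hence
\<open>\<bar>w\<^sup>2 - 1\<bar> = \<bar>w + 1\<bar> \<bar>w - 1\<bar> \<ge> 3/2 * \<bar>w - 1\<bar>\<close>.  Repeated squaring of \<open>z \<noteq> 1\<close> therefore moves away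
from \<open>1\<close> exponentially as long as it stays close to \<open>1\<close>, which is impossible forever.\<close>

lemma unit_circle_no_small_subgroups:
  fixes z :: complex
  assumes z: "cmod z = 1" "z \<noteq> 1"
  shows "\<exists>m. 1 \<le> cmod (z ^ m - 1)"
proof (rule ccontr)
  assume "\<nexists>m. 1 \<le> cmod (z ^ m - 1)"
  then have small: "cmod (z ^ m - 1) < 1" for m by (meson not_le)
  have growth: "(3/2) ^ j * cmod (z - 1) \<le> cmod (z ^ (2 ^ j) - 1)" for j :: nat
  proof (induction j)
    case (Suc j)
    define w where "w = z ^ (2 ^ j)"
    have w: "cmod w = 1" using z by (simp add: w_def norm_power)
    have "(cmod (w - 1))\<^sup>2 < 1" using small[of "2 ^ j"] by (simp add: w_def power_less_one_iff)
    moreover have "(cmod (w - 1))\<^sup>2 = (cmod w)\<^sup>2 + 1 - 2 * Re w"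
      by (simp add: cmod_power2) (simp add: power2_eq_square algebra_simps)
    ultimately have "1/2 < Re w" using w by simp
    then have "3/2 \<le> cmod (w + 1)" using complex_Re_le_cmod[of "w + 1"] by simp
    moreover have "z ^ (2 ^ Suc j) - 1 = (w + 1) * (w - 1)"
    proof -
      have "z ^ (2 ^ Suc j) = w ^ 2" unfolding w_def by (metis power_Suc2 power_mult)
      then show ?thesis by (simp add: power2_eq_square algebra_simps)
    qed
    ultimately show ?case
      using Suc mult_mono[of "3/2" "cmod (w + 1)" "(3/2) ^ j * cmod (z - 1)" "cmod (w - 1)"]
      by (simp add: norm_mult w_def mult.assoc)
  qed simp
  have "cmod (z - 1) > 0" using z by simp
  obtain j where "1 / cmod (z - 1) < (3/2) ^ j" using real_arch_pow[of "3/2"] by auto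
  then have "1 < (3/2) ^ j * cmod (z - 1)" using \<open>cmod (z - 1) > 0\<close> by (simp add: field_simps)
  then show False using growth[of j] small[of "2 ^ j"] by simp
qed

locale torus_section = torus_action X \<alpha>
  for X :: "'a topology" and \<alpha> :: "complex^'n \<Rightarrow> 'a \<Rightarrow> 'a" +
  fixes \<sigma> :: "'a set \<Rightarrow> 'a"
  assumes Hausdorff: "Hausdorff_space X"
    and loc_compact: "locally_compact_space X"
    and sect: "orbit_section X \<alpha> \<sigma>"
begin

abbreviation "D \<equiv> orbit_space X \<alpha>"
abbreviation "J \<equiv> orbit \<alpha>"

lemma action_closed: "\<lbrakk>s \<in> torus; x \<in> topspace X\<rbrakk> \<Longrightarrow> \<alpha> s x \<in> topspace X"
  using continuous_map_image_subset_topspace[OF continuous_action] by fastforce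

lemma action_inv: "\<lbrakk>s \<in> torus; x \<in> topspace X\<rbrakk> \<Longrightarrow> \<alpha> (torus_inv s) (\<alpha> s x) = x"
  by (simp add: action_mult[symmetric] torus_inv_torus torus_inv_left action_one)

lemma action_commute: "\<lbrakk>s \<in> torus; t \<in> torus; x \<in> topspace X\<rbrakk> \<Longrightarrow> \<alpha> s (\<alpha> t x) = \<alpha> t (\<alpha> s x)"
  by (simp add: action_mult[symmetric] mult.commute)

lemma topspace_D: "topspace D = J ` topspace X"
  using quotient_map_orbit[of X \<alpha>] by (simp add: quotient_map_def)

lemma J_D: "x \<in> topspace X \<Longrightarrow> J x \<in> topspace D"
  by (simp add: topspace_D)

lemma J_cont: "continuous_map X D J"
  by (rule quotient_imp_continuous_map[OF quotient_map_orbit])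

lemma J_self: "x \<in> topspace X \<Longrightarrow> x \<in> J x"
  unfolding orbit_def using one_torus action_one by (metis image_eqI)

lemma J_eqD: "\<lbrakk>x \<in> topspace X; x' \<in> topspace X; J x = J x'\<rbrakk> \<Longrightarrow> \<exists>s\<in>torus. x' = \<alpha> s x"
  using J_self[of x'] by (auto simp: orbit_def)

lemma J_action:
  assumes s: "s \<in> torus" and x: "x \<in> topspace X" shows "J (\<alpha> s x) = J x"
proof -
  have "\<alpha> t (\<alpha> s x) \<in> J x" if "t \<in> torus" for t
    using that s x by (auto simp: orbit_def action_mult[symmetric] mult_torus)
  moreover have "\<alpha> t x \<in> J (\<alpha> s x)" if t: "t \<in> torus" for t
  proof -
    have "\<alpha> t x = \<alpha> (t * torus_inv s) (\<alpha> s x)"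
      using t s x by (simp add: action_mult action_closed action_inv torus_inv_torus)
    then show ?thesis using t s by (auto simp: orbit_def mult_torus torus_inv_torus)
  qed
  ultimately show ?thesis by (auto simp: orbit_def)
qed

lemma \<sigma>_cont: "continuous_map D X \<sigma>" and J_\<sigma>: "y \<in> topspace D \<Longrightarrow> J (\<sigma> y) = y"
  using sect by (auto simp: orbit_section_def)

lemma \<sigma>_closed: "y \<in> topspace D \<Longrightarrow> \<sigma> y \<in> topspace X"
  using continuous_map_image_subset_topspace[OF \<sigma>_cont] by blast

lemma point_form: "x \<in> topspace X \<Longrightarrow> \<exists>s\<in>torus. x = \<alpha> s (\<sigma> (J x))"
  using J_eqD[of "\<sigma> (J x)" x] by (simp add: \<sigma>_closed J_D J_\<sigma>)

text \<open>The torus is commutative, so an element fixing one point of an orbit fixes all of them.\<close>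

lemma isotropy_iff:
  assumes x: "x \<in> topspace X"
  shows "s \<in> isotropy X \<alpha> (J x) \<longleftrightarrow> s \<in> torus \<and> \<alpha> s x = x"
proof -
  have "\<alpha> s x' = x'" if s: "s \<in> torus" "\<alpha> s x = x" and x': "x' \<in> topspace X" "J x' = J x" for x'
  proof -
    obtain t where t: "t \<in> torus" "x' = \<alpha> t x" using J_eqD[OF x x'(1)] x' by metis
    then show ?thesis using s x by (simp add: action_commute[of s t x])
  qed
  then show ?thesis using x by (auto simp: isotropy_def)
qed

lemma isotropy_\<sigma>_iff: "y \<in> topspace D \<Longrightarrow> s \<in> isotropy X \<alpha> y \<longleftrightarrow> s \<in> torus \<and> \<alpha> s (\<sigma> y) = \<sigma> y"
  using isotropy_iff[of "\<sigma> y" s] by (simp add: \<sigma>_closed J_\<sigma>)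

lemma isotropy_torus: "isotropy X \<alpha> y \<subseteq> torus"
  by (auto simp: isotropy_def)

lemma Delta_iff: "y \<in> Delta X \<alpha> k \<longleftrightarrow> y \<in> topspace D \<and> k \<in> isotropy_dual X \<alpha> y"
  by (simp add: Delta_def isotropy_dual_def)

lemma M_iff: "x \<in> M_set X \<alpha> k \<longleftrightarrow> x \<in> topspace X \<and> (\<forall>s\<in>torus. \<alpha> s x = x \<longrightarrow> pairing k s = 1)"
  using isotropy_iff[of x] by (auto simp: M_set_def Delta_def J_D)

text \<open>All topological statements about the action reduce to this one: a set of points \<open>x\<close> defined by the existence of a
torus element satisfying a closed condition jointly with \<open>x\<close> is closed.\<close>

lemma closedin_projection:
  assumes "closedin (prod_topology (top_of_set (torus :: (complex^'n) set)) Y) C"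
  shows "closedin Y (snd ` C)"
proof -
  have "compact_space (top_of_set (torus :: (complex^'n) set))"
    using compact_torus by (intro compact_space_subtopology) simp
  then show ?thesis using closed_map_snd assms unfolding closed_map_def by blast
qed

lemma closedin_pairing:
  assumes "closed C"
  shows "closedin (prod_topology (top_of_set torus) Y) {p \<in> topspace (prod_topology (top_of_set torus) Y). pairing k (fst p) \<in> C}"
proof (rule closedin_continuous_map_preimage)
  have "continuous_map (top_of_set torus) euclidean (pairing k)"
    by (simp add: continuous_on_pairing)
  then have "continuous_map (prod_topology (top_of_set torus) Y) euclidean (pairing k \<circ> fst)"
    using continuous_map_compose continuous_map_fst by blast
  then show "continuous_map (prod_topology (top_of_set torus) Y) euclidean (\<lambda>p. pairing k (fst p))"
    by (simp add: o_def)
qed (use assms in simp)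

lemma action_fun_cont: "continuous_map (prod_topology (top_of_set torus) X) X (\<lambda>p. \<alpha> (fst p) (snd p))"
  using continuous_action by (simp add: case_prod_unfold)

text \<open>A point outside \<open>M_set k\<close> is fixed by some \<open>s\<close> with \<open>pairing k s \<noteq> 1\<close>.  A suitable power of \<open>s\<close> still fixes
the point, and the value of \<open>k\<close> on it has distance at least \<open>1\<close> from \<open>1\<close>.  The condition so becomes
closed, and the complement is a projection along the torus.\<close>

lemma openin_M: "openin X (M_set X \<alpha> k)"
proof -
  let ?P = "prod_topology (top_of_set torus) X"
  define C where "C = {p \<in> topspace ?P. \<alpha> (fst p) (snd p) = snd p} \<inter>
     {p \<in> topspace ?P. pairing k (fst p) \<in> {z. 1 \<le> cmod (z - 1)}}"
  have "closedin ?P C"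
    unfolding C_def
    by (intro closedin_Int closedin_continuous_maps_eq[OF Hausdorff] action_fun_cont continuous_map_snd
        closedin_pairing closed_Collect_le continuous_intros)
  then have "closedin X (snd ` C)" by (rule closedin_projection)
  moreover have "snd ` C = topspace X - M_set X \<alpha> k"
  proof (intro equalityI subsetI)
    fix x assume "x \<in> snd ` C"
    then obtain s where "s \<in> torus" "x \<in> topspace X" "\<alpha> s x = x" "1 \<le> cmod (pairing k s - 1)"
      by (auto simp: C_def)
    then show "x \<in> topspace X - M_set X \<alpha> k" by (auto simp: M_iff)
  next
    fix x assume "x \<in> topspace X - M_set X \<alpha> k"
    then obtain s where s: "s \<in> torus" "x \<in> topspace X" "\<alpha> s x = x" "pairing k s \<noteq> 1"
      by (auto simp: M_iff)
    obtain m where m: "1 \<le> cmod (pairing k s ^ m - 1)"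
      using unit_circle_no_small_subgroups[OF norm_pairing[OF s(1)] s(4)] by blast
    have "\<alpha> (s ^ m) x = x"
    proof (induction m)
      case (Suc m)
      then show ?case using s by (simp add: action_mult power_torus)
    qed (simp add: action_one s)
    then have "(s ^ m, x) \<in> C" using s m by (simp add: C_def power_torus pairing_power)
    then show "x \<in> snd ` C" by force
  qed
  moreover have "M_set X \<alpha> k \<subseteq> topspace X" by (auto simp: M_set_def)
  ultimately show ?thesis by (metis closedin_def double_diff order_refl)
qed

lemma openin_Delta: "openin D (Delta X \<alpha> k)"
proof -
  have "{x \<in> topspace X. J x \<in> Delta X \<alpha> k} = M_set X \<alpha> k" by (simp add: M_set_def)
  moreover have "Delta X \<alpha> k \<subseteq> J ` topspace X" by (auto simp: Delta_def topspace_D)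
  ultimately show ?thesis using openin_M by (simp add: openin_orbit_space)
qed

text \<open>Two representations \<open>\<alpha> s (\<sigma> y) = \<alpha> t (\<sigma> y')\<close> of a point have \<open>y = y'\<close> and differ by an element of the
isotropy group of \<open>y\<close>, on which the character \<open>k\<close> is trivial because \<open>y\<close> lies in \<open>Delta k\<close>.\<close>

lemma k_fun_eq:
  assumes y: "y \<in> Delta X \<alpha> k" and s: "s \<in> torus"
  shows "k_fun X \<alpha> \<sigma> k (\<alpha> s (\<sigma> y)) = pairing k s"
  unfolding k_fun_def rho_def
proof (rule the_equality)
  show "\<exists>y'\<in>Delta X \<alpha> k. \<exists>s'\<in>torus. \<alpha> s (\<sigma> y) = \<alpha> s' (\<sigma> y') \<and> pairing k s = pairing k s'"
    using assms by blast
next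
  fix c assume "\<exists>y'\<in>Delta X \<alpha> k. \<exists>s'\<in>torus. \<alpha> s (\<sigma> y) = \<alpha> s' (\<sigma> y') \<and> c = pairing k s'"
  then obtain y' t where t: "y' \<in> Delta X \<alpha> k" "t \<in> torus" "\<alpha> s (\<sigma> y) = \<alpha> t (\<sigma> y')" "c = pairing k t"
    by blast
  have yD: "y \<in> topspace D" "y' \<in> topspace D" using y t by (auto simp: Delta_def)
  then have "y' = y" using t(2,3) s by (metis J_action J_\<sigma> \<sigma>_closed)
  then have "\<alpha> (torus_inv s * t) (\<sigma> y) = \<sigma> y"
    using t s yD by (metis action_inv action_mult torus_inv_torus \<sigma>_closed)
  then have "torus_inv s * t \<in> isotropy X \<alpha> y"
    using s t yD by (simp add: isotropy_\<sigma>_iff mult_torus torus_inv_torus)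
  then have "pairing k (torus_inv s * t) = 1" using y by (simp add: Delta_def)
  then have "pairing k s * pairing k (torus_inv s * t) = pairing k s" by simp
  then show "c = pairing k s"
    using s t(4) by (simp add: pairing_mult[symmetric] mult.assoc[symmetric] torus_inv_right)
qed

lemma k_fun_pairing:
  assumes "x \<in> M_set X \<alpha> k" "s \<in> torus" "x = \<alpha> s (\<sigma> (J x))"
  shows "k_fun X \<alpha> \<sigma> k x = pairing k s"
proof -
  have "J x \<in> Delta X \<alpha> k" using assms(1) by (simp add: M_set_def)
  then show ?thesis using k_fun_eq[OF _ assms(2), of "J x" k] assms(3) by simp
qed

lemma norm_k_fun:
  assumes "x \<in> M_set X \<alpha> k" shows "cmod (k_fun X \<alpha> \<sigma> k x) = 1"
proof -
  obtain s where "s \<in> torus" "x = \<alpha> s (\<sigma> (J x))"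
    using point_form[of x] assms by (auto simp: M_iff)
  then show ?thesis using k_fun_pairing[OF assms] norm_pairing by simp
qed

text \<open>For \<open>x\<close> in \<open>M_set k\<close>, the value of \<open>k_fun k\<close> lies in \<open>C\<close> exactly if some \<open>s\<close> satisfies
\<open>\<alpha> s (\<sigma> (J x)) = x\<close> and \<open>pairing k s \<in> C\<close>: the preimage of a closed set is again a projection.\<close>

lemma k_fun_cont: "continuous_map (subtopology X (M_set X \<alpha> k)) euclidean (k_fun X \<alpha> \<sigma> k)"
  unfolding continuous_map_closedin
proof (intro conjI allI impI)
  let ?P = "prod_topology (top_of_set torus) X"
  let ?M = "subtopology X (M_set X \<alpha> k)"
  have M: "M_set X \<alpha> k \<subseteq> topspace X" by (auto simp: M_set_def)
  fix C :: "complex set" assume "closedin euclidean C"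
  then have C: "closed C" by simp
  define E where "E = {p \<in> topspace ?P. \<alpha> (fst p) (\<sigma> (J (snd p))) = snd p} \<inter>
     {p \<in> topspace ?P. pairing k (fst p) \<in> C}"
  have "continuous_map ?P ?P (\<lambda>p. (fst p, \<sigma> (J (snd p))))"
    by (intro continuous_map_pairedI continuous_map_fst continuous_map_compose[OF continuous_map_snd, unfolded o_def]
        continuous_map_compose[OF J_cont \<sigma>_cont, unfolded o_def])
  then have "continuous_map ?P X (\<lambda>p. \<alpha> (fst p) (\<sigma> (J (snd p))))"
    using continuous_map_compose[OF _ action_fun_cont, of ?P "\<lambda>p. (fst p, \<sigma> (J (snd p)))"]
    by (simp add: o_def)
  then have "closedin ?P E"
    unfolding E_def
    by (intro closedin_Int closedin_continuous_maps_eq[OF Hausdorff] continuous_map_snd closedin_pairing C)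
  then have "closedin X (snd ` E)" by (rule closedin_projection)
  moreover have "{x \<in> topspace ?M. k_fun X \<alpha> \<sigma> k x \<in> C} = M_set X \<alpha> k \<inter> snd ` E"
  proof (intro equalityI subsetI)
    fix x assume "x \<in> {x \<in> topspace ?M. k_fun X \<alpha> \<sigma> k x \<in> C}"
    then have x: "x \<in> M_set X \<alpha> k" "k_fun X \<alpha> \<sigma> k x \<in> C" by auto
    then obtain s where s: "s \<in> torus" "x = \<alpha> s (\<sigma> (J x))"
      using point_form[of x] by (auto simp: M_iff)
    then have "(s, x) \<in> E" using x M k_fun_pairing[OF x(1) s] by (auto simp: E_def)
    then show "x \<in> M_set X \<alpha> k \<inter> snd ` E" using x by force
  next
    fix x assume "x \<in> M_set X \<alpha> k \<inter> snd ` E"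
    then obtain s where s: "x \<in> M_set X \<alpha> k" "s \<in> torus" "\<alpha> s (\<sigma> (J x)) = x" "pairing k s \<in> C"
      by (auto simp: E_def)
    then have "k_fun X \<alpha> \<sigma> k x = pairing k s"
      using k_fun_pairing by simp
    then show "x \<in> {x \<in> topspace ?M. k_fun X \<alpha> \<sigma> k x \<in> C}" using s M by auto
  qed
  ultimately show "closedin ?M {x \<in> topspace ?M. k_fun X \<alpha> \<sigma> k x \<in> C}"
    by (metis closedin_subtopology inf_commute)
qed simp

lemma k_fun_add:
  "x \<in> M_set X \<alpha> k \<Longrightarrow> x \<in> M_set X \<alpha> l \<Longrightarrow> x \<in> M_set X \<alpha> (k + l) \<and>
    k_fun X \<alpha> \<sigma> (k + l) x = k_fun X \<alpha> \<sigma> k x * k_fun X \<alpha> \<sigma> l x"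
proof -
  assume k: "x \<in> M_set X \<alpha> k" and l: "x \<in> M_set X \<alpha> l"
  have kl: "x \<in> M_set X \<alpha> (k + l)" using k l by (auto simp: M_iff pairing_add)
  obtain s where s: "s \<in> torus" "x = \<alpha> s (\<sigma> (J x))" using k point_form[of x] by (auto simp: M_iff)
  note k_fun_pairing[OF _ s]
  then show ?thesis using k l kl s(1) by (simp add: pairing_add)
qed

lemma k_fun_minus:
  assumes k: "x \<in> M_set X \<alpha> k"
  shows "x \<in> M_set X \<alpha> (- k) \<and> k_fun X \<alpha> \<sigma> (- k) x = cnj (k_fun X \<alpha> \<sigma> k x)"
proof -
  have mk: "x \<in> M_set X \<alpha> (- k)" using k by (auto simp: M_iff pairing_minus)
  obtain s where s: "s \<in> torus" "x = \<alpha> s (\<sigma> (J x))" using k point_form[of x] by (auto simp: M_iff)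
  note k_fun_pairing[OF _ s]
  then show ?thesis using k mk s(1) by (simp add: pairing_minus)
qed

lemma Hausdorff_D: "Hausdorff_space D"
  by (rule Hausdorff_space_injective_preimage[OF Hausdorff \<sigma>_cont]) (metis J_\<sigma> inj_onI)

text \<open>The section identifies the orbit space with the closed subset of \<open>X\<close> on which \<open>\<sigma> \<circ> J\<close> is the identity.\<close>

lemma loc_compact_D: "locally_compact_space D"
proof -
  have "section_map D X \<sigma>"
    unfolding section_map_def retraction_maps_def using \<sigma>_cont J_cont J_\<sigma> by blast
  then have "D homeomorphic_space subtopology X (\<sigma> ` topspace D)"
    by (intro embedding_map_imp_homeomorphic_space section_imp_embedding_map)
  moreover have "\<sigma> ` topspace D = {x \<in> topspace X. \<sigma> (J x) = x}"
    using J_D by (force simp: J_\<sigma> \<sigma>_closed)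
  moreover have "closedin X {x \<in> topspace X. \<sigma> (J x) = x}"
    using closedin_continuous_maps_eq[OF Hausdorff continuous_map_compose[OF J_cont \<sigma>_cont] continuous_map_id]
    by simp
  ultimately show ?thesis
    using locally_compact_space_closed_subset[OF loc_compact] homeomorphic_locally_compact_space by metis
qed

text \<open>The preimage of \<open>C\<close> is the image of the compact set \<open>torus \<times> \<sigma> ` C\<close> under the action.\<close>

lemma compactin_J_preimage:
  assumes C: "compactin D C" shows "compactin X {x \<in> topspace X. J x \<in> C}"
proof -
  have "compact (torus :: (complex^'n) set)" by (rule compact_torus)
  then have "compactin (prod_topology (top_of_set (torus :: (complex^'n) set)) X) (torus \<times> \<sigma> ` C)"
    using image_compactin[OF C \<sigma>_cont]
    by (simp add: compactin_Times compactin_subtopology)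
  then have "compactin X ((\<lambda>p. \<alpha> (fst p) (snd p)) ` (torus \<times> \<sigma> ` C))"
    by (rule image_compactin[OF _ action_fun_cont])
  moreover have "(\<lambda>p. \<alpha> (fst p) (snd p)) ` (torus \<times> \<sigma> ` C) = {x \<in> topspace X. J x \<in> C}"
  proof -
    have CD: "C \<subseteq> topspace D" using C by (rule compactin_subset_topspace)
    show ?thesis
    proof (intro equalityI subsetI)
      fix x assume "x \<in> {x \<in> topspace X. J x \<in> C}"
      then show "x \<in> (\<lambda>p. \<alpha> (fst p) (snd p)) ` (torus \<times> \<sigma> ` C)"
        using point_form[of x] by force
    next
      fix x assume "x \<in> (\<lambda>p. \<alpha> (fst p) (snd p)) ` (torus \<times> \<sigma> ` C)"
      then obtain s y where "s \<in> torus" "y \<in> C" "x = \<alpha> s (\<sigma> y)" by auto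
      then show "x \<in> {x \<in> topspace X. J x \<in> C}"
        using CD by (auto simp: action_closed \<sigma>_closed J_action J_\<sigma> subsetD)
    qed
  qed
  ultimately show ?thesis by simp
qed

end

section \<open>The convolution algebra of the isotropy bundle\<close>

lemma C0_sum_closed:
  "\<lbrakk>finite I; \<And>i. i \<in> I \<Longrightarrow> f i \<in> sa_carrier (C0 X)\<rbrakk> \<Longrightarrow> (\<lambda>x. \<Sum>i\<in>I. f i x) \<in> sa_carrier (C0 X)"
proof (induction I rule: finite_induct)
  case empty
  then show ?case using cstar_algebra.zero_closed[OF cstar_algebra_C0, of X] by simp
next
  case (insert i I)
  then show ?case using C0_add_closed[of "f i" X "\<lambda>x. \<Sum>i\<in>I. f i x"] by simp
qed

context torus_section
begin

abbreviation "G \<equiv> G0 X \<alpha>"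

lemma topspace_G: "topspace (gtop G) = {(y, k). y \<in> Delta X \<alpha> k}"
  by (auto simp: G0_def Delta_def)

lemma G_simps [simp]: "rng G = fst" "src G = fst" "gmul G (y, k) (z, l) = (y, k + l)" "ginv G (y, k) = (y, - k)"
  by (simp_all add: G0_def)

lemma Delta_D: "y \<in> Delta X \<alpha> k \<Longrightarrow> y \<in> topspace D"
  by (simp add: Delta_def)

lemma Delta_zero: "Delta X \<alpha> 0 = topspace D"
  by (auto simp: Delta_def pairing_zero)

lemma Delta_add: "\<lbrakk>y \<in> Delta X \<alpha> k; y \<in> Delta X \<alpha> l\<rbrakk> \<Longrightarrow> y \<in> Delta X \<alpha> (k + l)"
  using isotropy_torus by (fastforce simp: Delta_def pairing_add)

lemma Delta_minus: "y \<in> Delta X \<alpha> (- k) \<longleftrightarrow> y \<in> Delta X \<alpha> k"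
proof -
  have "y \<in> Delta X \<alpha> (- k)" if "y \<in> Delta X \<alpha> k" for k
    using that isotropy_torus by (fastforce simp: Delta_def pairing_minus)
  from this[of k] this[of "-k"] show ?thesis by auto
qed

lemma M_iff_Delta: "x \<in> topspace X \<Longrightarrow> x \<in> M_set X \<alpha> k \<longleftrightarrow> J x \<in> Delta X \<alpha> k"
  by (simp add: M_set_def)

text \<open>A description of \<open>Cc (gtop G)\<close> that avoids the topology of the bundle: finitely many functions on the orbit space,
the one of index \<open>k\<close> having compact support inside \<open>Delta k\<close>.  The finite set \<open>F\<close> is any set of indices containing
those of the nonzero functions; keeping it as a parameter allows support estimates for products.\<close>

definition fibrewise :: "(int^'n) set \<Rightarrow> ('a set \<times> (int^'n) \<Rightarrow> complex) \<Rightarrow> bool" where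
  "fibrewise F f \<longleftrightarrow> finite F \<and> (\<forall>y k. k \<notin> F \<longrightarrow> f (y, k) = 0) \<and>
     (\<forall>k. continuous_map D euclidean (\<lambda>y. f (y, k)) \<and>
          (\<exists>K. compactin D K \<and> K \<subseteq> Delta X \<alpha> k \<and> (\<forall>y. y \<notin> K \<longrightarrow> f (y, k) = 0)))"

lemma fibrewiseD:
  assumes "fibrewise F f"
  shows "finite F" "k \<notin> F \<Longrightarrow> f (y, k) = 0" "continuous_map D euclidean (\<lambda>y. f (y, k))"
    "y \<notin> Delta X \<alpha> k \<Longrightarrow> f (y, k) = 0"
  using assms unfolding fibrewise_def by (auto, metis subsetD)

lemma fibrewise_support:
  assumes "fibrewise F f"
  obtains K where "compactin D K" "K \<subseteq> Delta X \<alpha> k" "\<And>y. y \<notin> K \<Longrightarrow> f (y, k) = 0"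
  using assms unfolding fibrewise_def by metis

lemma fibrewise_mono: "\<lbrakk>fibrewise F f; F \<subseteq> F'; finite F'\<rbrakk> \<Longrightarrow> fibrewise F' f"
  unfolding fibrewise_def by blast

text \<open>Continuity holds because the character lattice is discrete, and the support is contained in a finite union of compact
sets \<open>K k \<times> {k}\<close>.\<close>

lemma fibrewise_imp_Cc:
  assumes f: "fibrewise F f" shows "f \<in> Cc (gtop G)"
proof -
  let ?P = "prod_topology D (discrete_topology (UNIV :: (int^'n) set))"
  have cont: "continuous_map ?P euclidean f"
    unfolding continuous_map_def
  proof (intro conjI allI impI)
    fix W :: "complex set" assume W: "openin euclidean W"
    have "openin ?P ({y \<in> topspace D. f (y, k) \<in> W} \<times> {k})" for k
      using openin_continuous_map_preimage[OF fibrewiseD(3)[OF f] W] by (simp add: openin_prod_Times_iff)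
    then have "openin ?P (\<Union>k. {y \<in> topspace D. f (y, k) \<in> W} \<times> {k})" by blast
    moreover have "(\<Union>k. {y \<in> topspace D. f (y, k) \<in> W} \<times> {k}) = {p \<in> topspace ?P. f p \<in> W}" by auto
    ultimately show "openin ?P {p \<in> topspace ?P. f p \<in> W}" by simp
  qed simp
  have gtop: "gtop G = subtopology ?P (\<Union>k. Delta X \<alpha> k \<times> {k})" by (simp add: G0_def)
  have cont': "continuous_map (gtop G) euclidean f"
    unfolding gtop by (rule continuous_map_from_subtopology[OF cont])
  have zero: "f p = 0" if "p \<notin> topspace (gtop G)" for p
    using that fibrewiseD(4)[OF f] by (cases p) (auto simp: topspace_G)
  have "\<forall>k. \<exists>K. compactin D K \<and> K \<subseteq> Delta X \<alpha> k \<and> (\<forall>y. y \<notin> K \<longrightarrow> f (y, k) = 0)"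
    using f unfolding fibrewise_def by blast
  then obtain K where K: "\<And>k. compactin D (K k)" "\<And>k. K k \<subseteq> Delta X \<alpha> k"
      "\<And>k y. y \<notin> K k \<Longrightarrow> f (y, k) = 0"
    by metis
  define C where "C = (\<Union>k\<in>F. K k \<times> {k})"
  have "compactin ?P (K k \<times> {k})" for k
    using K(1) by (simp add: compactin_Times)
  then have "compactin ?P C"
    unfolding C_def using fibrewiseD(1)[OF f] by (intro compactin_Union) auto
  moreover have "C \<subseteq> (\<Union>k. Delta X \<alpha> k \<times> {k})" using K(2) by (auto simp: C_def)
  ultimately have C: "compactin (gtop G) C" by (simp add: gtop compactin_subtopology)
  have "Hausdorff_space (gtop G)"
    unfolding gtop by (intro Hausdorff_space_subtopology) (simp add: Hausdorff_space_prod_topology Hausdorff_D)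
  then have "closedin (gtop G) C" using C by (rule compactin_imp_closedin)
  moreover have "{p \<in> topspace (gtop G). f p \<noteq> 0} \<subseteq> C"
  proof
    fix p assume "p \<in> {p \<in> topspace (gtop G). f p \<noteq> 0}"
    then have "f (fst p, snd p) \<noteq> 0" by simp
    then have "snd p \<in> F" "fst p \<in> K (snd p)"
      using fibrewiseD(2)[OF f, of "snd p" "fst p"] K(3)[of "fst p" "snd p"] by blast+
    then show "p \<in> C" unfolding C_def by (auto simp: mem_Times_iff)
  qed
  ultimately have "gtop G closure_of {p \<in> topspace (gtop G). f p \<noteq> 0} \<subseteq> C" by (intro closure_of_minimal)
  then have "compactin (gtop G) (gtop G closure_of {p \<in> topspace (gtop G). f p \<noteq> 0})"
    using C closed_compactin closedin_closure_of by blast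
  then show ?thesis using cont' zero by (simp add: Cc_def)
qed

text \<open>The projection of a compact support to the discrete lattice is finite, and its part in the sheet of index \<open>k\<close>
projects to a compact subset of \<open>Delta k\<close>.  As \<open>Delta k\<close> is open, \<open>f\<close> is continuous in this sheet after extension
by zero.\<close>

lemma Cc_imp_fibrewise:
  assumes "f \<in> Cc (gtop G)" shows "\<exists>F. fibrewise F f"
proof -
  let ?P = "prod_topology D (discrete_topology (UNIV :: (int^'n) set))"
  have gtop: "gtop G = subtopology ?P (\<Union>k. Delta X \<alpha> k \<times> {k})" by (simp add: G0_def)
  define S where "S = gtop G closure_of {p \<in> topspace (gtop G). f p \<noteq> 0}"
  have f: "continuous_map (gtop G) euclidean f" "\<And>p. p \<notin> topspace (gtop G) \<Longrightarrow> f p = 0"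
    and S: "compactin (gtop G) S"
    using assms by (auto simp: Cc_def S_def)
  have zero: "f p = 0" if "p \<notin> S" for p
  proof (rule ccontr)
    assume "f p \<noteq> 0"
    then have "p \<in> {p \<in> topspace (gtop G). f p \<noteq> 0}" using f(2) by blast
    also have "\<dots> \<subseteq> S" unfolding S_def by (intro closure_of_subset) auto
    finally show False using that by simp
  qed
  have SP: "compactin ?P S" and SG: "S \<subseteq> topspace (gtop G)"
    using S compactin_subset_topspace[OF S] by (simp_all add: gtop compactin_subtopology)
  define F where "F = snd ` S"
  have "compactin (discrete_topology UNIV) F"
    unfolding F_def by (rule image_compactin[OF SP continuous_map_snd])
  then have fin: "finite F" by (simp add: compactin_discrete_topology)
  have slice: "continuous_map D euclidean (\<lambda>y. f (y, k)) \<and>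
      (\<exists>K. compactin D K \<and> K \<subseteq> Delta X \<alpha> k \<and> (\<forall>y. y \<notin> K \<longrightarrow> f (y, k) = 0))" for k
  proof -
    define K where "K = fst ` (S \<inter> (topspace D \<times> {k}))"
    have "closedin ?P (topspace D \<times> {k})" by (simp add: closedin_prod_Times_iff)
    then have "compactin ?P (S \<inter> (topspace D \<times> {k}))"
      using SP by (intro compact_Int_closedin) auto
    then have K: "compactin D K"
      unfolding K_def by (rule image_compactin[OF _ continuous_map_fst])
    have KD: "K \<subseteq> Delta X \<alpha> k" using SG by (auto simp: K_def topspace_G)
    have K0: "f (y, k) = 0" if "y \<notin> K" for y
    proof (rule zero)
      show "(y, k) \<notin> S" using that SG Delta_D by (force simp: K_def topspace_G)
    qed
    have "continuous_map (subtopology D (Delta X \<alpha> k)) ?P (\<lambda>y. (y, k))"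
      by (intro continuous_map_pairedI) (auto intro: continuous_map_from_subtopology)
    then have "continuous_map (subtopology D (Delta X \<alpha> k)) (gtop G) (\<lambda>y. (y, k))"
      unfolding gtop by (auto simp: continuous_map_in_subtopology)
    then have "continuous_map (subtopology D (Delta X \<alpha> k)) euclidean (\<lambda>y. f (y, k))"
      using continuous_map_compose[OF _ f(1)] by (simp add: o_def)
    then have "continuous_map D euclidean (\<lambda>y. f (y, k))"
      using continuous_map_vanishing_outside[OF openin_Delta compactin_imp_closedin[OF Hausdorff_D K] KD] K0
      by blast
    then show ?thesis using K KD K0 by blast
  qed
  have "f (y, k) = 0" if "k \<notin> F" for y k
    using zero[of "(y, k)"] that by (force simp: F_def)
  then show ?thesis using fin slice unfolding fibrewise_def by blast
qed

lemma fibrewise_zero: "fibrewise {} (\<lambda>_. 0)"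
  by (auto simp: fibrewise_def)

lemma fibrewise_add:
  assumes f: "fibrewise F f" and g: "fibrewise E g"
  shows "fibrewise (F \<union> E) (\<lambda>p. f p + g p)"
  unfolding fibrewise_def
proof (intro conjI allI)
  fix k
  obtain K L where K: "compactin D K" "K \<subseteq> Delta X \<alpha> k" "\<And>y. y \<notin> K \<Longrightarrow> f (y, k) = 0"
    and L: "compactin D L" "L \<subseteq> Delta X \<alpha> k" "\<And>y. y \<notin> L \<Longrightarrow> g (y, k) = 0"
    using fibrewise_support[OF f, of k] fibrewise_support[OF g, of k] by metis
  show "\<exists>K. compactin D K \<and> K \<subseteq> Delta X \<alpha> k \<and> (\<forall>y. y \<notin> K \<longrightarrow> f (y, k) + g (y, k) = 0)"
    using K L by (intro exI[of _ "K \<union> L"]) (auto intro: compactin_Un)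
qed (use fibrewiseD[OF f] fibrewiseD[OF g] in \<open>auto intro: continuous_map_add\<close>)

lemma fibrewise_scale:
  assumes f: "fibrewise F f" shows "fibrewise F (\<lambda>p. c * f p)"
  unfolding fibrewise_def
proof (intro conjI allI)
  fix k
  show "\<exists>K. compactin D K \<and> K \<subseteq> Delta X \<alpha> k \<and> (\<forall>y. y \<notin> K \<longrightarrow> c * f (y, k) = 0)"
    by (rule fibrewise_support[OF f, of k]) auto
qed (use fibrewiseD[OF f] in \<open>auto intro: continuous_map_mult\<close>)

lemma involution_eq:
  assumes f: "fibrewise F f" shows "involution G f (y, k) = cnj (f (y, - k))"
  using fibrewiseD(4)[OF f, of y "-k"] by (auto simp: involution_def topspace_G Delta_minus)

lemma fibrewise_involution:
  assumes f: "fibrewise F f" shows "fibrewise (uminus ` F) (involution G f)"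
  unfolding fibrewise_def
proof (intro conjI allI impI)
  fix y k assume "k \<notin> uminus ` F"
  then have "- k \<notin> F" by (metis imageI minus_minus)
  then show "involution G f (y, k) = 0" using fibrewiseD(2)[OF f] by (simp add: involution_eq[OF f])
next
  fix k
  show "continuous_map D euclidean (\<lambda>y. involution G f (y, k))"
    using fibrewiseD(3)[OF f] by (simp add: involution_eq[OF f] continuous_map_cnj)
  show "\<exists>K. compactin D K \<and> K \<subseteq> Delta X \<alpha> k \<and> (\<forall>y. y \<notin> K \<longrightarrow> involution G f (y, k) = 0)"
    by (rule fibrewise_support[OF f, of "-k"]) (metis Delta_minus complex_cnj_zero involution_eq[OF f] subset_iff)
qed (use fibrewiseD(1)[OF f] in simp)

text \<open>The pairs over which the convolution sums are all \<open>((y, l), (y, k - l))\<close> with both entries in the bundle; \<open>f\<close> and \<open>g\<close>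
vanish at pairs outside the bundle, so it is harmless to include them.\<close>

lemma convolution_eq:
  assumes f: "fibrewise F f" and g: "fibrewise E g"
  shows "convolution G f g (y, k) = (\<Sum>l\<in>F. f (y, l) * g (y, k - l))"
proof -
  define S where "S = {(a, b). a \<in> topspace (gtop G) \<and> b \<in> topspace (gtop G) \<and>
                          src G a = rng G b \<and> gmul G a b = (y, k)}"
  define T where "T = (\<lambda>l. ((y, l), (y, k - l))) ` F"
  have "convolution G f g (y, k) = (\<Sum>\<^sub>\<infinity>(a, b)\<in>S. f a * g b)"
    by (simp add: convolution_def S_def)
  also have "\<dots> = (\<Sum>\<^sub>\<infinity>(a, b)\<in>T. f a * g b)"
  proof (rule infsum_cong_neutral)
    fix p assume p: "p \<in> T - S"
    then obtain l where l: "p = ((y, l), (y, k - l))" by (auto simp: T_def)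
    have "y \<notin> Delta X \<alpha> l \<or> y \<notin> Delta X \<alpha> (k - l)" using p by (auto simp: l S_def topspace_G)
    then show "(case p of (a, b) \<Rightarrow> f a * g b) = 0"
      using fibrewiseD(4)[OF f] fibrewiseD(4)[OF g] by (auto simp: l)
  next
    fix p assume p: "p \<in> S - T"
    obtain z l z' m where pp: "p = ((z, l), (z', m))" by (metis surj_pair)
    have "z = y" "z' = y" "m = k - l" using p by (auto simp: pp S_def)
    then have "l \<notin> F" using p by (auto simp: pp T_def)
    then show "(case p of (a, b) \<Rightarrow> f a * g b) = 0" using fibrewiseD(2)[OF f] by (simp add: pp)
  qed simp
  also have "\<dots> = (\<Sum>(a, b)\<in>T. f a * g b)"
    using fibrewiseD(1)[OF f] by (simp add: T_def)
  also have "\<dots> = (\<Sum>l\<in>F. f (y, l) * g (y, k - l))"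
    unfolding T_def by (subst sum.reindex) (auto simp: inj_on_def)
  finally show ?thesis .
qed

lemma fibrewise_convolution:
  assumes f: "fibrewise F f" and g: "fibrewise E g"
  shows "fibrewise ((\<lambda>(k, l). k + l) ` (F \<times> E)) (convolution G f g)"
  unfolding fibrewise_def
proof (intro conjI allI impI)
  show "finite ((\<lambda>(k, l). k + l) ` (F \<times> E))" using fibrewiseD(1)[OF f] fibrewiseD(1)[OF g] by simp
next
  fix y k assume k: "k \<notin> (\<lambda>(k, l). k + l) ` (F \<times> E)"
  have "k - l \<notin> E" if "l \<in> F" for l
    using k that by (force simp: image_iff)
  then show "convolution G f g (y, k) = 0"
    using fibrewiseD(2)[OF g] by (simp add: convolution_eq[OF f g])
next
  fix k
  show "continuous_map D euclidean (\<lambda>y. convolution G f g (y, k))"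
    using fibrewiseD[OF f] fibrewiseD[OF g]
    by (simp add: convolution_eq[OF f g] continuous_map_sum continuous_map_mult)
  have "\<forall>l. \<exists>K. compactin D K \<and> K \<subseteq> Delta X \<alpha> l \<and> (\<forall>y. y \<notin> K \<longrightarrow> f (y, l) = 0)"
    using f unfolding fibrewise_def by blast
  then obtain K where K: "\<And>l. compactin D (K l)" "\<And>l. K l \<subseteq> Delta X \<alpha> l"
      "\<And>l y. y \<notin> K l \<Longrightarrow> f (y, l) = 0"
    by metis
  have "\<forall>l. \<exists>K. compactin D K \<and> K \<subseteq> Delta X \<alpha> l \<and> (\<forall>y. y \<notin> K \<longrightarrow> g (y, l) = 0)"
    using g unfolding fibrewise_def by blast
  then obtain L where L: "\<And>l. compactin D (L l)" "\<And>l. L l \<subseteq> Delta X \<alpha> l"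
      "\<And>l y. y \<notin> L l \<Longrightarrow> g (y, l) = 0"
    by metis
  \<comment> \<open>A product of terms of index \<open>l\<close> and \<open>k - l\<close> lives over \<open>Delta l \<inter> Delta (k - l)\<close>, which lies in \<open>Delta k\<close>.\<close>
  define N where "N = (\<Union>l\<in>F. K l \<inter> L (k - l))"
  have "compactin D N"
    unfolding N_def using fibrewiseD(1)[OF f] K(1) L(1)
    by (intro compactin_Union) (auto intro!: compact_Int_closedin compactin_imp_closedin Hausdorff_D)
  moreover have "N \<subseteq> Delta X \<alpha> k"
  proof
    fix y assume "y \<in> N"
    then obtain l where "y \<in> K l" "y \<in> L (k - l)" by (auto simp: N_def)
    then have "y \<in> Delta X \<alpha> l" "y \<in> Delta X \<alpha> (k - l)" using K(2) L(2) by blast+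
    then show "y \<in> Delta X \<alpha> k" using Delta_add[of y l "k - l"] by simp
  qed
  moreover have "convolution G f g (y, k) = 0" if "y \<notin> N" for y
    unfolding convolution_eq[OF f g] using that K(3) L(3) by (intro sum.neutral) (auto simp: N_def)
  ultimately show "\<exists>K. compactin D K \<and> K \<subseteq> Delta X \<alpha> k \<and> (\<forall>y. y \<notin> K \<longrightarrow> convolution G f g (y, k) = 0)"
    by blast
qed

section \<open>The Gelfand transform of the convolution algebra\<close>

text \<open>The Gelfand transform of the commutative algebra \<open>Cc (gtop G)\<close>; the evaluation at \<open>x\<close> is a character of this algebra.\<close>

definition gelfand :: "('a set \<times> (int^'n) \<Rightarrow> complex) \<Rightarrow> 'a \<Rightarrow> complex" where
  "gelfand f x = (if x \<in> topspace X then \<Sum>\<^sub>\<infinity>k\<in>isotropy_dual X \<alpha> (J x). f (J x, k) * k_fun X \<alpha> \<sigma> k x else 0)"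

lemma gelfand_eq:
  assumes f: "fibrewise F f" and x: "x \<in> topspace X"
  shows "gelfand f x = (\<Sum>k\<in>F. f (J x, k) * k_fun X \<alpha> \<sigma> k x)"
proof -
  have "(\<Sum>\<^sub>\<infinity>k\<in>isotropy_dual X \<alpha> (J x). f (J x, k) * k_fun X \<alpha> \<sigma> k x) =
        (\<Sum>\<^sub>\<infinity>k\<in>F. f (J x, k) * k_fun X \<alpha> \<sigma> k x)"
  proof (rule infsum_cong_neutral)
    fix k assume "k \<in> F - isotropy_dual X \<alpha> (J x)"
    then have "J x \<notin> Delta X \<alpha> k" by (simp add: Delta_iff)
    then show "f (J x, k) * k_fun X \<alpha> \<sigma> k x = 0" using fibrewiseD(4)[OF f] by simp
  qed (use fibrewiseD(2)[OF f] in auto)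
  then show ?thesis using x fibrewiseD(1)[OF f] by (simp add: gelfand_def)
qed

text \<open>In the coordinates given by the section, the transform is a trigonometric polynomial on each orbit, whose coefficients
are the values of \<open>f\<close>.\<close>

lemma gelfand_at:
  assumes f: "fibrewise F f" and y: "y \<in> topspace D" and s: "s \<in> torus"
  shows "gelfand f (\<alpha> s (\<sigma> y)) = (\<Sum>k\<in>F. f (y, k) * pairing k s)"
proof -
  have x: "\<alpha> s (\<sigma> y) \<in> topspace X" "J (\<alpha> s (\<sigma> y)) = y"
    using y s by (simp_all add: action_closed \<sigma>_closed J_action J_\<sigma>)
  show ?thesis
    unfolding gelfand_eq[OF f x(1)] x(2)
    using fibrewiseD(4)[OF f, of y] k_fun_eq[OF _ s, of y] by (intro sum.cong) auto
qed

text \<open>Each summand is continuous on the open set \<open>M_set k\<close> and vanishes outside the preimage of a compact subset of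
\<open>Delta k\<close>, which is compact because the orbit map is proper.\<close>

lemma gelfand_closed:
  assumes f: "fibrewise F f" shows "gelfand f \<in> sa_carrier (C0 X)"
proof -
  define t where "t k x = (if x \<in> topspace X then f (J x, k) * k_fun X \<alpha> \<sigma> k x else 0)" for k x
  have "t k \<in> sa_carrier (C0 X)" for k
  proof (rule fibrewise_support[OF f, of k])
    fix K assume K: "compactin D K" "K \<subseteq> Delta X \<alpha> k" "\<And>y. y \<notin> K \<Longrightarrow> f (y, k) = 0"
    define L where "L = {x \<in> topspace X. J x \<in> K}"
    have L: "compactin X L" unfolding L_def by (rule compactin_J_preimage[OF K(1)])
    have LM: "L \<subseteq> M_set X \<alpha> k" using K(2) by (auto simp: L_def M_set_def)
    have zero: "t k x = 0" if "x \<notin> L" for x using that K(3) by (auto simp: t_def L_def)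
    have "continuous_map X euclidean (\<lambda>x. f (J x, k))"
      using continuous_map_compose[OF J_cont fibrewiseD(3)[OF f, of k]] by (simp add: o_def)
    then have "continuous_map (subtopology X (M_set X \<alpha> k)) euclidean (\<lambda>x. f (J x, k) * k_fun X \<alpha> \<sigma> k x)"
      by (intro continuous_map_mult k_fun_cont continuous_map_from_subtopology)
    then have "continuous_map (subtopology X (M_set X \<alpha> k)) euclidean (t k)"
      by (rule continuous_map_eq) (simp add: t_def)
    then have "continuous_map X euclidean (t k)"
      by (rule continuous_map_vanishing_outside[OF openin_M compactin_imp_closedin[OF Hausdorff L] LM])
        (use zero in simp)
    then show "t k \<in> sa_carrier (C0 X)"
    proof (rule C0_carrierI)
      fix e :: real assume "e > 0"
      then have "{x \<in> topspace X. e \<le> cmod (t k x)} \<subseteq> L" using zero by force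
      then show "\<exists>K. compactin X K \<and> {x \<in> topspace X. e \<le> cmod (t k x)} \<subseteq> K" using L by blast
    qed (simp add: t_def)
  qed
  then have "(\<lambda>x. \<Sum>k\<in>F. t k x) \<in> sa_carrier (C0 X)" using fibrewiseD(1)[OF f] by (intro C0_sum_closed)
  moreover have "gelfand f = (\<lambda>x. \<Sum>k\<in>F. t k x)"
    using gelfand_eq[OF f] by (auto simp: t_def gelfand_def)
  ultimately show ?thesis by simp
qed

lemma gelfand_zero: "gelfand (\<lambda>_. 0) = (\<lambda>_. 0)"
  by (auto simp: gelfand_def)

lemma gelfand_add:
  assumes f: "fibrewise F f" and g: "fibrewise E g"
  shows "gelfand (\<lambda>p. f p + g p) = (\<lambda>x. gelfand f x + gelfand g x)"
proof
  fix x
  have fin: "finite (F \<union> E)" using fibrewiseD(1)[OF f] fibrewiseD(1)[OF g] by simp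
  have f': "fibrewise (F \<union> E) f" and g': "fibrewise (F \<union> E) g"
    using fibrewise_mono[OF f _ fin] fibrewise_mono[OF g _ fin] by auto
  show "gelfand (\<lambda>p. f p + g p) x = gelfand f x + gelfand g x"
  proof (cases "x \<in> topspace X")
    case True
    then show ?thesis
      using gelfand_eq[OF fibrewise_add[OF f g]] gelfand_eq[OF f'] gelfand_eq[OF g']
      by (simp add: distrib_right sum.distrib)
  qed (simp add: gelfand_def)
qed

lemma gelfand_scale:
  assumes f: "fibrewise F f" shows "gelfand (\<lambda>p. c * f p) = (\<lambda>x. c * gelfand f x)"
proof
  fix x show "gelfand (\<lambda>p. c * f p) x = c * gelfand f x"
  proof (cases "x \<in> topspace X")
    case True
    then show ?thesis
      using gelfand_eq[OF fibrewise_scale[OF f]] gelfand_eq[OF f] by (simp add: sum_distrib_left mult.assoc)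
  qed (simp add: gelfand_def)
qed

lemma gelfand_involution:
  assumes f: "fibrewise F f" shows "gelfand (involution G f) = (\<lambda>x. cnj (gelfand f x))"
proof
  fix x
  show "gelfand (involution G f) x = cnj (gelfand f x)"
  proof (cases "x \<in> topspace X")
    case True
    have *: "cnj (f (J x, k)) * k_fun X \<alpha> \<sigma> (- k) x = cnj (f (J x, k) * k_fun X \<alpha> \<sigma> k x)" for k
      using fibrewiseD(4)[OF f, of "J x" k] k_fun_minus[of x k] M_iff_Delta[OF True, of k]
      by (cases "J x \<in> Delta X \<alpha> k") auto
    have "gelfand (involution G f) x = (\<Sum>k\<in>uminus ` F. cnj (f (J x, - k)) * k_fun X \<alpha> \<sigma> k x)"
      unfolding gelfand_eq[OF fibrewise_involution[OF f] True] by (simp add: involution_eq[OF f])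
    also have "\<dots> = (\<Sum>k\<in>F. cnj (f (J x, k)) * k_fun X \<alpha> \<sigma> (- k) x)"
      by (subst sum.reindex) auto
    finally show ?thesis by (simp add: * gelfand_eq[OF f True])
  qed (simp add: gelfand_def)
qed

text \<open>Each map \<open>k \<mapsto> k_fun k x\<close> is multiplicative on the fibre over \<open>J x\<close>, so this is the usual rearrangement of a product
of sums.\<close>

lemma gelfand_convolution:
  assumes f: "fibrewise F f" and g: "fibrewise E g"
  shows "gelfand (convolution G f g) = (\<lambda>x. gelfand f x * gelfand g x)"
proof
  fix x
  show "gelfand (convolution G f g) x = gelfand f x * gelfand g x"
  proof (cases "x \<in> topspace X")
    case x: True
    define y where "y = J x"
    define kf where "kf k = k_fun X \<alpha> \<sigma> k x" for k
    define S where "S = (\<lambda>(k, l). k + l) ` (F \<times> E)"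
    have fin: "finite S" "finite E" using fibrewiseD(1)[OF f] fibrewiseD(1)[OF g] by (simp_all add: S_def)
    have mult: "f (y, l) * g (y, m) * kf (m + l) = f (y, l) * kf l * (g (y, m) * kf m)" for l m
    proof (cases "y \<in> Delta X \<alpha> l \<and> y \<in> Delta X \<alpha> m")
      case True
      then show ?thesis using k_fun_add[of x m l] M_iff_Delta[OF x] by (simp add: kf_def y_def)
    next
      case False
      then show ?thesis using fibrewiseD(4)[OF f] fibrewiseD(4)[OF g] by auto
    qed
    have inner: "(\<Sum>k\<in>S. f (y, l) * g (y, k - l) * kf k) = (\<Sum>m\<in>E. f (y, l) * kf l * (g (y, m) * kf m))"
      if l: "l \<in> F" for l
    proof -
      have "(\<Sum>k\<in>S. f (y, l) * g (y, k - l) * kf k) =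
            (\<Sum>k\<in>(\<lambda>m. m + l) ` E. f (y, l) * g (y, k - l) * kf k)"
      proof (rule sum.mono_neutral_right[OF fin(1)])
        show "(\<lambda>m. m + l) ` E \<subseteq> S" using l by (force simp: S_def image_iff add.commute)
        show "\<forall>k\<in>S - (\<lambda>m. m + l) ` E. f (y, l) * g (y, k - l) * kf k = 0"
        proof
          fix k assume "k \<in> S - (\<lambda>m. m + l) ` E"
          then have "k - l \<notin> E" by (metis DiffD2 diff_add_cancel image_eqI)
          then show "f (y, l) * g (y, k - l) * kf k = 0" using fibrewiseD(2)[OF g] by simp
        qed
      qed
      also have "\<dots> = (\<Sum>m\<in>E. f (y, l) * g (y, m) * kf (m + l))"
        by (subst sum.reindex) auto
      finally show ?thesis by (simp add: mult)
    qed
    have "gelfand (convolution G f g) x = (\<Sum>k\<in>S. \<Sum>l\<in>F. f (y, l) * g (y, k - l) * kf k)"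
      using gelfand_eq[OF fibrewise_convolution[OF f g] x]
      by (simp add: convolution_eq[OF f g] S_def y_def kf_def sum_distrib_right)
    also have "\<dots> = (\<Sum>l\<in>F. \<Sum>m\<in>E. f (y, l) * kf l * (g (y, m) * kf m))"
      by (subst sum.swap) (simp add: inner)
    also have "\<dots> = gelfand f x * gelfand g x"
      using gelfand_eq[OF f x] gelfand_eq[OF g x] by (simp add: sum_product y_def kf_def)
    finally show ?thesis .
  qed (simp add: gelfand_def)
qed

definition transform_norm :: "('a set \<times> (int^'n) \<Rightarrow> complex) \<Rightarrow> real" where
  "transform_norm f = sa_norm (C0 X) (gelfand f)"

lemma transform_norm_nonneg: "fibrewise F f \<Longrightarrow> 0 \<le> transform_norm f"
  unfolding transform_norm_def by (intro C0_norm_nonneg gelfand_closed)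

text \<open>The values of \<open>f\<close> over \<open>y\<close> are the Fourier coefficients of its transform on the orbit over \<open>y\<close>.\<close>

lemma coefficient_le_transform_norm:
  assumes f: "fibrewise F f" and y: "y \<in> topspace D"
  shows "cmod (f (y, k)) \<le> transform_norm f"
proof (cases "k \<in> F")
  case True
  show ?thesis
  proof (rule trig_coefficient_le[OF fibrewiseD(1)[OF f] _ True, of "\<lambda>k. f (y, k)"])
    fix s :: "complex^'n" assume s: "s \<in> torus"
    show "cmod (\<Sum>k\<in>F. f (y, k) * pairing k s) \<le> transform_norm f"
      using C0_norm_upper[OF gelfand_closed[OF f], of "\<alpha> s (\<sigma> y)"] gelfand_at[OF f y s] s y
      by (simp add: transform_norm_def action_closed \<sigma>_closed)
  qed
next
  case False
  then show ?thesis using fibrewiseD(2)[OF f] transform_norm_nonneg[OF f] by simp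
qed

lemma I_norm_eq:
  assumes f: "fibrewise F f"
  shows "I_norm G f = Sup (insert 0 ((\<lambda>y. \<Sum>k\<in>F. cmod (f (y, k))) ` topspace D))"
proof -
  have sum: "(\<Sum>\<^sub>\<infinity>\<gamma>\<in>{\<gamma> \<in> topspace (gtop G). fst \<gamma> = y}. cmod (f \<gamma>)) = (\<Sum>k\<in>F. cmod (f (y, k)))" for y
  proof -
    have "(\<Sum>\<^sub>\<infinity>\<gamma>\<in>{\<gamma> \<in> topspace (gtop G). fst \<gamma> = y}. cmod (f \<gamma>)) = (\<Sum>\<^sub>\<infinity>\<gamma>\<in>Pair y ` F. cmod (f \<gamma>))"
    proof (rule infsum_cong_neutral)
      fix p assume p: "p \<in> {\<gamma> \<in> topspace (gtop G). fst \<gamma> = y} - Pair y ` F"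
      then have "p = (y, snd p)" by (auto simp: prod_eq_iff)
      then have "snd p \<notin> F" using p by blast
      then show "cmod (f p) = 0" using fibrewiseD(2)[OF f] \<open>p = (y, snd p)\<close> by (metis norm_zero)
    qed (use fibrewiseD(4)[OF f] in \<open>auto simp: topspace_G\<close>)
    also have "\<dots> = (\<Sum>\<gamma>\<in>Pair y ` F. cmod (f \<gamma>))" using fibrewiseD(1)[OF f] by simp
    also have "\<dots> = (\<Sum>k\<in>F. cmod (f (y, k)))" by (subst sum.reindex) (auto simp: inj_on_def)
    finally show ?thesis .
  qed
  have "fst ` topspace (gtop G) = topspace D"
    using Delta_zero by (force simp: topspace_G Delta_D)
  then show ?thesis by (simp add: I_norm_def sum)
qed

lemma I_norm_bdd:
  assumes f: "fibrewise F f"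
  shows "bdd_above (insert 0 ((\<lambda>y. \<Sum>k\<in>F. cmod (f (y, k))) ` topspace D))" (is ?bdd)
    and "I_norm G f \<le> real (card F) * transform_norm f"
proof -
  have le: "(\<Sum>k\<in>F. cmod (f (y, k))) \<le> real (card F) * transform_norm f" if "y \<in> topspace D" for y
    using sum_bounded_above[of F "\<lambda>k. cmod (f (y, k))" "transform_norm f"] coefficient_le_transform_norm[OF f that] by simp
  have 0: "0 \<le> real (card F) * transform_norm f" using transform_norm_nonneg[OF f] by simp
  show ?bdd using le 0 by (intro bdd_aboveI[of _ "real (card F) * transform_norm f"]) auto
  show "I_norm G f \<le> real (card F) * transform_norm f"
    unfolding I_norm_eq[OF f] using le 0 by (intro cSup_least) auto
qed

lemma I_norm_nonneg: "fibrewise F f \<Longrightarrow> 0 \<le> I_norm G f"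
  unfolding I_norm_eq by (intro cSup_upper I_norm_bdd) auto

lemma gelfand_le_I_norm:
  assumes f: "fibrewise F f" shows "cmod (gelfand f x) \<le> I_norm G f"
proof (cases "x \<in> topspace X")
  case x: True
  have "cmod (gelfand f x) \<le> (\<Sum>k\<in>F. cmod (f (J x, k) * k_fun X \<alpha> \<sigma> k x))"
    unfolding gelfand_eq[OF f x] by (rule norm_sum)
  also have "\<dots> \<le> (\<Sum>k\<in>F. cmod (f (J x, k)))"
  proof (rule sum_mono)
    fix k
    show "cmod (f (J x, k) * k_fun X \<alpha> \<sigma> k x) \<le> cmod (f (J x, k))"
      using fibrewiseD(4)[OF f, of "J x" k] norm_k_fun[of x k] M_iff_Delta[OF x, of k]
      by (cases "J x \<in> Delta X \<alpha> k") (auto simp: norm_mult)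
  qed
  also have "\<dots> \<le> I_norm G f"
    unfolding I_norm_eq[OF f] using x J_D by (intro cSup_upper I_norm_bdd[OF f]) auto
  finally show ?thesis .
next
  case False
  then show ?thesis using I_norm_nonneg[OF f] by (simp add: gelfand_def)
qed

end

section \<open>Square-summable sequences\<close>

lemma ell2_summable: "\<xi> \<in> ell2 S \<Longrightarrow> summable (\<lambda>i. (cmod (\<xi> i))\<^sup>2)"
  by (simp add: ell2_def)

lemma ell2_norm_nonneg: "\<xi> \<in> ell2 S \<Longrightarrow> 0 \<le> ell2_norm \<xi>"
  unfolding ell2_norm_def by (simp add: ell2_summable suminf_nonneg)

lemma ell2_partial_norm:
  assumes "\<xi> \<in> ell2 S" shows "L2_set (\<lambda>i. cmod (\<xi> i)) {..<n} \<le> ell2_norm \<xi>"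
  unfolding L2_set_def ell2_norm_def
  using sum_le_suminf[OF ell2_summable[OF assms], of "{..<n}"] by simp

lemma ell2_Cauchy_Schwarz:
  assumes "\<xi> \<in> ell2 S" "\<eta> \<in> ell2 S"
  shows "cmod (ell2_inner \<xi> \<eta>) \<le> ell2_norm \<xi> * ell2_norm \<eta>"
proof -
  have le: "(\<Sum>i<n. cmod (\<xi> i) * cmod (\<eta> i)) \<le> ell2_norm \<xi> * ell2_norm \<eta>" for n
  proof -
    have "(\<Sum>i<n. cmod (\<xi> i) * cmod (\<eta> i)) \<le> L2_set (\<lambda>i. cmod (\<xi> i)) {..<n} * L2_set (\<lambda>i. cmod (\<eta> i)) {..<n}"
      using L2_set_mult_ineq[of "\<lambda>i. cmod (\<xi> i)" "\<lambda>i. cmod (\<eta> i)" "{..<n}"] by simp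
    also have "\<dots> \<le> ell2_norm \<xi> * ell2_norm \<eta>"
      using assms by (intro mult_mono ell2_partial_norm L2_set_nonneg) (auto intro: ell2_norm_nonneg)
    finally show ?thesis .
  qed
  have "(\<Sum>i\<le>n. cmod (\<xi> i) * cmod (\<eta> i)) \<le> ell2_norm \<xi> * ell2_norm \<eta>" for n
    using le[of "Suc n"] by (simp add: lessThan_Suc_atMost)
  then have sm: "summable (\<lambda>i. cmod (\<xi> i) * cmod (\<eta> i))"
    by (intro bounded_imp_summable[where B = "ell2_norm \<xi> * ell2_norm \<eta>"]) auto
  have "cmod (ell2_inner \<xi> \<eta>) \<le> (\<Sum>i. cmod (\<xi> i) * cmod (\<eta> i))"
    unfolding ell2_inner_def using summable_norm[of "\<lambda>i. cnj (\<xi> i) * \<eta> i"] sm by (simp add: norm_mult)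
  also have "\<dots> \<le> ell2_norm \<xi> * ell2_norm \<eta>" by (rule suminf_le_const[OF sm le])
  finally show ?thesis .
qed

lemma ell2_inner_self:
  assumes "\<xi> \<in> ell2 S" shows "ell2_inner \<xi> \<xi> = complex_of_real ((ell2_norm \<xi>)\<^sup>2)"
proof -
  have "cnj z * z = complex_of_real ((cmod z)\<^sup>2)" for z
    using complex_norm_square[of z] by (simp add: mult.commute)
  then have "ell2_inner \<xi> \<xi> = (\<Sum>i. complex_of_real ((cmod (\<xi> i))\<^sup>2))"
    unfolding ell2_inner_def by presburger
  also have "\<dots> = complex_of_real (\<Sum>i. (cmod (\<xi> i))\<^sup>2)"
    by (rule suminf_of_real[OF ell2_summable[OF assms], symmetric])
  finally show ?thesis
    using suminf_nonneg[OF ell2_summable[OF assms]] by (simp add: ell2_norm_def)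
qed

lemma ell2_norm_scale: 
  assumes "\<xi> \<in> ell2 S" shows "ell2_norm (\<lambda>i. c * \<xi> i) = cmod c * ell2_norm \<xi>"
  unfolding ell2_norm_def
  by (simp add: norm_mult power_mult_distrib suminf_mult[OF ell2_summable[OF assms]] real_sqrt_mult)

lemma ell2_scale: "\<xi> \<in> ell2 S \<Longrightarrow> (\<lambda>i. c * \<xi> i) \<in> ell2 S"
  by (auto simp: ell2_def norm_mult power_mult_distrib intro: summable_mult)

lemma ell2_zero: "(\<lambda>_. 0) \<in> ell2 S" "ell2_norm (\<lambda>_. 0) = 0"
  by (simp_all add: ell2_def ell2_norm_def)

text \<open>From \<open>\<parallel>Q \<xi>\<parallel>\<^sup>2 = \<langle>\<xi>, P (Q \<xi>)\<rangle>\<close> and the Cauchy-Schwarz inequality, where \<open>P\<close> is an adjoint of \<open>Q\<close>.  It serves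
twice: to pass from an operator to its self-adjoint square, and to double the exponent of a power.\<close>

lemma ell2_selfadjoint_square:
  assumes Q: "\<And>\<xi>. \<xi> \<in> ell2 S \<Longrightarrow> Q \<xi> \<in> ell2 S" and \<xi>: "\<xi> \<in> ell2 S" "ell2_norm \<xi> \<le> 1"
    and adj: "\<And>\<eta>. \<eta> \<in> ell2 S \<Longrightarrow> ell2_inner \<xi> (P \<eta>) = ell2_inner (Q \<xi>) \<eta>"
    and PQ: "P (Q \<xi>) \<in> ell2 S"
  shows "(ell2_norm (Q \<xi>))\<^sup>2 \<le> ell2_norm (P (Q \<xi>))"
proof -
  have "(ell2_norm (Q \<xi>))\<^sup>2 = cmod (ell2_inner \<xi> (P (Q \<xi>)))"
    using ell2_inner_self[OF Q[OF \<xi>(1)]] adj[OF Q[OF \<xi>(1)]] by (simp del: of_real_power)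
  also have "\<dots> \<le> ell2_norm \<xi> * ell2_norm (P (Q \<xi>))" by (rule ell2_Cauchy_Schwarz[OF \<xi>(1) PQ])
  also have "\<dots> \<le> ell2_norm (P (Q \<xi>))"
    using mult_right_mono[OF \<xi>(2) ell2_norm_nonneg[OF PQ]] by simp
  finally show ?thesis .
qed

section \<open>The full norm is the supremum norm of the Gelfand transform\<close>

definition lattice_box :: "nat \<Rightarrow> (int^'n) set" where
  "lattice_box r = {k. \<forall>i. \<bar>k $ i\<bar> \<le> int r}"

text \<open>The number of lattice points grows polynomially in \<open>r\<close>; this is what makes the I-norm of a convolution power
comparable to the supremum norm of its transform.\<close>

lemma lattice_box_card:
  "finite (lattice_box r :: (int^'n) set)"
  "card (lattice_box r :: (int^'n) set) \<le> (2 * r + 1) ^ CARD('n)"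
proof -
  let ?B = "PiE (UNIV :: 'n set) (\<lambda>_. {- int r..int r})"
  have eq: "(lattice_box r :: (int^'n) set) = vec_lambda ` ?B"
  proof (intro equalityI subsetI)
    fix k :: "int^'n" assume "k \<in> lattice_box r"
    then have "vec_nth k \<in> ?B" by (simp add: lattice_box_def PiE_UNIV_domain Pi_iff abs_le_iff minus_le_iff)
    then show "k \<in> vec_lambda ` ?B" by (intro image_eqI[of _ _ "vec_nth k"]) simp_all
  next
    fix k assume "k \<in> vec_lambda ` ?B"
    then obtain f where f: "k = vec_lambda f" "\<And>i. f i \<in> {- int r..int r}" by (auto simp: PiE_UNIV_domain Pi_iff)
    then show "k \<in> lattice_box r" by (simp add: lattice_box_def abs_le_iff minus_le_iff)
  qed
  have "finite ?B" by (intro finite_PiE) auto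
  moreover have "card ?B = (2 * r + 1) ^ CARD('n)"
    by (subst card_PiE) (auto simp: nat_add_distrib nat_mult_distrib)
  ultimately show "finite (lattice_box r :: (int^'n) set)"
    "card (lattice_box r :: (int^'n) set) \<le> (2 * r + 1) ^ CARD('n)"
    unfolding eq using card_image_le[of ?B vec_lambda] by auto
qed

lemma lattice_box_add: "\<lbrakk>k \<in> lattice_box r; l \<in> lattice_box r'\<rbrakk> \<Longrightarrow> k + l \<in> lattice_box (r + r')"
  unfolding lattice_box_def by (auto intro!: abs_triangle_ineq[THEN order_trans] add_mono)

lemma finite_subset_lattice_box:
  assumes "finite (F :: (int^'n) set)" obtains r where "F \<subseteq> lattice_box r"
proof
  show "F \<subseteq> lattice_box (\<Sum>k\<in>F. \<Sum>i\<in>UNIV. nat \<bar>k $ i\<bar>)"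
  proof
    fix k assume k: "k \<in> F"
    have "nat \<bar>k $ i\<bar> \<le> (\<Sum>k\<in>F. \<Sum>i\<in>UNIV. nat \<bar>k $ i\<bar>)" for i
    proof -
      have "nat \<bar>k $ i\<bar> \<le> (\<Sum>i\<in>UNIV. nat \<bar>k $ i\<bar>)" by (rule member_le_sum) auto
      also have "\<dots> \<le> (\<Sum>k\<in>F. \<Sum>i\<in>UNIV. nat \<bar>k $ i\<bar>)"
        using k assms by (intro member_le_sum) auto
      finally show ?thesis .
    qed
    then show "k \<in> lattice_box (\<Sum>k\<in>F. \<Sum>i\<in>UNIV. nat \<bar>k $ i\<bar>)"
      unfolding lattice_box_def using nat_le_iff by blast
  qed
qed

text \<open>If \<open>a > b\<close>, then the \<open>d\<close>-th root \<open>t > 1\<close> of \<open>a / b\<close> would satisfy \<open>t ^ m \<le> (2 * r + 1) * m\<close> for all powers \<open>m\<close> of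
two, which exponential growth excludes.\<close>

lemma le_of_power_le_polynomial:
  fixes a b :: real
  assumes a: "0 \<le> a" and b: "0 \<le> b" and d: "d > 0"
    and le: "\<And>j. a ^ (2 ^ j) \<le> (real (2 * (2 ^ j * r) + 1)) ^ d * b ^ (2 ^ j)"
  shows "a \<le> b"
proof (rule ccontr)
  assume "\<not> a \<le> b"
  then have ab: "b < a" by simp
  have bpos: "b > 0"
  proof (rule ccontr)
    assume "\<not> b > 0"
    then have "b = 0" using b by simp
    then show False using le[of 0] ab by simp
  qed
  define t where "t = root d (a / b)"
  have t: "t > 1" "t ^ d = a / b" using ab bpos d by (simp_all add: t_def)
  have bound: "t ^ (2 ^ j) \<le> real (2 ^ j) * real (2 * r + 1)" for j :: nat
  proof -
    have "(t ^ (2 ^ j)) ^ d = (t ^ d) ^ (2 ^ j)" by (simp add: power_mult[symmetric] mult.commute)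
    also have "\<dots> = a ^ (2 ^ j) / b ^ (2 ^ j)" by (simp add: t power_divide)
    also have "\<dots> \<le> (real (2 * (2 ^ j * r) + 1)) ^ d" using le[of j] bpos by (simp add: divide_le_eq)
    finally have "t ^ (2 ^ j) \<le> real (2 * (2 ^ j * r) + 1)"
      using power_mono_iff[of "t ^ (2 ^ j)" "real (2 * (2 ^ j * r) + 1)" d] t d by simp
    also have "\<dots> \<le> real (2 ^ j * (2 * r + 1))"
      unfolding of_nat_le_iff by (simp add: algebra_simps)
    finally show ?thesis by (simp add: algebra_simps)
  qed
  have "(\<lambda>n. real n * (1/t) ^ n) \<longlonglongrightarrow> 0"
    using t by (intro powser_times_n_limit_0) simp
  then have "\<forall>\<^sub>F n in sequentially. dist (real n * (1/t) ^ n) 0 < 1 / real (2 * r + 1)"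
    by (rule tendstoD) simp
  then obtain N where N: "\<And>n. n \<ge> N \<Longrightarrow> \<bar>real n * (1/t) ^ n\<bar> < 1 / real (2 * r + 1)"
    unfolding eventually_sequentially dist_real_def by auto
  have "N \<le> 2 ^ N" by (simp add: less_imp_le)
  from N[OF this] have "real (2 ^ N) * (1/t) ^ (2 ^ N) < 1 / real (2 * r + 1)" using t by simp
  then have "real (2 ^ N) * real (2 * r + 1) < t ^ (2 ^ N)"
    using t by (simp add: power_divide field_simps)
  then show False using bound[of N] by simp
qed

context torus_section
begin

fun dyadic_power :: "('a set \<times> (int^'n) \<Rightarrow> complex) \<Rightarrow> nat \<Rightarrow> 'a set \<times> (int^'n) \<Rightarrow> complex" where
  "dyadic_power h 0 = h"
| "dyadic_power h (Suc j) = convolution G (dyadic_power h j) (dyadic_power h j)"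

lemma fibrewise_dyadic_power:
  assumes h: "fibrewise (lattice_box r) h"
  shows "fibrewise (lattice_box (2 ^ j * r)) (dyadic_power h j)"
proof (induction j)
  case (Suc j)
  have "(\<lambda>(k, l). k + l) ` (lattice_box (2 ^ j * r) \<times> lattice_box (2 ^ j * r)) \<subseteq>
      (lattice_box (2 ^ Suc j * r) :: (int^'n) set)"
    using lattice_box_add[of _ "2 ^ j * r" _ "2 ^ j * r"] by (auto simp: mult_2 distrib_right)
  from fibrewise_mono[OF fibrewise_convolution[OF Suc Suc] this lattice_box_card(1)]
  show ?case by simp
qed (use h in simp)

lemma transform_norm_convolution_le:
  assumes f: "fibrewise F f" and g: "fibrewise E g"
  shows "transform_norm (convolution G f g) \<le> transform_norm f * transform_norm g"
  using cstar_algebra.norm_mult[OF cstar_algebra_C0 gelfand_closed[OF f] gelfand_closed[OF g]]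
  by (simp add: transform_norm_def gelfand_convolution[OF f g])

lemma transform_norm_dyadic_power:
  assumes h: "fibrewise (lattice_box r) h"
  shows "transform_norm (dyadic_power h j) \<le> transform_norm h ^ (2 ^ j)"
proof (induction j)
  case (Suc j)
  note p = fibrewise_dyadic_power[OF h, of j]
  have "transform_norm (dyadic_power h (Suc j)) \<le> transform_norm (dyadic_power h j) * transform_norm (dyadic_power h j)"
    using transform_norm_convolution_le[OF p p] by simp
  also have "\<dots> \<le> transform_norm h ^ (2 ^ j) * transform_norm h ^ (2 ^ j)"
    using Suc transform_norm_nonneg[OF p] transform_norm_nonneg[OF h] by (intro mult_mono) auto
  finally show ?case by (simp add: power_add[symmetric] mult_2)
qed simp

text \<open>A sum over a fibre has at most as many nonzero terms as the box has points, and each of them is bounded by the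
supremum norm of the transform of the power.\<close>

lemma I_norm_dyadic_power:
  assumes h: "fibrewise (lattice_box r) h"
  shows "I_norm G (dyadic_power h j) \<le> (real (2 * (2 ^ j * r) + 1)) ^ CARD('n) * transform_norm h ^ (2 ^ j)"
proof -
  note p = fibrewise_dyadic_power[OF h, of j]
  have "I_norm G (dyadic_power h j) \<le> real (card (lattice_box (2 ^ j * r) :: (int^'n) set)) * transform_norm (dyadic_power h j)"
    by (rule I_norm_bdd(2)[OF p])
  also have "\<dots> \<le> real ((2 * (2 ^ j * r) + 1) ^ CARD('n)) * transform_norm h ^ (2 ^ j)"
    using lattice_box_card(2) transform_norm_dyadic_power[OF h] transform_norm_nonneg[OF p]
    by (intro mult_mono) (simp_all only: of_nat_le_iff, simp)
  finally show ?thesis by simp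
qed

text \<open>The spectral radius argument: with \<open>h = f\<^sup>* * f\<close> and \<open>m = 2 ^ j\<close>, repeated use of \<open>ell2_selfadjoint_square\<close> bounds
\<open>\<parallel>L h \<xi>\<parallel> ^ m\<close> by \<open>\<parallel>L (h ^ m) \<xi>\<parallel>\<close>, which is at most the I-norm of \<open>h ^ m\<close>.  Letting \<open>j\<close> tend to infinity
gives \<open>\<parallel>L h \<xi>\<parallel> \<le> transform_norm h = (transform_norm f)\<^sup>2\<close>.\<close>

lemma representation_bound:
  assumes rep: "groupoid_rep G S L" and f: "fibrewise F f" and \<xi>: "\<xi> \<in> ell2 S" "ell2_norm \<xi> \<le> 1"
  shows "ell2_norm (L f \<xi>) \<le> transform_norm f"
proof -
  note rep' = rep[unfolded groupoid_rep_def]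
  have L: "L g \<eta> \<in> ell2 S" if "g \<in> Cc (gtop G)" "\<eta> \<in> ell2 S" for g \<eta>
    using rep'[THEN conjunct1, rule_format] that by simp
  have Lmult: "L (convolution G g h) \<eta> = L g (L h \<eta>)"
    if "g \<in> Cc (gtop G)" "h \<in> Cc (gtop G)" "\<eta> \<in> ell2 S" for g h \<eta>
    using rep'[THEN conjunct2, THEN conjunct2, THEN conjunct2, THEN conjunct2, THEN conjunct2, THEN conjunct1, rule_format] that by simp
  have Lstar: "ell2_inner \<eta> (L g \<zeta>) = ell2_inner (L (involution G g) \<eta>) \<zeta>"
    if "g \<in> Cc (gtop G)" "\<eta> \<in> ell2 S" "\<zeta> \<in> ell2 S" for g \<eta> \<zeta>
    using rep'[THEN conjunct2, THEN conjunct2, THEN conjunct2, THEN conjunct2, THEN conjunct2, THEN conjunct2, THEN conjunct1, rule_format] that by simp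
  have Lbound: "ell2_norm (L g \<eta>) \<le> I_norm G g * ell2_norm \<eta>"
    if "g \<in> Cc (gtop G)" "\<eta> \<in> ell2 S" for g \<eta>
    using rep'[THEN conjunct2, THEN conjunct2, THEN conjunct2, THEN conjunct2, THEN conjunct2, THEN conjunct2, THEN conjunct2, rule_format] that by simp
  define f' where "f' = involution G f"
  define h where "h = convolution G f' f"
  have f': "fibrewise (uminus ` F) f'" unfolding f'_def by (rule fibrewise_involution[OF f])
  have f'': "involution G f' = f"
    unfolding f'_def using involution_eq[OF fibrewise_involution[OF f]] involution_eq[OF f]
    by (simp add: fun_eq_iff)
  \<comment> \<open>A box containing all indices of \<open>h\<close>; those of the \<open>m\<close>-th power then lie in the \<open>m\<close>-fold box.\<close>
  obtain r where r: "(\<lambda>(k, l). k + l) ` (uminus ` F \<times> F) \<subseteq> lattice_box r"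
    using finite_subset_lattice_box fibrewiseD(1)[OF fibrewise_convolution[OF f' f]] by blast
  have h: "fibrewise (lattice_box r) h"
    unfolding h_def by (rule fibrewise_mono[OF fibrewise_convolution[OF f' f] r lattice_box_card(1)])
  have Cf: "f \<in> Cc (gtop G)" and Cf': "f' \<in> Cc (gtop G)" and Ch: "h \<in> Cc (gtop G)"
    using f f' h fibrewise_imp_Cc by blast+
  define p where "p = dyadic_power h"
  have Cp: "p j \<in> Cc (gtop G)" for j unfolding p_def using fibrewise_dyadic_power[OF h] fibrewise_imp_Cc by blast
  have Lh: "L h \<eta> = L f' (L f \<eta>)" if "\<eta> \<in> ell2 S" for \<eta>
    unfolding h_def using Lmult Cf Cf' that by blast
  have adj: "ell2_inner \<eta> (L (p j) \<zeta>) = ell2_inner (L (p j) \<eta>) \<zeta>" if "\<eta> \<in> ell2 S" "\<zeta> \<in> ell2 S" for \<eta> \<zeta> j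
    using that
  proof (induction j arbitrary: \<eta> \<zeta>)
    case 0
    have "ell2_inner \<eta> (L f' (L f \<zeta>)) = ell2_inner (L f \<eta>) (L f \<zeta>)"
      using Lstar[OF Cf' 0(1) L[OF Cf 0(2)]] f'' by simp
    also have "\<dots> = ell2_inner (L f' (L f \<eta>)) \<zeta>"
      using Lstar[OF Cf L[OF Cf 0(1)] 0(2)] by (simp add: f'_def)
    finally show ?case using Lh 0 by (simp add: p_def)
  next
    case (Suc j)
    then show ?case using Lmult[OF Cp Cp, of _ j j] Suc.IH L[OF Cp] by (simp add: p_def)
  qed
  have square: "(ell2_norm (L h \<xi>)) ^ (2 ^ j) \<le> ell2_norm (L (p j) \<xi>)" for j
  proof (induction j)
    case (Suc j)
    have "(ell2_norm (L h \<xi>)) ^ (2 ^ Suc j) = ((ell2_norm (L h \<xi>)) ^ (2 ^ j))\<^sup>2"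
      by (simp add: power_mult[symmetric] mult.commute)
    also have "\<dots> \<le> (ell2_norm (L (p j) \<xi>))\<^sup>2"
      using Suc ell2_norm_nonneg[OF L[OF Ch \<xi>(1)]] by (intro power_mono) auto
    also have "\<dots> \<le> ell2_norm (L (p j) (L (p j) \<xi>))"
      using adj[OF \<xi>(1)] L[OF Cp] \<xi> by (intro ell2_selfadjoint_square) auto
    also have "L (p j) (L (p j) \<xi>) = L (p (Suc j)) \<xi>" using Lmult[OF Cp Cp \<xi>(1)] by (simp add: p_def)
    finally show ?case .
  qed (simp add: p_def)
  have growth: "ell2_norm (L (p j) \<xi>) \<le> (real (2 * (2 ^ j * r) + 1)) ^ CARD('n) * transform_norm h ^ (2 ^ j)" for j
  proof -
    have "ell2_norm (L (p j) \<xi>) \<le> I_norm G (p j) * ell2_norm \<xi>" by (rule Lbound[OF Cp \<xi>(1)])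
    also have "\<dots> \<le> I_norm G (p j)"
      using mult_left_mono[OF \<xi>(2), of "I_norm G (p j)"] I_norm_nonneg[OF fibrewise_dyadic_power[OF h]]
      by (simp add: p_def)
    also have "\<dots> \<le> (real (2 * (2 ^ j * r) + 1)) ^ CARD('n) * transform_norm h ^ (2 ^ j)"
      unfolding p_def by (rule I_norm_dyadic_power[OF h])
    finally show ?thesis .
  qed
  have "ell2_norm (L h \<xi>) \<le> transform_norm h"
    using ell2_norm_nonneg[OF L[OF Ch \<xi>(1)]] transform_norm_nonneg[OF h] zero_less_card_finite
    by (rule le_of_power_le_polynomial[OF _ _ _ order_trans[OF square growth]])
  moreover have "(ell2_norm (L f \<xi>))\<^sup>2 \<le> ell2_norm (L h \<xi>)"
  proof -
    have "(ell2_norm (L f \<xi>))\<^sup>2 \<le> ell2_norm (L f' (L f \<xi>))"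
    proof (rule ell2_selfadjoint_square[OF L[OF Cf] \<xi>])
      show "ell2_inner \<xi> (L f' \<eta>) = ell2_inner (L f \<xi>) \<eta>" if "\<eta> \<in> ell2 S" for \<eta>
        using Lstar[OF Cf' \<xi>(1) that] f'' by simp
    qed (use L Cf Cf' \<xi> in auto)
    then show ?thesis using Lh[OF \<xi>(1)] by simp
  qed
  moreover have "transform_norm h = (transform_norm f)\<^sup>2"
    using cstar_algebra.cstar_identity[OF cstar_algebra_C0 gelfand_closed[OF f]]
    by (simp add: transform_norm_def h_def gelfand_convolution[OF f' f] gelfand_involution[OF f, folded f'_def])
  ultimately have "(ell2_norm (L f \<xi>))\<^sup>2 \<le> (transform_norm f)\<^sup>2" by simp
  then show ?thesis using transform_norm_nonneg[OF f] by (rule power2_le_imp_le)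
qed

lemma op_norm_bound:
  assumes rep: "groupoid_rep G S L" and f: "fibrewise F f"
  shows "op_norm S (L f) \<le> transform_norm f"
    and "\<lbrakk>\<xi> \<in> ell2 S; ell2_norm \<xi> \<le> 1\<rbrakk> \<Longrightarrow> ell2_norm (L f \<xi>) \<le> op_norm S (L f)"
proof -
  show "op_norm S (L f) \<le> transform_norm f"
    unfolding op_norm_def
  proof (rule cSup_least)
    have "(\<lambda>_. 0) \<in> ell2 S \<and> ell2_norm (\<lambda>_. 0) \<le> 1" by (simp add: ell2_zero)
    then show "{ell2_norm (L f \<xi>) |\<xi>. \<xi> \<in> ell2 S \<and> ell2_norm \<xi> \<le> 1} \<noteq> {}" by blast
  qed (use representation_bound[OF rep f] in auto)
  show "ell2_norm (L f \<xi>) \<le> op_norm S (L f)" if "\<xi> \<in> ell2 S" "ell2_norm \<xi> \<le> 1"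
    unfolding op_norm_def
    by (rule cSup_upper) (use that representation_bound[OF rep f] in \<open>auto intro!: bdd_aboveI[of _ "transform_norm f"]\<close>)
qed

text \<open>The one-dimensional Hilbert space is realised as the space of sequences supported at \<open>0\<close>.\<close>

lemma character_representation:
  assumes add: "\<And>f g. \<lbrakk>f \<in> Cc (gtop G); g \<in> Cc (gtop G)\<rbrakk> \<Longrightarrow> \<omega> (\<lambda>p. f p + g p) = \<omega> f + \<omega> g"
    and scale: "\<And>f c. f \<in> Cc (gtop G) \<Longrightarrow> \<omega> (\<lambda>p. c * f p) = c * \<omega> f"
    and mult: "\<And>f g. \<lbrakk>f \<in> Cc (gtop G); g \<in> Cc (gtop G)\<rbrakk> \<Longrightarrow> \<omega> (convolution G f g) = \<omega> f * \<omega> g"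
    and star: "\<And>f. f \<in> Cc (gtop G) \<Longrightarrow> \<omega> (involution G f) = cnj (\<omega> f)"
    and bound: "\<And>f. f \<in> Cc (gtop G) \<Longrightarrow> cmod (\<omega> f) \<le> I_norm G f"
  shows "groupoid_rep G {0} (\<lambda>f \<xi> i. \<omega> f * \<xi> i)"
  unfolding groupoid_rep_def
proof (intro conjI ballI allI, goal_cases)
  case (1 f \<xi>)
  then show ?case by (simp add: ell2_scale)
next
  case (7 f \<xi> \<eta>)
  then show ?case by (simp add: ell2_inner_def star mult_ac)
next
  case (8 f \<xi>)
  then show ?case using bound[of f] ell2_norm_nonneg[of \<xi>] by (auto simp: ell2_norm_scale intro: mult_right_mono)
qed (simp_all add: ell2_scale add scale mult distrib_left distrib_right mult_ac)

text \<open>The points of \<open>X\<close> give representations that attain the supremum norm.  The zero representation guarantees that the full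
norm is a supremum over a nonempty set and is nonnegative, also if \<open>X\<close> is empty.\<close>

lemma full_norm_eq:
  assumes f: "fibrewise F f" shows "full_norm G f = transform_norm f"
proof -
  let ?A = "{op_norm S (L f) |S L. groupoid_rep G S L}"
  have bdd: "bdd_above ?A"
    using op_norm_bound(1)[OF _ f] by (auto intro!: bdd_aboveI[of _ "transform_norm f"])
  have char: "cmod (\<omega> f) \<le> full_norm G f" if rep: "groupoid_rep G {0} (\<lambda>f \<xi> i. \<omega> f * \<xi> i)" for \<omega>
  proof -
    \<comment> \<open>A unit vector, at which the one-dimensional representation attains its norm.\<close>
    define e where "e i = (if i = 0 then 1 else 0 :: complex)" for i :: nat
    have "(\<lambda>i. (cmod (e i))\<^sup>2) sums (\<Sum>i\<in>{0}. (cmod (e i))\<^sup>2)"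
      by (rule sums_finite) (auto simp: e_def)
    then have s: "(\<lambda>i. (cmod (e i))\<^sup>2) sums 1" by (simp add: e_def)
    then have e: "e \<in> ell2 {0}" "ell2_norm e = 1"
      using sums_unique[OF s] by (auto simp: ell2_def ell2_norm_def e_def sums_iff)
    have "cmod (\<omega> f) \<le> op_norm {0} (\<lambda>\<xi> i. \<omega> f * \<xi> i)"
      using op_norm_bound(2)[OF rep f e(1)] e by (simp add: ell2_norm_scale[OF e(1)])
    also have "\<dots> \<le> full_norm G f"
      unfolding full_norm_def
      by (rule cSup_upper[OF _ bdd])
         (intro CollectI exI[of _ "{0}"] exI[of _ "\<lambda>f \<xi> i. \<omega> f * \<xi> i"] conjI refl rep)
    finally show ?thesis .
  qed
  have zero: "groupoid_rep G {0} (\<lambda>f \<xi> i. (\<lambda>_. 0) f * \<xi> i)"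
    using Cc_imp_fibrewise I_norm_nonneg by (intro character_representation) auto
  have point: "groupoid_rep G {0} (\<lambda>f \<xi> i. (\<lambda>f. gelfand f x) f * \<xi> i)" for x
    by (intro character_representation)
       (use Cc_imp_fibrewise gelfand_add gelfand_scale gelfand_convolution gelfand_involution gelfand_le_I_norm in metis)+
  show ?thesis
  proof (rule antisym)
    have "?A \<noteq> {}" using zero by blast
    then show "full_norm G f \<le> transform_norm f"
      unfolding full_norm_def by (rule cSup_least) (use op_norm_bound(1)[OF _ f] in auto)
    show "transform_norm f \<le> full_norm G f"
      unfolding transform_norm_def using char[OF zero] char[OF point] by (intro C0_norm_least) auto
  qed
qed

section \<open>Density of the Gelfand transforms\<close>

text \<open>The function on the torus obtained from \<open>g\<close> on the orbit over \<open>y\<close> is invariant under the isotropy group, so it has an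
approximation by characters \<open>k\<close> with \<open>y \<in> Delta k\<close>.  As \<open>Delta k\<close> is open and the set of orbits on which the
approximation fails is a projection along the torus, hence closed, the same polynomial works on a neighbourhood
of \<open>y\<close>, and the bump function \<open>\<phi>\<close> is chosen with compact support there.\<close>

lemma local_approximation:
  assumes g: "g \<in> sa_carrier (C0 X)" and y: "y \<in> topspace D" and e: "0 < e"
  shows "\<exists>F c \<phi> K. finite F \<and> continuous_map D euclideanreal \<phi> \<and> \<phi> y = 1 \<and> (\<forall>z. 0 \<le> \<phi> z) \<and>
     compactin D K \<and> (\<forall>k\<in>F. K \<subseteq> Delta X \<alpha> k) \<and> (\<forall>z. z \<notin> K \<longrightarrow> \<phi> z = 0) \<and>
     (\<forall>z\<in>K. \<forall>s\<in>torus. cmod (g (\<alpha> s (\<sigma> z)) - (\<Sum>k\<in>F. c k * pairing k s)) < e)"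
proof -
  let ?P = "prod_topology (top_of_set (torus :: (complex^'n) set)) D"
  have gcont: "continuous_map X euclidean g" by (rule C0_carrierD(1)[OF g])
  have rho: "continuous_map ?P euclidean (\<lambda>p. g (\<alpha> (fst p) (\<sigma> (snd p))))"
  proof -
    have "continuous_map ?P (prod_topology (top_of_set torus) X) (\<lambda>p. (fst p, \<sigma> (snd p)))"
      by (intro continuous_map_pairedI continuous_map_fst continuous_map_compose[OF continuous_map_snd \<sigma>_cont, unfolded o_def])
    then have "continuous_map ?P X (\<lambda>p. \<alpha> (fst p) (\<sigma> (snd p)))"
      using continuous_map_compose[OF _ action_fun_cont, of ?P "\<lambda>p. (fst p, \<sigma> (snd p))"] by (simp add: o_def)
    from continuous_map_compose[OF this gcont] show ?thesis by (simp add: o_def)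
  qed
  have "continuous_map (top_of_set torus) ?P (\<lambda>s. (s, y))"
    using y by (intro continuous_map_pairedI) auto
  from continuous_map_compose[OF this rho]
  have cont: "continuous_on torus (\<lambda>s. g (\<alpha> s (\<sigma> y)))" by (simp add: o_def)
  have inv: "g (\<alpha> (s * h) (\<sigma> y)) = g (\<alpha> s (\<sigma> y))" if "s \<in> torus" "h \<in> isotropy X \<alpha> y" for s h
    using that y by (simp add: isotropy_\<sigma>_iff action_mult \<sigma>_closed)
  obtain F c where F: "finite F" "\<And>k. k \<in> F \<Longrightarrow> \<forall>h\<in>isotropy X \<alpha> y. pairing k h = 1"
    and approx: "\<And>s. s \<in> torus \<Longrightarrow> cmod (g (\<alpha> s (\<sigma> y)) - (\<Sum>k\<in>F. c k * pairing k s)) < e"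
    using invariant_trig_approximation[OF isotropy_torus inv cont e] by blast
  have yF: "y \<in> Delta X \<alpha> k" if "k \<in> F" for k using F(2)[OF that] y by (simp add: Delta_def)
  define C where "C = {p \<in> topspace ?P. cmod (g (\<alpha> (fst p) (\<sigma> (snd p))) - (\<Sum>k\<in>F. c k * pairing k (fst p))) \<in> {e..}}"
  have "continuous_map ?P euclidean (\<lambda>p. \<Sum>k\<in>F. c k * pairing k (fst p))"
  proof -
    have "continuous_map (top_of_set torus) euclidean (\<lambda>s. \<Sum>k\<in>F. c k * pairing k s)"
      by (simp add: continuous_on_pairing continuous_on_sum continuous_on_mult continuous_on_const)
    from continuous_map_compose[OF continuous_map_fst this] show ?thesis by (simp add: o_def)
  qed
  then have "closedin ?P C"
    unfolding C_def
    by (intro closedin_continuous_map_preimage[where Y = euclideanreal] continuous_map_norm continuous_map_diff rho) auto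
  then have closed: "closedin D (snd ` C)" by (rule closedin_projection)
  define V where "V = (topspace D - snd ` C) \<inter> (topspace D \<inter> (\<Inter>k\<in>F. Delta X \<alpha> k))"
  have "openin D (topspace D \<inter> (\<Inter>k\<in>F. Delta X \<alpha> k))"
    using F(1) openin_Delta by (intro openin_Int_Inter) auto
  then have V: "openin D V" unfolding V_def using closed by blast
  have "y \<in> V"
    using approx y yF unfolding V_def C_def by fastforce
  then obtain \<phi> K where K: "continuous_map D euclideanreal \<phi>" "\<phi> y = 1" "\<And>z. 0 \<le> \<phi> z"
      "compactin D K" "K \<subseteq> V" "\<And>z. z \<notin> K \<Longrightarrow> \<phi> z = 0"
    using locally_compact_Hausdorff_bump[OF Hausdorff_D loc_compact_D V] by metis
  have close: "cmod (g (\<alpha> s (\<sigma> z)) - (\<Sum>k\<in>F. c k * pairing k s)) < e" if z: "z \<in> V" and s: "s \<in> torus" for z s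
  proof (rule ccontr)
    assume "\<not> ?thesis"
    then have "(s, z) \<in> C" using z s by (auto simp: C_def V_def)
    then show False using z by (force simp: V_def)
  qed
  have "K \<subseteq> Delta X \<alpha> k" if "k \<in> F" for k using K(5) that by (auto simp: V_def)
  moreover have "cmod (g (\<alpha> s (\<sigma> z)) - (\<Sum>k\<in>F. c k * pairing k s)) < e" if "z \<in> K" "s \<in> torus" for z s
    using close K(5) that by (simp add: subset_eq)
  ultimately show ?thesis
    using F(1) K(1-4,6) by (intro exI[of _ F] exI[of _ c] exI[of _ \<phi>] exI[of _ K]) simp
qed

text \<open>Finitely many of the local approximations suffice near the compact image \<open>C\<close> of the set where \<open>g\<close> is not small.  With
\<open>\<psi> = (\<Sum>y. \<phi> y)\<close>, the weights \<open>w y = \<phi> y / max \<psi> (1/2)\<close> are continuous everywhere, add up to a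
function \<open>\<theta>\<close> with values between \<open>0\<close> and \<open>1\<close>, and \<open>\<theta> = 1\<close> on \<open>C\<close>.  The weighted sum of the local polynomials is
close to \<open>\<theta> * g\<close>, and \<open>\<theta> * g\<close> is close to \<open>g\<close> because \<open>g\<close> is small outside \<open>C\<close>.\<close>

lemma gelfand_dense:
  assumes g: "g \<in> sa_carrier (C0 X)" and e: "0 < e"
  shows "\<exists>f\<in>Cc (gtop G). sa_dist (C0 X) (gelfand f) g < e"
proof -
  define C where "C = J ` {x \<in> topspace X. e/4 \<le> cmod (g x)}"
  have C: "compactin D C"
    unfolding C_def using C0_carrierD(3)[OF g, of "e/4"] e by (intro image_compactin[OF _ J_cont]) simp
  then have CD: "C \<subseteq> topspace D" by (rule compactin_subset_topspace)
  \<comment> \<open>The conjunction is made atomic to choose the four witnesses as functions of \<open>y\<close>.\<close>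
  define P where "P y F c \<phi> K \<longleftrightarrow>
     finite F \<and> continuous_map D euclideanreal \<phi> \<and> \<phi> y = 1 \<and> (\<forall>z. 0 \<le> \<phi> z) \<and>
     compactin D K \<and> (\<forall>k\<in>F. K \<subseteq> Delta X \<alpha> k) \<and> (\<forall>z. z \<notin> K \<longrightarrow> \<phi> z = 0) \<and>
     (\<forall>z\<in>K. \<forall>s\<in>torus. cmod (g (\<alpha> s (\<sigma> z)) - (\<Sum>k\<in>F. c k * pairing k s)) < e/4)"
    for y F c K and \<phi> :: "'a set \<Rightarrow> real"
  have "\<forall>y\<in>C. \<exists>F c \<phi> K. P y F c \<phi> K"
    unfolding P_def by (intro ballI local_approximation[OF g]) (use CD e in auto)
  then obtain F c \<phi> K where "\<And>y. y \<in> C \<Longrightarrow> P y (F y) (c y) (\<phi> y) (K y)"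
    by metis
  note this[unfolded P_def]
  then have F: "\<And>y. y \<in> C \<Longrightarrow> finite (F y)"
    and \<phi>: "\<And>y. y \<in> C \<Longrightarrow> continuous_map D euclideanreal (\<phi> y)" "\<And>y. y \<in> C \<Longrightarrow> \<phi> y y = 1"
      "\<And>y z. y \<in> C \<Longrightarrow> 0 \<le> \<phi> y z" "\<And>y z. \<lbrakk>y \<in> C; z \<notin> K y\<rbrakk> \<Longrightarrow> \<phi> y z = 0"
    and K: "\<And>y. y \<in> C \<Longrightarrow> compactin D (K y)" "\<And>y k. \<lbrakk>y \<in> C; k \<in> F y\<rbrakk> \<Longrightarrow> K y \<subseteq> Delta X \<alpha> k"
    and approx: "\<And>y z s. \<lbrakk>y \<in> C; z \<in> K y; s \<in> torus\<rbrakk> \<Longrightarrow>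
       cmod (g (\<alpha> s (\<sigma> z)) - (\<Sum>k\<in>F y. c y k * pairing k s)) < e/4"
    by simp_all
  define W where "W y = {z \<in> topspace D. \<phi> y z \<in> {1/2<..}}" for y
  have "openin D (W y)" if "y \<in> C" for y
    unfolding W_def by (rule openin_continuous_map_preimage[OF \<phi>(1)[OF that]]) simp
  moreover have "C \<subseteq> \<Union> (W ` C)" using CD \<phi>(2) by (auto simp: W_def)
  ultimately obtain \<W> where \<W>: "finite \<W>" "\<W> \<subseteq> W ` C" "C \<subseteq> \<Union> \<W>"
    using C unfolding compactin_def by (metis (no_types, lifting) imageE)
  then obtain Y where Y: "finite Y" "Y \<subseteq> C" "\<W> = W ` Y" by (metis finite_subset_image)
  define \<psi> where "\<psi> z = (\<Sum>y\<in>Y. \<phi> y z)" for z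
  define w where "w y z = \<phi> y z / max (\<psi> z) (1/2)" for y z
  have \<psi>_cont: "continuous_map D euclideanreal \<psi>"
    unfolding \<psi>_def using Y \<phi>(1) by (intro continuous_map_sum) auto
  have w_cont: "continuous_map D euclideanreal (w y)" if "y \<in> Y" for y
    unfolding w_def using that Y \<phi>(1) \<psi>_cont by (intro continuous_map_real_divide continuous_map_real_max) auto
  have w_nonneg: "0 \<le> w y z" if "y \<in> Y" for y z using \<phi>(3) that Y by (auto simp: w_def)
  have w_zero: "w y z = 0" if "y \<in> Y" "z \<notin> K y" for y z using \<phi>(4) that Y by (auto simp: w_def)
  define \<theta> where "\<theta> z = (\<Sum>y\<in>Y. w y z)" for z
  have \<theta>: "\<theta> z = \<psi> z / max (\<psi> z) (1/2)" for z by (simp add: \<theta>_def w_def \<psi>_def sum_divide_distrib)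
  have \<psi>_nonneg: "0 \<le> \<psi> z" for z unfolding \<psi>_def using \<phi>(3) Y by (intro sum_nonneg) auto
  have \<theta>01: "0 \<le> \<theta> z" "\<theta> z \<le> 1" for z using \<psi>_nonneg[of z] by (auto simp: \<theta> divide_le_eq)
  have \<theta>1: "\<theta> z = 1" if z: "z \<in> C" for z
  proof -
    obtain y where y: "y \<in> Y" "1/2 < \<phi> y z" using \<W>(3) Y(3) z by (auto simp: W_def)
    have "\<phi> y z \<le> \<psi> z" unfolding \<psi>_def using y Y \<phi>(3) by (intro member_le_sum) auto
    then show ?thesis using y by (simp add: \<theta>)
  qed
  define f where "f = (\<lambda>(z, k). \<Sum>y\<in>Y. of_real (w y z) * (if k \<in> F y then c y k else 0))"
  define E where "E = (\<Union>y\<in>Y. F y)"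
  have f: "fibrewise E f"
    unfolding fibrewise_def
  proof (intro conjI allI impI)
    show "finite E" using Y F by (auto simp: E_def)
    show "f (z, k) = 0" if "k \<notin> E" for z k using that by (auto simp: f_def E_def intro!: sum.neutral)
  next
    fix k
    have "continuous_map D euclidean (\<lambda>z. complex_of_real (w y z))" if "y \<in> Y" for y
      using w_cont[OF that] by (simp add: continuous_map_atin tendsto_of_real)
    then show "continuous_map D euclidean (\<lambda>z. f (z, k))"
      unfolding f_def prod.case using Y by (intro continuous_map_sum continuous_map_mult) auto
    define N where "N = \<Union> (K ` {y \<in> Y. k \<in> F y})"
    have "compactin D N" unfolding N_def using Y K(1) by (intro compactin_Union) auto
    moreover have "N \<subseteq> Delta X \<alpha> k" using K(2) Y by (fastforce simp: N_def)
    moreover have "f (z, k) = 0" if "z \<notin> N" for z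
      unfolding f_def prod.case using that w_zero by (intro sum.neutral) (auto simp: N_def)
    ultimately show "\<exists>K. compactin D K \<and> K \<subseteq> Delta X \<alpha> k \<and> (\<forall>y. y \<notin> K \<longrightarrow> f (y, k) = 0)" by blast
  qed
  have "sa_dist (C0 X) (gelfand f) g \<le> e/2"
    unfolding C0_dist
  proof (rule C0_norm_least)
    fix x assume x: "x \<in> topspace X"
    define z where "z = J x"
    obtain s where s: "s \<in> torus" "x = \<alpha> s (\<sigma> z)" using point_form[OF x] by (auto simp: z_def)
    define q where "q y = (\<Sum>k\<in>F y. c y k * pairing k s)" for y
    have "gelfand f x = (\<Sum>k\<in>E. f (z, k) * pairing k s)"
      unfolding s(2) by (rule gelfand_at[OF f _ s(1)]) (use x J_D in \<open>simp add: z_def\<close>)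
    also have "\<dots> = (\<Sum>y\<in>Y. of_real (w y z) * (\<Sum>k\<in>E. (if k \<in> F y then c y k else 0) * pairing k s))"
      unfolding f_def prod.case sum_distrib_right sum_distrib_left
      by (subst sum.swap) (simp add: mult.assoc)
    also have "\<dots> = (\<Sum>y\<in>Y. of_real (w y z) * q y)"
    proof (rule sum.cong[OF refl])
      fix y assume y: "y \<in> Y"
      have "q y = (\<Sum>k\<in>E. (if k \<in> F y then c y k else 0) * pairing k s)"
        unfolding q_def using y fibrewiseD(1)[OF f] by (intro sum.mono_neutral_cong_left) (auto simp: E_def)
      then show "of_real (w y z) * (\<Sum>k\<in>E. (if k \<in> F y then c y k else 0) * pairing k s) = of_real (w y z) * q y"
        by simp
    qed
    finally have Pf: "gelfand f x = (\<Sum>y\<in>Y. of_real (w y z) * q y)" .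
    have "cmod (gelfand f x - of_real (\<theta> z) * g x) = cmod (\<Sum>y\<in>Y. of_real (w y z) * (q y - g x))"
      by (simp add: Pf \<theta>_def sum_subtractf right_diff_distrib sum_distrib_right)
    also have "\<dots> \<le> (\<Sum>y\<in>Y. w y z * (e/4))"
    proof (rule sum_norm_le)
      fix y assume y: "y \<in> Y"
      show "cmod (of_real (w y z) * (q y - g x)) \<le> w y z * (e/4)"
      proof (cases "z \<in> K y")
        case True
        then have "cmod (g x - q y) < e/4" using approx[of y z s] y Y s by (auto simp: q_def)
        then have "w y z * cmod (q y - g x) \<le> w y z * (e/4)"
          using w_nonneg[OF y, of z] by (intro mult_left_mono) (simp_all add: norm_minus_commute)
        then show ?thesis using w_nonneg[OF y, of z] by (simp add: norm_mult)
      qed (use w_zero[OF y] in simp)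
    qed
    also have "\<dots> = \<theta> z * (e/4)" by (simp add: \<theta>_def sum_distrib_right)
    also have "\<dots> \<le> e/4" using \<theta>01[of z] e mult_right_mono[of "\<theta> z" 1 "e/4"] by simp
    finally have 1: "cmod (gelfand f x - of_real (\<theta> z) * g x) \<le> e/4" .
    have 2: "cmod (of_real (\<theta> z) * g x - g x) \<le> e/4"
    proof (cases "z \<in> C")
      case False
      then have "cmod (g x) \<le> e/4" using x by (force simp: C_def z_def)
      moreover have "cmod (of_real (\<theta> z) * g x - g x) = (1 - \<theta> z) * cmod (g x)"
      proof -
        have "of_real (\<theta> z) * g x - g x = - (of_real (1 - \<theta> z) * g x)" by (simp add: algebra_simps)
        then show ?thesis using \<theta>01[of z] by (simp only: norm_minus_cancel norm_mult norm_of_real)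
      qed
      moreover have "(1 - \<theta> z) * cmod (g x) \<le> 1 * cmod (g x)"
        using \<theta>01[of z] by (intro mult_right_mono) auto
      ultimately show ?thesis by simp
    qed (use \<theta>1 e in simp)
    show "cmod (gelfand f x - g x) \<le> e/2"
      using 1 2 norm_triangle_ineq[of "gelfand f x - of_real (\<theta> z) * g x" "of_real (\<theta> z) * g x - g x"] by simp
  qed (use e in simp)
  then have "sa_dist (C0 X) (gelfand f) g < e" using e by simp
  then show ?thesis using fibrewise_imp_Cc[OF f] by blast
qed

lemma groupoid_cstar_isomorphism:
  "\<exists>\<I>. cstar_isomorphism (C0 X) (groupoid_cstar G) \<I> \<and>
       (\<forall>f\<in>Cc (gtop G). inv_into (sa_carrier (C0 X)) \<I> (Cc_to_cstar G f) = gelfand f)"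
proof -
  let ?A = "Cc_algebra G"
  have A: "sa_carrier ?A = Cc (gtop G)" "sa_zero ?A = (\<lambda>_. 0)" "sa_add ?A = (\<lambda>f g \<gamma>. f \<gamma> + g \<gamma>)"
    "sa_scale ?A = (\<lambda>c f \<gamma>. c * f \<gamma>)" "sa_mult ?A = convolution G" "sa_star ?A = involution G"
    "sa_norm ?A = full_norm G"
    by (simp_all add: Cc_algebra_def)
  have "\<exists>\<I>. cstar_isomorphism (C0 X) (sa_completion ?A) \<I> \<and>
     (\<forall>a\<in>sa_carrier ?A. inv_into (sa_carrier (C0 X)) \<I> (to_completion ?A a) = gelfand a)"
  proof (rule completion_of_dense_isometry[OF cstar_algebra_C0], unfold A C0_simps, goal_cases)
    case 1 show ?case by (rule fibrewise_imp_Cc[OF fibrewise_zero])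
  next
    case 2 then show ?case using Cc_imp_fibrewise fibrewise_imp_Cc fibrewise_add by metis
  next
    case 3 then show ?case using Cc_imp_fibrewise fibrewise_imp_Cc fibrewise_scale by metis
  next
    case 4 then show ?case using Cc_imp_fibrewise fibrewise_imp_Cc fibrewise_convolution by metis
  next
    case 5 then show ?case using Cc_imp_fibrewise fibrewise_imp_Cc fibrewise_involution by metis
  next
    case 6 then show ?case using Cc_imp_fibrewise gelfand_closed by metis
  next
    case 7 show ?case by (rule gelfand_zero)
  next
    case 8 then show ?case using Cc_imp_fibrewise gelfand_add by metis
  next
    case 9 then show ?case using Cc_imp_fibrewise gelfand_scale by metis
  next
    case 10 then show ?case using Cc_imp_fibrewise gelfand_convolution by metis
  next
    case 11 then show ?case using Cc_imp_fibrewise gelfand_involution by metis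
  next
    case 12 then show ?case using Cc_imp_fibrewise full_norm_eq transform_norm_def by metis
  next
    case 13 then show ?case by (rule gelfand_dense)
  qed
  then show ?thesis by (simp add: groupoid_cstar_def Cc_to_cstar_def A)
qed

end

section \<open>The isomorphism\<close>

theorem theorem1p3:
  fixes X :: "'a topology" and \<alpha> :: "complex^'n \<Rightarrow> 'a \<Rightarrow> 'a"
  assumes "Hausdorff_space X" and "locally_compact_space X" and "second_countable X"
    and "torus_action X \<alpha>"
    and "\<exists>\<sigma>. orbit_section X \<alpha> \<sigma>"
  shows "(\<forall>\<sigma>. orbit_section X \<alpha> \<sigma> \<longrightarrow> (\<forall>k.
            openin X (M_set X \<alpha> k) \<and>
            continuous_map (subtopology X (M_set X \<alpha> k)) (top_of_set (sphere 0 1)) (k_fun X \<alpha> \<sigma> k))) \<and>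
         (\<forall>\<sigma>. orbit_section X \<alpha> \<sigma> \<longrightarrow> (\<exists>\<I>.
            cstar_isomorphism (C0 X) (groupoid_cstar (G0 X \<alpha>)) \<I> \<and>
            (\<forall>f\<in>Cc (gtop (G0 X \<alpha>)). \<forall>x\<in>topspace X.
               inv_into (sa_carrier (C0 X)) \<I> (Cc_to_cstar (G0 X \<alpha>) f) x =
                 (\<Sum>\<^sub>\<infinity>k\<in>isotropy_dual X \<alpha> (orbit \<alpha> x). f (orbit \<alpha> x, k) * k_fun X \<alpha> \<sigma> k x))))"
proof (intro conjI allI impI)
  fix \<sigma> k assume "orbit_section X \<alpha> \<sigma>"
  then interpret torus_section X \<alpha> \<sigma>
    using assms by (simp add: torus_section_def torus_section_axioms_def)
  show "openin X (M_set X \<alpha> k)" by (rule openin_M)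
  show "continuous_map (subtopology X (M_set X \<alpha> k)) (top_of_set (sphere 0 1)) (k_fun X \<alpha> \<sigma> k)"
    using k_fun_cont norm_k_fun by (auto simp: continuous_map_in_subtopology)
next
  fix \<sigma> assume "orbit_section X \<alpha> \<sigma>"
  then interpret torus_section X \<alpha> \<sigma>
    using assms by (simp add: torus_section_def torus_section_axioms_def)
  obtain \<I> where "cstar_isomorphism (C0 X) (groupoid_cstar G) \<I>"
    "\<And>f. f \<in> Cc (gtop G) \<Longrightarrow> inv_into (sa_carrier (C0 X)) \<I> (Cc_to_cstar G f) = gelfand f"
    using groupoid_cstar_isomorphism by blast
  then show "\<exists>\<I>. cstar_isomorphism (C0 X) (groupoid_cstar (G0 X \<alpha>)) \<I> \<and>
            (\<forall>f\<in>Cc (gtop (G0 X \<alpha>)). \<forall>x\<in>topspace X.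
               inv_into (sa_carrier (C0 X)) \<I> (Cc_to_cstar (G0 X \<alpha>) f) x =
                 (\<Sum>\<^sub>\<infinity>k\<in>isotropy_dual X \<alpha> (orbit \<alpha> x). f (orbit \<alpha> x, k) * k_fun X \<alpha> \<sigma> k x))"
    by (intro exI[of _ \<I>]) (simp add: gelfand_def)
qed

end
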